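(* Let $p\ge 2$ be an integer, $d\ge1$, $\nu\ge 1$, and let $f:\mathbb{C}\to\mathbb{C}$ be real analytic with $f(0)\ne 0$. There exists a nonempty open set $U\subseteq A_\nu(\mathbb{T}^d)$ of initial data whose solutions under $$-iu_t=\triangle u+u^pf(u),\qquad x\in\mathbb{T}^d,$$ are homoclinic orbits limiting to $u\equiv 0$; that is, for every initial datum in $U$ the solution $u(t)$ exists for all $t\in\mathbb{R}$ and $\lim_{t\to\pm\infty}u(t)=0$ in $A_\nu(\mathbb{T}^d)$.
   Context: Fix $\omega\in\mathbb{R}^d$ (nonzero entries) and let $\mathbb{T}^d=\mathbb{R}^d/\frac{2\pi}{\omega}\mathbb{Z}^d$ be the torus with period $2\pi/\omega_j$ in the $j$-th coordinate. For $k\in\mathbb{Z}^d$ put $|k|=|k_1|+\dots+|k_d|$ and $k\omega x=\sum_j k_j\omega_jx_j$. For $u\in L^1(\mathbb{T}^d)$ let $\hat u(k)=\frac{1}{\mathrm{vol}(\mathbb{T}^d)}\int_{\mathbb{T}^d}u(x)e^{-i\omega kx}dx$ and $\|u\|=\sum_{k\in\mathbb{Z}^d}|\hat u(k)|\nu^{|k|}$. The weighted Wiener algebra $A_\nu(\mathbb{T}^d)$ is the set of complex valued $u\in L^1(\mathbb{T}^d)$ with $\|u\|<\infty$. "Real analytic" means that $f$ may be written as a (convergent) power series in $u$ and its complex conjugate $u^*$. A solution $u:\mathbb{R}\to A_\nu(\mathbb{T}^d)$ is a homoclinic orbit to an equilibrium $\tilde u\in A_\nu(\mathbb{T}^d)$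 if $\lim_{t\to\pm\infty}u(t)=\tilde u$. Solutions are curves in $A_\nu(\mathbb{T}^d)$ whose Fourier coefficients satisfy the system of ODEs obtained from the equation (equivalently, its variation of constants formula). *)

theory Defs
  imports "HOL-Analysis.Analysis"
begin

text \<open>
  A function on the torus, with period \<open>2 * pi / \<omega> $ j\<close> in the \<open>j\<close>-th coordinate, is
  a periodic function on \<open>real ^ 'd\<close>. Entries of \<open>\<omega>\<close> may be negative, whence the absolute
  values in the period cell.
\<close>

definition torus_fun :: "real ^ 'd \<Rightarrow> (real ^ 'd \<Rightarrow> complex) \<Rightarrow> bool" where
  "torus_fun \<omega> u \<longleftrightarrow> (\<forall>j x. u (x + axis j (2 * pi / \<omega> $ j)) = u x)"

definition period_cell :: "real ^ 'd \<Rightarrow> (real ^ 'd) set" where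
  "period_cell \<omega> = cbox 0 (\<chi> j. 2 * pi / \<bar>\<omega> $ j\<bar>)"

definition fourier_coeff :: "real ^ 'd \<Rightarrow> (real ^ 'd \<Rightarrow> complex) \<Rightarrow> int ^ 'd \<Rightarrow> complex" where
  "fourier_coeff \<omega> u k =
     (LINT x : period_cell \<omega> | lebesgue.
        u x * exp (- (\<i> * complex_of_real (\<Sum>j\<in>UNIV. real_of_int (k $ j) * \<omega> $ j * x $ j))))
     / complex_of_real (measure lebesgue (period_cell \<omega>))"

definition index_norm :: "int ^ 'd \<Rightarrow> nat" where
  "index_norm k = (\<Sum>j\<in>UNIV. nat \<bar>k $ j\<bar>)"

text \<open>
  Elements of the weighted Wiener algebra are represented by integrable functions, not by
  classes modulo null sets, so that \<open>wiener_norm\<close> is a seminorm whose kernel consists of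
  the functions that vanish almost everywhere. Continuity, limits and open sets below refer
  to this seminorm; in particular an open set is closed under changes on null sets and
  corresponds to an open set of classes.
\<close>

definition wiener_algebra :: "real ^ 'd \<Rightarrow> real \<Rightarrow> (real ^ 'd \<Rightarrow> complex) set" where
  "wiener_algebra \<omega> \<nu> =
     {u. torus_fun \<omega> u \<and> u absolutely_integrable_on period_cell \<omega> \<and>
         (\<lambda>k. cmod (fourier_coeff \<omega> u k) * \<nu> ^ index_norm k) summable_on UNIV}"

definition wiener_norm :: "real ^ 'd \<Rightarrow> real \<Rightarrow> (real ^ 'd \<Rightarrow> complex) \<Rightarrow> real" where
  "wiener_norm \<omega> \<nu> u =
     (\<Sum>\<^sub>\<infinity>k\<in>UNIV. cmod (fourier_coeff \<omega> u k) * \<nu> ^ index_norm k)"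

definition wiener_dist ::
  "real ^ 'd \<Rightarrow> real \<Rightarrow> (real ^ 'd \<Rightarrow> complex) \<Rightarrow> (real ^ 'd \<Rightarrow> complex) \<Rightarrow> real" where
  "wiener_dist \<omega> \<nu> u v = wiener_norm \<omega> \<nu> (\<lambda>x. u x - v x)"

definition wiener_open :: "real ^ 'd \<Rightarrow> real \<Rightarrow> (real ^ 'd \<Rightarrow> complex) set \<Rightarrow> bool" where
  "wiener_open \<omega> \<nu> U \<longleftrightarrow>
     U \<subseteq> wiener_algebra \<omega> \<nu> \<and>
     (\<forall>u\<in>U. \<exists>\<epsilon>>0. \<forall>v\<in>wiener_algebra \<omega> \<nu>. wiener_dist \<omega> \<nu> v u < \<epsilon> \<longrightarrow> v \<in> U)"

text \<open>
  Real analyticity of a map of the complex plane: around every point the map is the sum of a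
  convergent power series in the increment and its complex conjugate. Maps given by a single
  everywhere convergent power series in \<open>u\<close> and \<open>cnj u\<close> are a special case.
\<close>

definition real_analytic :: "(complex \<Rightarrow> complex) \<Rightarrow> bool" where
  "real_analytic f \<longleftrightarrow>
     (\<forall>z. \<exists>r>0. \<exists>a :: nat \<Rightarrow> nat \<Rightarrow> complex. \<forall>h. cmod h < r \<longrightarrow>
        ((\<lambda>(m, n). a m n * h ^ m * cnj h ^ n) has_sum f (z + h)) UNIV)"

text \<open>
  Global solutions of \<open>-\<i> u\<^sub>t = \<Delta>u + u\<^sup>p f(u)\<close>: continuous curves in the Wiener algebra whose
  Fourier coefficients satisfy the corresponding system of ordinary differential equations,
  the Laplacian acting on the \<open>k\<close>-th coefficient as multiplication by
  \<open>- (\<Sum>j\<in>UNIV. (k $ j * \<omega> $ j)\<^sup>2)\<close>.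
\<close>

definition nls_solution ::
  "real ^ 'd \<Rightarrow> real \<Rightarrow> nat \<Rightarrow> (complex \<Rightarrow> complex) \<Rightarrow> (real \<Rightarrow> real ^ 'd \<Rightarrow> complex) \<Rightarrow> bool" where
  "nls_solution \<omega> \<nu> p f u \<longleftrightarrow>
     (\<forall>t. u t \<in> wiener_algebra \<omega> \<nu>) \<and>
     (\<forall>t. ((\<lambda>s. wiener_dist \<omega> \<nu> (u s) (u t)) \<longlongrightarrow> 0) (at t)) \<and>
     (\<forall>t k. ((\<lambda>s. - \<i> * fourier_coeff \<omega> (u s) k) has_vector_derivative
               (- complex_of_real (\<Sum>j\<in>UNIV. (real_of_int (k $ j) * \<omega> $ j)\<^sup>2)
                  * fourier_coeff \<omega> (u t) k
                + fourier_coeff \<omega> (\<lambda>x. u t x ^ p * f (u t x)) k)) (at t))"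

definition nls_equilibrium ::
  "real ^ 'd \<Rightarrow> real \<Rightarrow> nat \<Rightarrow> (complex \<Rightarrow> complex) \<Rightarrow> (real ^ 'd \<Rightarrow> complex) \<Rightarrow> bool" where
  "nls_equilibrium \<omega> \<nu> p f v \<longleftrightarrow> nls_solution \<omega> \<nu> p f (\<lambda>t. v)"

definition homoclinic_orbit ::
  "real ^ 'd \<Rightarrow> real \<Rightarrow> nat \<Rightarrow> (complex \<Rightarrow> complex) \<Rightarrow>
   (real \<Rightarrow> real ^ 'd \<Rightarrow> complex) \<Rightarrow> (real ^ 'd \<Rightarrow> complex) \<Rightarrow> bool" where
  "homoclinic_orbit \<omega> \<nu> p f u v \<longleftrightarrow>
     nls_solution \<omega> \<nu> p f u \<and> nls_equilibrium \<omega> \<nu> p f v \<and>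
     ((\<lambda>t. wiener_dist \<omega> \<nu> (u t) v) \<longlongrightarrow> 0) at_top \<and>
     ((\<lambda>t. wiener_dist \<omega> \<nu> (u t) v) \<longlongrightarrow> 0) at_bot"

end

theory Submission
  imports Defs
begin

text \<open>
  Constant functions carry the mechanism. To leading order a small constant obeys the planar equation
  \<open>z' = \<i> f(0) z\<^sup>p\<close>. Its solutions \<open>z(t) = c (t + \<i> B)\<^bsup>-1/(p-1)\<^esup>\<close> with \<open>B > 0\<close> miss their singularity,
  exist for all times and tend to \<open>0\<close> at both ends; for large \<open>B\<close> the whole orbit is small
  (\<open>reference_orbit\<close>). The claim is that everything in a ball around \<open>z(0)\<close> follows this orbit.

  The linearisation of \<open>\<i> f(0) u\<^sup>p\<close> along the orbit is multiplication by \<open>\<i> p f(0) z\<^bsup>p-1\<^esup>\<close>, a scalar function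
  of time. It therefore commutes with the Laplacian, and its fundamental solution is \<open>z\<^sup>p\<close>. In the
  variable \<open>y\<close> given by \<open>u = z + z\<^sup>p exp(\<i> t \<Delta>) y\<close> both the Laplacian and the linearisation disappear.
  What remains is an ordinary differential equation in the Wiener algebra, whose right-hand side
  consists of terms at least quadratic in \<open>u - z\<close> and of terms of degree at least \<open>p + 1\<close> in \<open>u\<close>.

  The solution is confined to the tube \<open>\<parallel>u - z\<parallel> \<le> \<eta> \<bar>z\<bar>\<close>, which in terms of \<open>y\<close> reads
  \<open>\<parallel>y\<parallel> \<le> \<eta> \<rho>\<close> with \<open>\<rho> = \<bar>z\<bar>\<^bsup>1-p\<^esup>\<close>. In the tube the right-hand side is bounded by a
  constant of order \<open>\<eta>\<^sup>2 + \<bar>z(0)\<bar>\<close> and has Lipschitz constant of order \<open>(\<eta> + \<bar>z(0)\<bar>) / \<rho>\<close>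
  (\<open>nonlinearity_near_constants\<close>, \<open>field_lipschitz\<close>, \<open>norm_field\<close>). The tube opens linearly in time,
  \<open>\<bar>t\<bar> \<le> \<rho>(t) / \<bar>f(0)\<bar>\<close>, exactly as fast as a bounded right-hand side can move \<open>y\<close>. Hence, once \<open>\<eta>\<close> and
  then \<open>z(0)\<close> are small, a contraction in the norm \<open>sup \<parallel>y\<parallel> / \<rho>\<close> produces a global solution
  (\<open>ode_global_solution_in_tube\<close>), and a continuity argument keeps every solution inside the tube
  (\<open>solution_stays_in_tube\<close>), where \<open>\<parallel>u\<parallel> \<le> 2 \<bar>z\<bar>\<close> tends to \<open>0\<close>.

  For the analysis the Wiener algebra is realised on the Banach space \<open>\<ell>\<^sup>1(\<int>\<^sup>d)\<close> of weighted
  coefficients, evaluated at points of the torus by the absolutely convergent Fourier series. A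
  solution is a curve of merely integrable functions, and its nonlinear term is formed pointwise; that
  such a function equals the sum of its Fourier series almost everywhere is the uniqueness theorem
  \<open>fourier_coeff_zero_imp_negligible\<close>, proved from the Stone-Weierstrass theorem on the torus.
\<close>

section \<open>The Banach space \<open>\<ell>\<^sup>1\<close> over an arbitrary index set\<close>

typedef 'i l1 = "{a :: 'i \<Rightarrow> complex. (\<lambda>i. cmod (a i)) summable_on UNIV}"
  morphisms coeff Abs_l1
  by (rule exI[of _ "\<lambda>_. 0"]) simp

setup_lifting type_definition_l1

lemma coeff_abs_summable: "(\<lambda>i. cmod (coeff a i)) summable_on UNIV"
  using coeff[of a] by simp

lemma l1_eqI: "(\<And>i. coeff a i = coeff b i) \<Longrightarrow> a = b"
  by (metis coeff_inject ext)

instantiation l1 :: (type) real_vector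
begin

lift_definition zero_l1 :: "'a l1" is "\<lambda>_. 0"
  by simp

lift_definition plus_l1 :: "'a l1 \<Rightarrow> 'a l1 \<Rightarrow> 'a l1" is "\<lambda>a b i. a i + b i"
proof -
  fix a b :: "'a \<Rightarrow> complex"
  assume "(\<lambda>i. cmod (a i)) summable_on UNIV" "(\<lambda>i. cmod (b i)) summable_on UNIV"
  from summable_on_add[OF this] show "(\<lambda>i. cmod (a i + b i)) summable_on UNIV"
    by (rule Infinite_Sum.abs_summable_on_comparison_test') (rule norm_triangle_ineq)
qed

lift_definition uminus_l1 :: "'a l1 \<Rightarrow> 'a l1" is "\<lambda>a i. - a i"
  by simp

lift_definition minus_l1 :: "'a l1 \<Rightarrow> 'a l1 \<Rightarrow> 'a l1" is "\<lambda>a b i. a i - b i"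
proof -
  fix a b :: "'a \<Rightarrow> complex"
  assume "(\<lambda>i. cmod (a i)) summable_on UNIV" "(\<lambda>i. cmod (b i)) summable_on UNIV"
  from summable_on_add[OF this] show "(\<lambda>i. cmod (a i - b i)) summable_on UNIV"
    by (rule Infinite_Sum.abs_summable_on_comparison_test') (rule norm_triangle_ineq4)
qed

lift_definition scaleR_l1 :: "real \<Rightarrow> 'a l1 \<Rightarrow> 'a l1" is "\<lambda>r a i. r *\<^sub>R a i"
  by (simp add: summable_on_cmult_right)

instance
  by standard (transfer; simp add: algebra_simps)+

end

lemma coeff_simps [simp]:
  "coeff 0 i = 0" "coeff (a + b) i = coeff a i + coeff b i" "coeff (- a) i = - coeff a i"
  "coeff (a - b) i = coeff a i - coeff b i" "coeff (r *\<^sub>R a) i = r *\<^sub>R coeff a i"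
  by (transfer; simp)+

instantiation l1 :: (type) real_normed_vector
begin

definition norm_l1 :: "'a l1 \<Rightarrow> real" where
  "norm_l1 a = (\<Sum>\<^sub>\<infinity>i\<in>UNIV. cmod (coeff a i))"

definition sgn_l1 :: "'a l1 \<Rightarrow> 'a l1" where
  "sgn_l1 a = a /\<^sub>R norm a"

definition dist_l1 :: "'a l1 \<Rightarrow> 'a l1 \<Rightarrow> real" where
  "dist_l1 a b = norm (a - b)"

definition uniformity_l1 :: "('a l1 \<times> 'a l1) filter" where
  "uniformity_l1 = (INF e\<in>{0 <..}. principal {(x, y). dist x y < e})"

definition open_l1 :: "'a l1 set \<Rightarrow> bool" where
  "open_l1 U \<longleftrightarrow> (\<forall>x\<in>U. \<forall>\<^sub>F (x', y) in uniformity. x' = x \<longrightarrow> y \<in> U)"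

instance
proof
  fix a b :: "'a l1" and r :: real
  show "norm a = 0 \<longleftrightarrow> a = 0"
  proof
    assume "norm a = 0"
    then have "cmod (coeff a i) = 0" for i
      by (intro nonneg_infsum_le_0D[OF _ coeff_abs_summable]) (auto simp: norm_l1_def)
    then show "a = 0" by (intro l1_eqI) simp
  qed (simp add: norm_l1_def)
  show "norm (a + b) \<le> norm a + norm b"
    using coeff_abs_summable[of "a + b"]
    unfolding norm_l1_def
    by (subst infsum_add[OF coeff_abs_summable coeff_abs_summable, symmetric])
       (rule infsum_mono,
        simp_all add: coeff_abs_summable summable_on_add norm_triangle_ineq)
  show "norm (r *\<^sub>R a) = \<bar>r\<bar> * norm a"
    unfolding norm_l1_def by (simp add: infsum_cmult_right')
qed (simp_all only: dist_l1_def uniformity_l1_def open_l1_def sgn_l1_def)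

end

lemma sum_coeff_le_norm: "finite F \<Longrightarrow> (\<Sum>i\<in>F. cmod (coeff a i)) \<le> norm a"
  unfolding norm_l1_def by (rule finite_sum_le_infsum[OF coeff_abs_summable]) auto

lemma cmod_coeff_le: "cmod (coeff a i) \<le> norm a"
  using sum_coeff_le_norm[of "{i}" a] by simp

lemma norm_l1_leI:
  assumes "\<And>F. finite F \<Longrightarrow> (\<Sum>i\<in>F. cmod (coeff a i)) \<le> C"
  shows "norm a \<le> C"
  unfolding norm_l1_def
  by (rule infsum_le_finite_sums[OF coeff_abs_summable]) (use assms in auto)

lemma Abs_l1_bounded:
  assumes "\<And>F. finite F \<Longrightarrow> (\<Sum>i\<in>F. cmod (a i)) \<le> C"
  shows "coeff (Abs_l1 a) = a" "norm (Abs_l1 a) \<le> C"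
proof -
  have "(\<lambda>i. cmod (a i)) summable_on UNIV"
    by (rule nonneg_bdd_above_summable_on) (use assms in \<open>auto intro!: bdd_aboveI2\<close>)
  then show *: "coeff (Abs_l1 a) = a"
    by (simp add: Abs_l1_inverse)
  show "norm (Abs_l1 a) \<le> C"
    by (rule norm_l1_leI) (simp add: * assms)
qed

lemma bounded_linear_coeff: "bounded_linear (\<lambda>a. coeff a i)"
  by (rule bounded_linear_intro[where K = 1]) (auto simp: cmod_coeff_le)

instance l1 :: (type) banach
proof
  fix X :: "nat \<Rightarrow> 'a l1" assume X: "Cauchy X"
  have "Cauchy (\<lambda>n. coeff (X n) i)" for i
    by (rule bounded_linear.Cauchy[OF bounded_linear_coeff X])
  then obtain L where L: "(\<lambda>n. coeff (X n) i) \<longlonglongrightarrow> L i" for i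
    unfolding Cauchy_convergent_iff convergent_def by metis
  have bound: "(\<Sum>i\<in>F. cmod (coeff (X m) i - L i)) \<le> e"
    if N: "\<And>m n. m \<ge> N \<Longrightarrow> n \<ge> N \<Longrightarrow> norm (X m - X n) < e" and F: "finite F" and m: "m \<ge> N"
    for N m e F
  proof (rule tendsto_upperbound)
    show "(\<lambda>n. \<Sum>i\<in>F. cmod (coeff (X m) i - coeff (X n) i)) \<longlonglongrightarrow> (\<Sum>i\<in>F. cmod (coeff (X m) i - L i))"
      by (intro tendsto_intros L)
    show "\<forall>\<^sub>F n in sequentially. (\<Sum>i\<in>F. cmod (coeff (X m) i - coeff (X n) i)) \<le> e"
      using eventually_ge_at_top[of N]
    proof eventually_elim
      case (elim n)
      show ?case using sum_coeff_le_norm[OF F, of "X m - X n"] N[OF m elim] by simp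
    qed
  qed simp
  have Cau: "\<exists>N. \<forall>m\<ge>N. \<forall>n\<ge>N. norm (X m - X n) < e" if "e > 0" for e
    using CauchyD[OF X that] by simp
  obtain N1 where "\<And>m n. m \<ge> N1 \<Longrightarrow> n \<ge> N1 \<Longrightarrow> norm (X m - X n) < 1"
    using Cau[of 1] by auto
  note D = Abs_l1_bounded[where a = "\<lambda>i. coeff (X N1) i - L i", OF bound[OF this _ order_refl]]
  define Y where "Y = X N1 - Abs_l1 (\<lambda>i. coeff (X N1) i - L i)"
  have Y: "coeff Y i = L i" for i
    using D(1) by (simp add: Y_def)
  have "X \<longlonglongrightarrow> Y"
  proof (rule LIMSEQ_I)
    fix r :: real assume "r > 0"
    then obtain N where N: "\<And>m n. m \<ge> N \<Longrightarrow> n \<ge> N \<Longrightarrow> norm (X m - X n) < r / 2"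
      using Cau[of "r / 2"] by auto
    have "norm (X m - Y) \<le> r / 2" if "m \<ge> N" for m
      by (rule norm_l1_leI) (use bound[OF N _ that] Y in simp)
    then show "\<exists>no. \<forall>n\<ge>no. norm (X n - Y) < r"
      using \<open>r > 0\<close> by (intro exI[of _ N]) force
  qed
  then show "convergent X"
    by (auto simp: convergent_def)
qed

definition single :: "'i \<Rightarrow> complex \<Rightarrow> 'i l1" where
  "single i c = Abs_l1 (\<lambda>j. if j = i then c else 0)"

lemma coeff_single [simp]: "coeff (single i c) j = (if j = i then c else 0)"
  and norm_single [simp]: "norm (single i c) = cmod c"
proof -
  have *: "(\<Sum>j\<in>F. cmod (if j = i then c else 0)) \<le> cmod c" if "finite F" for F
  proof -
    have "(\<Sum>j\<in>F. cmod (if j = i then c else 0)) = (\<Sum>j\<in>F. if j = i then cmod c else 0)"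
      by (intro sum.cong) auto
    then show ?thesis using that by (simp add: sum.delta)
  qed
  show coeff: "coeff (single i c) j = (if j = i then c else 0)" for j
    unfolding single_def by (subst Abs_l1_bounded(1)[OF *]) auto
  show "norm (single i c) = cmod c"
  proof (rule antisym)
    show "norm (single i c) \<le> cmod c"
      unfolding single_def by (rule Abs_l1_bounded(2)[OF *])
    show "cmod c \<le> norm (single i c)"
      using cmod_coeff_le[of "single i c" i] by (simp add: coeff)
  qed
qed

lemma bounded_linear_single: "bounded_linear (single i)"
  by (rule bounded_linear_intro[where K = 1]) (auto intro!: l1_eqI)

lemma has_sum_single: "((\<lambda>i. single i (coeff a i)) has_sum a) UNIV"
proof -
  have "(\<lambda>i. single i (coeff a i)) summable_on UNIV"
    by (rule abs_summable_summable) (simp add: coeff_abs_summable)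
  then obtain S where S: "((\<lambda>i. single i (coeff a i)) has_sum S) UNIV"
    by (auto simp: summable_on_def)
  have "S = a"
  proof (rule l1_eqI)
    fix j
    have "((\<lambda>i. coeff (single i (coeff a i)) j) has_sum coeff S j) UNIV"
      by (rule has_sum_bounded_linear[OF bounded_linear_coeff S])
    moreover have "((\<lambda>i. coeff (single i (coeff a i)) j) has_sum coeff a j) UNIV"
      by (rule has_sum_finite_neutralI[of "{j}"]) auto
    ultimately show "coeff S j = coeff a j"
      by (rule has_sum_unique)
  qed
  with S show ?thesis by simp
qed

lemma norm_l1_has_sum: "((\<lambda>i. cmod (coeff a i)) has_sum norm a) UNIV"
  unfolding norm_l1_def by (rule has_sum_infsum[OF coeff_abs_summable])

text \<open>
  The bound on a curve in \<open>\<ell>\<^sup>1\<close> needs derivatives of the single coefficients only: the finite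
  partial sums of the norm of an increment are attained by pairing it with unimodular numbers,
  and the scalar curve so obtained obeys the mean value inequality.
\<close>

lemma l1_mean_value_inequality:
  fixes Y :: "real \<Rightarrow> 'i l1" and g :: "real \<Rightarrow> 'i l1"
  assumes deriv: "\<And>i s. s \<in> closed_segment 0 t \<Longrightarrow>
      ((\<lambda>s. coeff (Y s) i) has_vector_derivative coeff (g s) i) (at s)"
    and bound: "\<And>s. s \<in> closed_segment 0 t \<Longrightarrow> norm (g s) \<le> c"
  shows "norm (Y t - Y 0) \<le> c * \<bar>t\<bar>"
proof (rule norm_l1_leI)
  fix F :: "'i set" assume F: "finite F"
  define \<theta> where "\<theta> i = cnj (sgn (coeff (Y t - Y 0) i))" for i
  have \<theta>: "\<theta> i * coeff (Y t - Y 0) i = of_real (cmod (coeff (Y t - Y 0) i))" "cmod (\<theta> i) \<le> 1" for i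
  proof -
    show "\<theta> i * coeff (Y t - Y 0) i = of_real (cmod (coeff (Y t - Y 0) i))"
      using complex_norm_square[of "coeff (Y t - Y 0) i"]
      by (cases "coeff (Y t - Y 0) i = 0")
         (auto simp: \<theta>_def sgn_eq field_simps power2_eq_square mult.commute)
    show "cmod (\<theta> i) \<le> 1" by (simp add: \<theta>_def norm_sgn)
  qed
  define \<phi> where "\<phi> s = (\<Sum>i\<in>F. \<theta> i * coeff (Y s) i)" for s
  have der: "(\<phi> has_vector_derivative (\<Sum>i\<in>F. \<theta> i * coeff (g s) i)) (at s within closed_segment 0 t)"
    if "s \<in> closed_segment 0 t" for s
    unfolding \<phi>_def
    by (intro has_vector_derivative_sum has_vector_derivative_mult_right
        has_vector_derivative_at_within[OF deriv[OF that]])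
  have le: "cmod (\<Sum>i\<in>F. \<theta> i * coeff (g s) i) \<le> c" if "s \<in> closed_segment 0 t" for s
  proof -
    have "cmod (\<Sum>i\<in>F. \<theta> i * coeff (g s) i) \<le> (\<Sum>i\<in>F. cmod (coeff (g s) i))"
      by (rule order.trans[OF norm_sum]) (auto intro!: sum_mono mult_left_le_one_le \<theta>(2) simp: norm_mult)
    also have "\<dots> \<le> norm (g s)" by (rule sum_coeff_le_norm[OF F])
    finally show ?thesis using bound[OF that] by simp
  qed
  have "norm (\<phi> t - \<phi> 0) \<le> c * norm (t - 0)"
  proof (rule differentiable_bound)
    show "convex (closed_segment 0 t)" by simp
    show "(\<phi> has_derivative (\<lambda>x. x *\<^sub>R (\<Sum>i\<in>F. \<theta> i * coeff (g s) i))) (at s within closed_segment 0 t)"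
      if "s \<in> closed_segment 0 t" for s
      using der[OF that] by (simp add: has_vector_derivative_def)
    show "onorm (\<lambda>x. x *\<^sub>R (\<Sum>i\<in>F. \<theta> i * coeff (g s) i)) \<le> c" if "s \<in> closed_segment 0 t" for s
      using mult_right_mono[OF le[OF that] abs_ge_zero] by (intro onorm_le) (simp add: mult.commute)
  qed auto
  also have "\<phi> t - \<phi> 0 = (\<Sum>i\<in>F. \<theta> i * coeff (Y t - Y 0) i)"
    by (simp add: \<phi>_def sum_subtractf algebra_simps)
  also have "\<dots> = of_real (\<Sum>i\<in>F. cmod (coeff (Y t - Y 0) i))"
    unfolding \<theta>(1) by simp
  finally show "(\<Sum>i\<in>F. cmod (coeff (Y t - Y 0) i)) \<le> c * \<bar>t\<bar>"
    by (simp only: norm_of_real) (simp add: sum_nonneg)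
qed

section \<open>Analytic nonlinearities in Banach algebras of functions\<close>

text \<open>
  A commutative Banach algebra of complex functions, given by its evaluations: \<open>ev x a\<close> is the value of
  \<open>a\<close> at \<open>x\<close>. Since evaluations separate elements, every algebraic identity is verified pointwise.
  Complex scalars act through the constants \<open>cst c\<close>, the only linear structure on the type being real.
\<close>

locale function_algebra =
  fixes ev :: "'x \<Rightarrow> 'a::banach \<Rightarrow> complex"
    and mul :: "'a \<Rightarrow> 'a \<Rightarrow> 'a" (infixl "\<odot>" 70)
    and cst :: "complex \<Rightarrow> 'a"
    and conj :: "'a \<Rightarrow> 'a"
  assumes ev_linear: "bounded_linear (ev x)"
    and norm_ev: "cmod (ev x a) \<le> norm a"
    and ev_inject: "(\<And>x. ev x a = ev x b) \<Longrightarrow> a = b"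
    and ev_mul: "ev x (a \<odot> b) = ev x a * ev x b"
    and ev_cst: "ev x (cst c) = c"
    and ev_conj: "ev x (conj a) = cnj (ev x a)"
    and norm_mul: "norm (a \<odot> b) \<le> norm a * norm b"
    and norm_cst: "norm (cst c) \<le> cmod c"
    and norm_conj: "norm (conj a) \<le> norm a"
begin

sublocale ev: bounded_linear "ev x" for x
  by (rule ev_linear)

lemmas ev_simps = ev.add ev.diff ev.zero ev.neg ev.scaleR ev_mul ev_cst ev_conj

lemma bounded_bilinear_mul: "bounded_bilinear (\<odot>)"
  by standard
     (auto intro!: ev_inject exI[of _ 1] norm_mul simp: ev_simps algebra_simps scaleR_conv_of_real)

sublocale mul: bounded_bilinear "(\<odot>)"
  by (rule bounded_bilinear_mul)

lemma bounded_linear_cst: "bounded_linear cst"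
  by (rule bounded_linear_intro[where K = 1])
     (auto intro!: ev_inject norm_cst simp: ev_simps)

lemma bounded_linear_conj: "bounded_linear conj"
  by (rule bounded_linear_intro[where K = 1])
     (auto intro!: ev_inject norm_conj simp: ev_simps)

sublocale cst: bounded_linear cst
  by (rule bounded_linear_cst)

sublocale conj: bounded_linear conj
  by (rule bounded_linear_conj)

lemma norm_conj_diff: "norm (conj a - conj b) \<le> norm (a - b)"
  using norm_conj[of "a - b"] by (simp add: conj.diff)

primrec pow :: "'a \<Rightarrow> nat \<Rightarrow> 'a" where
  "pow a 0 = cst 1"
| "pow a (Suc n) = a \<odot> pow a n"

lemma ev_pow: "ev x (pow a n) = ev x a ^ n"
  by (induction n) (auto simp: ev_simps)

lemma norm_mul_le: "norm a \<le> A \<Longrightarrow> norm b \<le> B \<Longrightarrow> norm (a \<odot> b) \<le> A * B"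
  by (rule order.trans[OF norm_mul]) (auto intro!: mult_mono intro: order.trans[OF norm_ge_zero])

lemma norm_pow: "norm a \<le> s \<Longrightarrow> norm (pow a n) \<le> s ^ n"
  by (induction n) (use norm_cst[of 1] in \<open>auto intro!: norm_mul_le\<close>)

lemma norm_mul_diff_le:
  assumes "norm a \<le> A" "norm b' \<le> B" "norm (a - a') \<le> D" "norm (b - b') \<le> E"
  shows "norm (a \<odot> b - a' \<odot> b') \<le> A * E + D * B"
proof -
  have "a \<odot> b - a' \<odot> b' = a \<odot> (b - b') + (a - a') \<odot> b'"
    by (simp add: mul.diff_right mul.diff_left)
  also have "norm \<dots> \<le> A * E + D * B"
    by (intro norm_triangle_le add_mono norm_mul_le assms)
  finally show ?thesis .
qed

lemma norm_pow_diff: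
  assumes "norm a \<le> s" "norm b \<le> s"
  shows "norm (pow a n - pow b n) \<le> real n * s ^ (n - 1) * norm (a - b)"
proof (induction n)
  case (Suc n)
  have "norm (pow a (Suc n) - pow b (Suc n))
      \<le> s * (real n * s ^ (n - 1) * norm (a - b)) + norm (a - b) * s ^ n"
    unfolding pow.simps by (rule norm_mul_diff_le) (use assms Suc norm_pow in auto)
  also have "\<dots> = real (Suc n) * s ^ (Suc n - 1) * norm (a - b)"
    by (cases n) (auto simp: algebra_simps)
  finally show ?case .
qed simp

text \<open>
  Second-order Taylor estimate of the power map at a constant: the linear part is removed, so one
  factor of the distance to the constant is gained in the Lipschitz constant.
\<close>

lemma norm_pow_taylor_diff:
  assumes "norm u \<le> s" "norm v \<le> s" "cmod c \<le> s" "norm (u - cst c) \<le> e" "norm (v - cst c) \<le> e"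
  shows "norm (pow u (n + 2) - pow v (n + 2) - cst (of_nat (n + 2) * c ^ (n + 1)) \<odot> (u - v))
    \<le> real ((n + 2) * (n + 1)) * s ^ n * e * norm (u - v)"
proof (induction n)
  case 0
  have "pow u (0 + 2) - pow v (0 + 2) - cst (of_nat (0 + 2) * c ^ (0 + 1)) \<odot> (u - v)
      = ((u - cst c) + (v - cst c)) \<odot> (u - v)"
    by (rule ev_inject) (simp add: numeral_2_eq_2 ev_simps algebra_simps)
  also have "norm \<dots> \<le> (e + e) * norm (u - v)"
    by (intro norm_mul_le norm_triangle_le add_mono assms order_refl)
  finally show ?case by simp
next
  case (Suc n)
  have s: "0 \<le> s" using assms(1) norm_ge_zero order.trans by blast
  have e: "0 \<le> e" using assms(4) norm_ge_zero order.trans by blast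
  define m where "m = n + 2"
  have "norm (cst c) \<le> s"
    using norm_cst[of c] assms(3) by simp
  have "pow u (Suc m) - pow v (Suc m) - cst (of_nat (Suc m) * c ^ m) \<odot> (u - v)
    = u \<odot> (pow u m - pow v m - cst (of_nat m * c ^ (m - 1)) \<odot> (u - v))
      + cst (of_nat m * c ^ (m - 1)) \<odot> ((u - cst c) \<odot> (u - v))
      + (pow v m - pow (cst c) m) \<odot> (u - v)" (is "_ = ?A + ?B + ?C")
    by (rule ev_inject) (simp add: ev_simps ev_pow algebra_simps m_def)
  moreover have "norm ?A \<le> s * (real ((n + 2) * (n + 1)) * s ^ n * e * norm (u - v))"
    by (rule norm_mul_le) (use Suc assms in \<open>simp_all add: m_def\<close>)
  moreover have "norm ?B \<le> (real m * s ^ (m - 1)) * (e * norm (u - v))"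
  proof (intro norm_mul_le assms order_refl)
    have "norm (cst (of_nat m * c ^ (m - 1))) \<le> real m * cmod c ^ (m - 1)"
      using norm_cst[of "of_nat m * c ^ (m - 1)"] by (simp add: norm_mult norm_power)
    also have "\<dots> \<le> real m * s ^ (m - 1)"
      by (intro mult_left_mono power_mono assms) auto
    finally show "norm (cst (of_nat m * c ^ (m - 1))) \<le> real m * s ^ (m - 1)" .
  qed
  moreover have "norm ?C \<le> (real m * s ^ (m - 1) * e) * norm (u - v)"
  proof (intro norm_mul_le order_refl)
    have "norm (pow v m - pow (cst c) m) \<le> real m * s ^ (m - 1) * norm (v - cst c)"
      by (rule norm_pow_diff) fact+
    also have "\<dots> \<le> real m * s ^ (m - 1) * e"
      using s by (intro mult_left_mono assms) auto
    finally show "norm (pow v m - pow (cst c) m) \<le> real m * s ^ (m - 1) * e" .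
  qed
  ultimately have "norm (pow u (Suc m) - pow v (Suc m) - cst (of_nat (Suc m) * c ^ m) \<odot> (u - v))
    \<le> s * (real ((n + 2) * (n + 1)) * s ^ n * e * norm (u - v))
      + (real m * s ^ (m - 1)) * (e * norm (u - v)) + (real m * s ^ (m - 1) * e) * norm (u - v)"
    by (simp only:) (intro norm_triangle_le add_mono)
  also have "\<dots> = real ((Suc n + 2) * (Suc n + 1)) * s ^ Suc n * e * norm (u - v)"
    by (simp add: m_def algebra_simps)
  finally show ?case by (simp add: m_def)
qed

definition monomial :: "nat \<Rightarrow> (nat \<Rightarrow> nat \<Rightarrow> complex) \<Rightarrow> nat \<times> nat \<Rightarrow> 'a \<Rightarrow> 'a" where
  "monomial p A = (\<lambda>(m, n) u. cst (A m n) \<odot> (pow u (p + m) \<odot> pow (conj u) n))"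

lemma ev_monomial:
  "ev x (monomial p A (m, n) u) = ev x u ^ p * (A m n * ev x u ^ m * cnj (ev x u) ^ n)"
  by (simp add: monomial_def ev_simps ev_pow power_add)

lemma norm_monomial_diff:
  assumes "norm u \<le> s" "norm v \<le> s"
  shows "norm (monomial p A (m, n) u - monomial p A (m, n) v)
    \<le> cmod (A m n) * (real (p + m + n) * s ^ (p + m + n - 1)) * norm (u - v)"
proof -
  have s: "0 \<le> s" using assms(1) norm_ge_zero order.trans by blast
  have conj: "norm (conj u) \<le> s" "norm (conj v) \<le> s"
    using assms norm_conj[of u] norm_conj[of v] by auto
  have "norm (pow u (p + m) \<odot> pow (conj u) n - pow v (p + m) \<odot> pow (conj v) n)
    \<le> s ^ (p + m) * (real n * s ^ (n - 1) * norm (u - v))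
      + (real (p + m) * s ^ (p + m - 1) * norm (u - v)) * s ^ n"
  proof (rule norm_mul_diff_le)
    have "norm (pow (conj u) n - pow (conj v) n) \<le> real n * s ^ (n - 1) * norm (conj u - conj v)"
      by (rule norm_pow_diff) fact+
    also have "\<dots> \<le> real n * s ^ (n - 1) * norm (u - v)"
      using s by (intro mult_left_mono norm_conj_diff) auto
    finally show "norm (pow (conj u) n - pow (conj v) n) \<le> real n * s ^ (n - 1) * norm (u - v)" .
  qed (rule norm_pow norm_pow_diff assms conj)+
  also have "s ^ (p + m) * (real n * s ^ (n - 1) * norm (u - v))
      = real n * s ^ (p + m + n - 1) * norm (u - v)"
    by (cases n) (auto simp: power_add)
  also have "(real (p + m) * s ^ (p + m - 1) * norm (u - v)) * s ^ n
      = real (p + m) * s ^ (p + m + n - 1) * norm (u - v)"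
    by (cases "p + m") (auto simp: power_add)
  finally have *: "norm (pow u (p + m) \<odot> pow (conj u) n - pow v (p + m) \<odot> pow (conj v) n)
      \<le> real (p + m + n) * s ^ (p + m + n - 1) * norm (u - v)"
    by (simp add: algebra_simps)
  have "norm (cst (A m n) \<odot> (pow u (p + m) \<odot> pow (conj u) n - pow v (p + m) \<odot> pow (conj v) n))
    \<le> cmod (A m n) * (real (p + m + n) * s ^ (p + m + n - 1) * norm (u - v))"
    by (rule norm_mul_le[OF norm_cst *])
  then show ?thesis
    by (simp add: monomial_def mul.diff_right mult.assoc)
qed

text \<open>
  The terms of the series of \<open>u\<^sup>p f(u)\<close> other than \<open>f(0) u\<^sup>p\<close> have degree at least \<open>p + 1\<close>; their
  sum therefore has a Lipschitz constant of order \<open>s\<^sup>p\<close> on the ball of radius \<open>s\<close>.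
\<close>

lemma higher_order_terms:
  fixes A :: "nat \<Rightarrow> nat \<Rightarrow> complex" and f :: "complex \<Rightarrow> complex"
  assumes p: "p \<ge> 1" and r: "r > 0"
    and f: "\<And>h. cmod h \<le> 2 * r \<Longrightarrow> ((\<lambda>(m, n). A m n * h ^ m * cnj h ^ n) has_sum f h) UNIV"
  obtains G :: "'a \<Rightarrow> 'a" and C where "C \<ge> 0"
    "\<And>u x. norm u \<le> r \<Longrightarrow> ev x (cst (f 0) \<odot> pow u p + G u) = ev x u ^ p * f (ev x u)"
    "\<And>u v s. norm u \<le> s \<Longrightarrow> norm v \<le> s \<Longrightarrow> s \<le> r \<Longrightarrow> norm (G u - G v) \<le> C * s ^ p * norm (u - v)"
    "G 0 = 0"
proof -
  have f0: "f 0 = A 0 0"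
  proof -
    have "((\<lambda>(m, n). A m n * 0 ^ m * cnj 0 ^ n) has_sum A 0 0) UNIV"
    proof (rule has_sum_finite_neutralI[of "{(0, 0)}"])
      fix i :: "nat \<times> nat" assume i: "i \<in> UNIV - {(0, 0)}"
      obtain m n where mn: "i = (m, n)" by force
      then have "m \<noteq> 0 \<or> n \<noteq> 0" using i by simp
      then show "(case i of (m, n) \<Rightarrow> A m n * 0 ^ m * cnj 0 ^ n) = 0"
        by (auto simp: mn power_0_left)
    qed simp_all
    then show ?thesis
      using f[of 0] r by (simp add: has_sum_unique)
  qed
  define I where "I = UNIV - {(0 :: nat, 0 :: nat)}"
  define w where "w = (\<lambda>(m, n). cmod (A m n) * (2 * r) ^ (m + n))"
  have w: "w summable_on UNIV"
  proof -
    have "(\<lambda>(m, n). A m n * (2 * r) ^ m * cnj (2 * r) ^ n) summable_on UNIV"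
      using f[of "of_real (2 * r)"] r by (auto simp: summable_on_def)
    then show ?thesis
      using r unfolding summable_on_iff_abs_summable_on_complex
      by (simp add: case_prod_unfold norm_mult norm_power w_def power_add mult.assoc)
  qed
  have wI: "w summable_on I"
    by (rule summable_on_subset_banach[OF w]) auto
  define K where "K = real p / r"
  define C where "C = K * infsum w I"
  have K: "K \<ge> 0" using r by (simp add: K_def)
  have w0: "w i \<ge> 0" for i using r by (cases i) (simp add: w_def)
  have lip: "norm (monomial p A i u - monomial p A i v) \<le> K * s ^ p * norm (u - v) * w i"
    if "norm u \<le> s" "norm v \<le> s" "s \<le> r" "i \<in> I" for u v s i
  proof -
    obtain m n where i: "i = (m, n)" by force
    define k where "k = m + n - 1"
    have k: "m + n = Suc k" using that(4) by (auto simp: i I_def k_def)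
    have s: "0 \<le> s" using that(1) norm_ge_zero order.trans by blast
    \<comment> \<open>The degree in front of the monomial is absorbed by doubling the radius in the weights \<open>w\<close>.\<close>
    have pow2: "real (p + Suc k) \<le> real p * 2 ^ Suc k"
    proof -
      have "p + Suc k \<le> p * Suc (Suc k)" using p by (cases p) auto
      also have "\<dots> \<le> p * 2 ^ Suc k" using less_exp[of "Suc k"] by (intro mult_left_mono) linarith+
      finally have "real (p + Suc k) \<le> real (p * 2 ^ Suc k)" by (rule of_nat_mono)
      then show ?thesis by simp
    qed
    have "norm (monomial p A i u - monomial p A i v)
        \<le> cmod (A m n) * (real (p + m + n) * s ^ (p + m + n - 1)) * norm (u - v)"
      unfolding i by (rule norm_monomial_diff) fact+
    also have "p + m + n = p + Suc k" using k by simp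
    also have "cmod (A m n) * (real (p + Suc k) * s ^ (p + Suc k - 1)) * norm (u - v)
       \<le> cmod (A m n) * ((real p * 2 ^ Suc k) * (s ^ p * r ^ k)) * norm (u - v)"
      using s that(3) pow2
      by (intro mult_right_mono mult_left_mono mult_mono) (auto simp: power_add intro!: power_mono mult_left_mono)
    also have "\<dots> = K * s ^ p * norm (u - v) * w i"
      using r by (simp add: i w_def K_def k power_mult_distrib field_simps)
    finally show ?thesis .
  qed
  have mon0: "monomial p A i 0 = 0" for i
    using p by (cases i; cases p) (auto simp: monomial_def mul.zero_left mul.zero_right)
  define G where "G u = infsum (\<lambda>i. monomial p A i u) I" for u
  have G: "((\<lambda>i. monomial p A i u) has_sum G u) I" if "norm u \<le> r" for u
    unfolding G_def
  proof (rule has_sum_infsum[OF abs_summable_summable])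
    show "(\<lambda>i. norm (monomial p A i u)) summable_on I"
    proof (rule Infinite_Sum.abs_summable_on_comparison_test')
      show "(\<lambda>i. K * r ^ p * norm (u - 0) * w i) summable_on I"
        by (intro summable_on_cmult_right wI)
      show "norm (monomial p A i u) \<le> K * r ^ p * norm (u - 0) * w i" if "i \<in> I" for i
        using lip[OF \<open>norm u \<le> r\<close>, of 0 i] that r by (simp add: mon0)
    qed
  qed
  show ?thesis
  proof
    show "C \<ge> 0" using K w0 by (auto simp: C_def intro!: mult_nonneg_nonneg infsum_nonneg)
    show "G 0 = 0" by (simp add: G_def mon0)
  next
    fix u v :: 'a and s
    assume uv: "norm u \<le> s" "norm v \<le> s" "s \<le> r"
    have "norm (G u - G v) \<le> K * s ^ p * norm (u - v) * infsum w I"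
    proof (rule norm_infsum_le)
      show "((\<lambda>i. monomial p A i u - monomial p A i v) has_sum (G u - G v)) I"
        using has_sum_add[OF G[of u] has_sum_bounded_linear[OF bounded_linear_minus[OF bounded_linear_ident] G[of v]]] uv by simp
      show "((\<lambda>i. K * s ^ p * norm (u - v) * w i) has_sum (K * s ^ p * norm (u - v) * infsum w I)) I"
        by (intro has_sum_cmult_right has_sum_infsum wI)
    qed (use lip uv in auto)
    then show "norm (G u - G v) \<le> C * s ^ p * norm (u - v)"
      by (simp add: C_def mult_ac)
  next
    fix u :: 'a and x assume u: "norm u \<le> r"
    define h where "h = ev x u"
    have h: "cmod h \<le> 2 * r" using norm_ev[of x u] u r by (simp add: h_def)
    have "((\<lambda>i. ev x (monomial p A i u)) has_sum ev x (G u)) I"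
      by (rule has_sum_bounded_linear[OF ev_linear G[OF u]])
    moreover have "((\<lambda>i. ev x (monomial p A i u)) has_sum (h ^ p * f h - h ^ p * A 0 0)) I"
    proof -
      have "((\<lambda>i. h ^ p * (case i of (m, n) \<Rightarrow> A m n * h ^ m * cnj h ^ n)) has_sum (h ^ p * f h)) UNIV"
        by (rule has_sum_cmult_right[OF f[OF h]])
      moreover have "ev x (monomial p A i u) = h ^ p * (case i of (m, n) \<Rightarrow> A m n * h ^ m * cnj h ^ n)" for i
        by (cases i) (simp add: ev_monomial h_def)
      ultimately have "((\<lambda>i. ev x (monomial p A i u)) has_sum (h ^ p * f h)) UNIV"
        by (simp only:)
      then have "((\<lambda>i. ev x (monomial p A i u)) has_sum
          (h ^ p * f h - sum (\<lambda>i. ev x (monomial p A i u)) {(0, 0)})) I"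
        unfolding I_def by (intro has_sum_Diff has_sum_finite) auto
      then show ?thesis by (simp add: ev_monomial h_def)
    qed
    ultimately have "ev x (G u) = h ^ p * f h - h ^ p * A 0 0"
      by (rule has_sum_unique)
    then show "ev x (cst (f 0) \<odot> pow u p + G u) = ev x u ^ p * f (ev x u)"
      by (simp add: ev_simps ev_pow h_def f0)
  qed
qed

lemma continuous_on_pow: "continuous_on S (\<lambda>u. pow u n)"
  by (induction n) (auto intro!: continuous_intros mul.continuous_on)

text \<open>
  The two estimates that close the argument. Near a constant \<open>c\<close> the map \<open>u \<mapsto> u\<^sup>p f(u)\<close>, less the
  linearisation of \<open>f(0) u\<^sup>p\<close> at \<open>c\<close>, has a Lipschitz constant that is smaller than \<open>\<bar>c\<bar>\<^bsup>p-1\<^esup>\<close>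
  by the factor \<open>\<eta> + \<bar>c\<bar>\<close>: the first summand is the relative distance to \<open>c\<close> and comes from
  the second-order part of \<open>f(0) u\<^sup>p\<close>, the second one comes from the terms of higher degree. At \<open>c\<close>
  itself only the latter survive. Here and below \<open>p = n + 2\<close>.
\<close>

theorem nonlinearity_near_constants:
  fixes f :: "complex \<Rightarrow> complex" and n :: nat
  assumes f: "real_analytic f"
  obtains N :: "'a \<Rightarrow> 'a" and r K :: real where "r > 0" "K \<ge> 0"
    "\<And>u x. norm u \<le> r \<Longrightarrow> ev x (N u) = ev x u ^ (n + 2) * f (ev x u)"
    "continuous_on (cball 0 r) N"
    "\<And>c u v \<eta>. 2 * cmod c \<le> r \<Longrightarrow> \<eta> \<le> 1 \<Longrightarrow>
       norm (u - cst c) \<le> \<eta> * cmod c \<Longrightarrow> norm (v - cst c) \<le> \<eta> * cmod c \<Longrightarrow>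
       norm (N u - N v - cst (of_nat (n + 2) * f 0 * c ^ (n + 1)) \<odot> (u - v))
         \<le> K * (\<eta> + cmod c) * cmod c ^ (n + 1) * norm (u - v)"
    "\<And>c. 2 * cmod c \<le> r \<Longrightarrow> norm (N (cst c) - cst (f 0 * c ^ (n + 2))) \<le> K * cmod c ^ (n + 3)"
proof -
  obtain r\<^sub>0 A where r0: "r\<^sub>0 > 0"
    and A: "\<And>h. cmod h < r\<^sub>0 \<Longrightarrow> ((\<lambda>(m, n). A m n * h ^ m * cnj h ^ n) has_sum f (0 + h)) UNIV"
    using f[unfolded real_analytic_def, THEN spec[of _ 0]] by blast
  \<comment> \<open>The series is needed at radius \<open>2 * r\<close>, strictly inside the disc of convergence.\<close>
  define r where "r = r\<^sub>0 / 4"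
  have r: "r > 0" using r0 by (simp add: r_def)
  have A': "((\<lambda>(m, n). A m n * h ^ m * cnj h ^ n) has_sum f h) UNIV" if "cmod h \<le> 2 * r" for h
    using A[of h] that r0 by (simp add: r_def)
  have p: "n + 2 \<ge> 1" by simp
  note higher = higher_order_terms[of "n + 2" r A f]
  obtain G :: "'a \<Rightarrow> 'a" and C where C: "C \<ge> 0"
    and G_ev: "\<And>u x. norm u \<le> r \<Longrightarrow> ev x (cst (f 0) \<odot> pow u (n + 2) + G u) = ev x u ^ (n + 2) * f (ev x u)"
    and G_lip: "\<And>u v s. norm u \<le> s \<Longrightarrow> norm v \<le> s \<Longrightarrow> s \<le> r \<Longrightarrow> norm (G u - G v) \<le> C * s ^ (n + 2) * norm (u - v)"
    and G0: "G 0 = 0"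
    by (rule higher[OF p r A'], assumption, rule that)
  define N where "N u = cst (f 0) \<odot> pow u (n + 2) + G u" for u
  define K where "K = cmod (f 0) * (real ((n + 2) * (n + 1)) * 2 ^ n) + C * 2 ^ (n + 2)"
  have K: "K \<ge> 0" "C \<le> K"
  proof -
    show "K \<ge> 0" using C by (simp add: K_def)
    have "C * 1 \<le> C * 2 ^ (n + 2)" using C by (intro mult_left_mono one_le_power) auto
    moreover have "0 \<le> cmod (f 0) * (real ((n + 2) * (n + 1)) * 2 ^ n)" by simp
    ultimately show "C \<le> K" unfolding K_def by linarith
  qed
  have "(C * r ^ (n + 2))-lipschitz_on (cball 0 r) G"
    using G_lip[OF _ _ order_refl] C r by (intro lipschitz_onI) (auto simp: dist_norm)
  then have contG: "continuous_on (cball 0 r) G"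
    by (rule lipschitz_on_continuous_on)
  have contN: "continuous_on (cball 0 r) N"
    unfolding N_def by (intro continuous_on_add contG mul.continuous_on continuous_on_const continuous_on_pow)
  have lip: "norm (N u - N v - cst (of_nat (n + 2) * f 0 * c ^ (n + 1)) \<odot> (u - v))
         \<le> K * (\<eta> + cmod c) * cmod c ^ (n + 1) * norm (u - v)"
    if c: "2 * cmod c \<le> r" and \<eta>: "\<eta> \<le> 1" and u: "norm (u - cst c) \<le> \<eta> * cmod c"
      and v: "norm (v - cst c) \<le> \<eta> * cmod c" for c u v \<eta>
  proof -
    define \<sigma> where "\<sigma> = cmod c"
    have "\<eta> * cmod c \<le> 1 * cmod c" using \<eta> by (intro mult_right_mono) auto
    then have near: "norm w \<le> 2 * \<sigma>" if "norm (w - cst c) \<le> \<eta> * cmod c" for w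
      using norm_triangle_ineq[of "w - cst c" "cst c"] that norm_cst[of c] by (simp add: \<sigma>_def)
    have "N u - N v - cst (of_nat (n + 2) * f 0 * c ^ (n + 1)) \<odot> (u - v)
      = cst (f 0) \<odot> (pow u (n + 2) - pow v (n + 2) - cst (of_nat (n + 2) * c ^ (n + 1)) \<odot> (u - v)) + (G u - G v)"
    proof (rule ev_inject)
      have ring: "a * q + g - (a * q' + g') - m * a * b * d = a * (q - q' - m * b * d) + (g - g')"
        for a b d g g' m q q' :: complex
        by (simp add: algebra_simps)
      show "ev x (N u - N v - cst (of_nat (n + 2) * f 0 * c ^ (n + 1)) \<odot> (u - v))
        = ev x (cst (f 0) \<odot> (pow u (n + 2) - pow v (n + 2) - cst (of_nat (n + 2) * c ^ (n + 1)) \<odot> (u - v)) + (G u - G v))" for x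
        unfolding N_def ev_simps by (rule ring)
    qed
    also have "norm \<dots> \<le> cmod (f 0) * (real ((n + 2) * (n + 1)) * (2 * \<sigma>) ^ n * (\<eta> * \<sigma>) * norm (u - v))
        + C * (2 * \<sigma>) ^ (n + 2) * norm (u - v)"
    proof (intro norm_triangle_le add_mono norm_mul_le norm_cst norm_pow_taylor_diff G_lip near u v)
      show "cmod c \<le> 2 * \<sigma>" by (simp add: \<sigma>_def)
    qed (use u v c in \<open>simp_all add: \<sigma>_def\<close>)
    also have "\<dots> = ((cmod (f 0) * (real ((n + 2) * (n + 1)) * 2 ^ n)) * \<eta> + (C * 2 ^ (n + 2)) * \<sigma>) * \<sigma> ^ (n + 1) * norm (u - v)"
      by (simp add: power_mult_distrib algebra_simps)
    also have "\<dots> \<le> (K * \<eta> + K * \<sigma>) * \<sigma> ^ (n + 1) * norm (u - v)"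
    proof (cases "\<sigma> = 0")
      case False
      then have s: "\<sigma> > 0" by (simp add: \<sigma>_def)
      have "0 \<le> \<eta> * \<sigma>" using u norm_ge_zero order.trans unfolding \<sigma>_def by blast
      then have "\<eta> \<ge> 0" using s by (simp add: zero_le_mult_iff)
      then show ?thesis
        using s C by (intro mult_right_mono add_mono) (auto simp: K_def)
    qed simp
    finally show ?thesis by (simp add: \<sigma>_def distrib_left)
  qed
  have cst: "norm (N (cst c) - cst (f 0 * c ^ (n + 2))) \<le> K * cmod c ^ (n + 3)" if c: "2 * cmod c \<le> r" for c
  proof -
    have "N (cst c) - cst (f 0 * c ^ (n + 2)) = G (cst c) - G 0"
      unfolding N_def G0 by (rule ev_inject) (simp only: ev_simps ev_pow, simp)
    also have "norm \<dots> \<le> C * cmod c ^ (n + 2) * norm (cst c - 0)"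
      by (rule G_lip) (use norm_cst[of c] c norm_ge_zero[of c] r in \<open>auto simp del: norm_ge_zero\<close>)
    also have "\<dots> \<le> K * cmod c ^ (n + 2) * cmod c"
      using K C norm_cst[of c] by (intro mult_mono mult_right_mono) auto
    finally show ?thesis by (simp add: algebra_simps numeral_3_eq_3)
  qed
  show ?thesis
  proof (rule that[of r K N])
    show "ev x (N u) = ev x u ^ (n + 2) * f (ev x u)" if "norm u \<le> r" for u x
      unfolding N_def by (rule G_ev[OF that])
  qed (fact r K contN lip cst)+
qed

end

section \<open>Differential equations in a widening tube\<close>

lemma continuous_has_primitive:
  fixes g :: "real \<Rightarrow> 'a::banach"
  assumes "continuous_on UNIV g"
  obtains F where "F 0 = 0" "\<And>t. (F has_vector_derivative g t) (at t)"
proof -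
  define F where "F t = (if t \<ge> 0 then integral {0..t} g else - integral {t..0} g)" for t
  have F0: "F 0 = 0" by (simp add: F_def)
  have "(F has_vector_derivative g t) (at t)" for t
  proof -
  define n where "n = \<bar>t\<bar> + 1"
  have n: "-n < t" "t < n" "0 < n" by (auto simp: n_def)
  have cont: "continuous_on {a..b} g" for a b
    using assms continuous_on_subset by blast
  have F: "F s = integral {-n..s} g - integral {-n..0} g" if "s \<in> {-n<..<n}" for s
  proof (cases "s \<ge> 0")
    case True
    have "integral {-n..0} g + integral {0..s} g = integral {-n..s} g"
      by (rule Henstock_Kurzweil_Integration.integral_combine)
         (use True n integrable_continuous_interval[OF cont] in auto)
    then show ?thesis using True by (simp add: F_def algebra_simps)
  next
    case False
    have "integral {-n..s} g + integral {s..0} g = integral {-n..0} g"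
      by (rule Henstock_Kurzweil_Integration.integral_combine)
         (use False that n integrable_continuous_interval[OF cont] in auto)
    then show ?thesis using False by (simp add: F_def algebra_simps)
  qed
  have "((\<lambda>s. integral {-n..s} g - integral {-n..0} g) has_vector_derivative g t - 0) (at t within {-n..n})"
    by (intro has_vector_derivative_diff integral_has_vector_derivative cont has_vector_derivative_const)
       (use n in auto)
  then have "((\<lambda>s. integral {-n..s} g - integral {-n..0} g) has_vector_derivative g t) (at t)"
    using n by (simp add: at_within_Icc_at)
  then show ?thesis
    by (rule has_vector_derivative_transform_within_open[where S = "{-n<..<n}"]) (use n F in auto)
  qed
  with F0 show ?thesis by (rule that)
qed

lemma vector_mean_value_inequality:
  fixes F :: "real \<Rightarrow> 'a::real_normed_vector"
  assumes "\<And>s. (F has_vector_derivative g s) (at s)" "\<And>s. norm (g s) \<le> c"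
  shows "norm (F t - F 0) \<le> c * \<bar>t\<bar>"
proof -
  have "norm (F t - F 0) \<le> c * norm (t - 0)"
  proof (rule differentiable_bound)
    show "(F has_derivative (\<lambda>x. x *\<^sub>R g s)) (at s within UNIV)" for s
      using assms(1)[of s] by (simp add: has_vector_derivative_def)
    show "onorm (\<lambda>x. x *\<^sub>R g s) \<le> c" for s
      using mult_right_mono[OF assms(2) abs_ge_zero] by (intro onorm_le) (simp add: mult.commute)
  qed auto
  then show ?thesis by simp
qed

text \<open>
  The tube \<open>\<parallel>y\<parallel> \<le> \<eta> \<rho>(s)\<close> opens at least linearly in time, so the integral of a bounded right-hand
  side fits into it, and a Lipschitz constant of size \<open>\<kappa> / \<rho>\<close> acting on a difference of size \<open>\<rho>\<close>
  integrates to a multiple of \<open>\<rho>\<close>. The fixed point argument is therefore global: it is run for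
  \<open>b = y / \<rho>\<close> among the bounded continuous functions on the whole line.
\<close>

theorem ode_global_solution_in_tube:
  fixes H :: "real \<Rightarrow> 'a::banach \<Rightarrow> 'a" and \<rho> :: "real \<Rightarrow> real"
  assumes cont: "continuous_on {(s, y). norm y \<le> \<eta> * \<rho> s} (\<lambda>(s, y). H s y)"
    and \<rho>_cont: "continuous_on UNIV \<rho>" and \<rho>_pos: "\<And>t. \<rho> t > 0"
    and \<rho>_min: "\<And>t. \<rho> 0 \<le> \<rho> t" and \<rho>_growth: "\<And>t. \<bar>t\<bar> \<le> M * \<rho> t"
    and lip: "\<And>s y y'. norm y \<le> \<eta> * \<rho> s \<Longrightarrow> norm y' \<le> \<eta> * \<rho> s \<Longrightarrow>
        norm (H s y - H s y') \<le> \<kappa> / \<rho> s * norm (y - y')"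
    and forcing: "\<And>s. norm (H s 0) \<le> \<epsilon>"
    and \<eta>: "\<eta> \<ge> 0" and \<kappa>: "\<kappa> \<ge> 0" "\<epsilon> \<ge> 0" and small: "M * (\<epsilon> + \<kappa> * \<eta>) \<le> \<eta> / 2" "M * \<kappa> \<le> 1 / 2"
    and init: "norm y0 \<le> \<eta> / 2 * \<rho> 0"
  obtains Y where "Y 0 = y0" "\<And>t. norm (Y t) \<le> \<eta> * \<rho> t"
    "\<And>t. (Y has_vector_derivative H t (Y t)) (at t)"
proof -
  define h where "h b s = H s (\<rho> s *\<^sub>R apply_bcontfun b s)" for b :: "real \<Rightarrow>\<^sub>C 'a" and s
  define S where "S = {b :: real \<Rightarrow>\<^sub>C 'a. \<forall>t. norm (apply_bcontfun b t) \<le> \<eta>}"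
  have tube: "norm (\<rho> s *\<^sub>R apply_bcontfun b s) \<le> \<eta> * \<rho> s" if "b \<in> S" for b s
    using that \<rho>_pos[of s] by (auto simp: S_def mult.commute intro!: mult_left_mono)
  have h_cont: "continuous_on UNIV (h b)" if "b \<in> S" for b
  proof -
    have "continuous_on UNIV ((\<lambda>(s, y). H s y) \<circ> (\<lambda>s. (s, \<rho> s *\<^sub>R apply_bcontfun b s)))"
    proof (rule continuous_on_compose)
      show "continuous_on UNIV (\<lambda>s. (s, \<rho> s *\<^sub>R apply_bcontfun b s))"
        using apply_bcontfun[of b]
        by (intro continuous_intros \<rho>_cont) (auto simp: bcontfun_def)
      show "continuous_on ((\<lambda>s. (s, \<rho> s *\<^sub>R apply_bcontfun b s)) ` UNIV) (\<lambda>(s, y). H s y)"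
        by (rule continuous_on_subset[OF cont]) (use tube[OF that] in auto)
    qed
    then show ?thesis by (simp add: h_def[abs_def] o_def)
  qed
  have h_lip: "norm (h b s - h b' s) \<le> \<kappa> * dist b b'" if "b \<in> S" "b' \<in> S" for b b' s
  proof -
    have "norm (h b s - h b' s) \<le> \<kappa> / \<rho> s * norm (\<rho> s *\<^sub>R apply_bcontfun b s - \<rho> s *\<^sub>R apply_bcontfun b' s)"
      unfolding h_def by (rule lip[OF tube[OF that(1)] tube[OF that(2)]])
    also have "\<dots> = \<kappa> * dist (apply_bcontfun b s) (apply_bcontfun b' s)"
      using \<rho>_pos[of s] by (simp add: dist_norm flip: scaleR_diff_right)
    also have "\<dots> \<le> \<kappa> * dist b b'"
      by (intro mult_left_mono dist_bounded \<kappa>)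
    finally show ?thesis .
  qed
  have h_bound: "norm (h b s) \<le> \<epsilon> + \<kappa> * \<eta>" if "b \<in> S" for b s
  proof -
    have "norm (h b s - H s 0) \<le> \<kappa> / \<rho> s * norm (\<rho> s *\<^sub>R apply_bcontfun b s - 0)"
      unfolding h_def by (rule lip[OF tube[OF that]]) (use \<eta> \<rho>_pos[of s] in auto)
    also have "\<dots> = \<kappa> * norm (apply_bcontfun b s)" using \<rho>_pos[of s] by simp
    also have "\<dots> \<le> \<kappa> * \<eta>" using that \<kappa> by (auto simp: S_def intro!: mult_left_mono)
    finally have "norm (h b s - H s 0) \<le> \<kappa> * \<eta>" .
    moreover have "norm (h b s) \<le> norm (H s 0) + norm (h b s - H s 0)"
      using norm_triangle_ineq[of "H s 0" "h b s - H s 0"] by simp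
    ultimately show ?thesis using forcing[of s] by linarith
  qed
  define P where "P b = (SOME F. F 0 = 0 \<and> (\<forall>t. (F has_vector_derivative h b t) (at t)))" for b
  have P: "P b 0 = 0" "(P b has_vector_derivative h b t) (at t)" if "b \<in> S" for b t
  proof -
    have "\<exists>F. F 0 = 0 \<and> (\<forall>t. (F has_vector_derivative h b t) (at t))"
      using continuous_has_primitive[OF h_cont[OF that]] by metis
    then have "P b 0 = 0 \<and> (\<forall>t. (P b has_vector_derivative h b t) (at t))"
      unfolding P_def by (rule someI_ex)
    then show "P b 0 = 0" "(P b has_vector_derivative h b t) (at t)" by auto
  qed
  have P_bound: "norm (P b t) \<le> \<eta> / 2 * \<rho> t" if "b \<in> S" for b t
  proof -
    have "norm (P b t - P b 0) \<le> (\<epsilon> + \<kappa> * \<eta>) * \<bar>t\<bar>"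
      by (rule vector_mean_value_inequality) (use P h_bound that in auto)
    also have "\<dots> \<le> (\<epsilon> + \<kappa> * \<eta>) * (M * \<rho> t)"
      using \<kappa> \<eta> by (intro mult_left_mono \<rho>_growth) auto
    also have "\<dots> = (M * (\<epsilon> + \<kappa> * \<eta>)) * \<rho> t" by simp
    also have "\<dots> \<le> \<eta> / 2 * \<rho> t"
      using \<rho>_pos[of t] by (intro mult_right_mono small) auto
    finally show ?thesis using P that by simp
  qed
  have P_lip: "norm (P b t - P b' t) \<le> 1 / 2 * dist b b' * \<rho> t" if "b \<in> S" "b' \<in> S" for b b' t
  proof -
    have "norm ((P b t - P b' t) - (P b 0 - P b' 0)) \<le> (\<kappa> * dist b b') * \<bar>t\<bar>"
      by (rule vector_mean_value_inequality[where g = "\<lambda>s. h b s - h b' s"])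
         (use P h_lip that in \<open>auto intro!: has_vector_derivative_diff\<close>)
    also have "\<dots> \<le> (\<kappa> * dist b b') * (M * \<rho> t)"
      using \<kappa> by (intro mult_left_mono \<rho>_growth) auto
    also have "\<dots> = (M * \<kappa>) * (dist b b' * \<rho> t)" by simp
    also have "\<dots> \<le> 1 / 2 * (dist b b' * \<rho> t)"
      using \<rho>_pos[of t] by (intro mult_right_mono small) auto
    finally show ?thesis using P that by simp
  qed
  define \<Phi> where "\<Phi> b = Bcontfun (\<lambda>t. (y0 + P b t) /\<^sub>R \<rho> t)" for b
  have bound: "norm ((y0 + P b t) /\<^sub>R \<rho> t) \<le> \<eta>" if "b \<in> S" for b t
  proof -
    have "norm (y0 + P b t) \<le> \<eta> / 2 * \<rho> 0 + \<eta> / 2 * \<rho> t"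
      by (intro norm_triangle_le add_mono init P_bound that)
    also have "\<dots> \<le> \<eta> / 2 * \<rho> t + \<eta> / 2 * \<rho> t"
      using \<eta> by (intro add_mono mult_left_mono \<rho>_min) auto
    finally have "norm (y0 + P b t) \<le> \<eta> * \<rho> t" by simp
    then show ?thesis
      using \<rho>_pos[of t] by (simp only: norm_scaleR) (simp add: field_simps)
  qed
  have \<Phi>: "apply_bcontfun (\<Phi> b) t = (y0 + P b t) /\<^sub>R \<rho> t" if "b \<in> S" for b t
  proof -
    have "continuous_on UNIV (P b)"
      using P(2)[OF that] by (auto intro!: continuous_at_imp_continuous_on has_vector_derivative_continuous)
    moreover have "\<forall>t. \<rho> t \<noteq> 0" using \<rho>_pos less_numeral_extra(3) by metis
    ultimately have "(\<lambda>t. (y0 + P b t) /\<^sub>R \<rho> t) \<in> bcontfun"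
      using bound[OF that] by (intro bcontfun_normI[of _ \<eta>] continuous_intros \<rho>_cont) auto
    then show ?thesis by (simp add: \<Phi>_def Bcontfun_inverse)
  qed
  have "\<exists>!b. b \<in> S \<and> \<Phi> b = b"
  proof (rule Banach_fix)
    have "closed S"
    proof -
      have "S = (\<Inter>t. {b. norm (apply_bcontfun b t) \<le> \<eta>})" by (auto simp: S_def)
      moreover have "continuous_on UNIV (\<lambda>b :: real \<Rightarrow>\<^sub>C 'a. apply_bcontfun b t)" for t
        unfolding continuous_on_iff
        by (intro ballI allI impI) (meson dist_bounded le_less_trans)
      ultimately show ?thesis
        by (simp only:) (intro closed_INT ballI closed_Collect_le continuous_intros)
    qed
    then show "complete S" by (simp add: complete_eq_closed)
    show "S \<noteq> {}" using \<eta> by (auto simp: S_def intro!: exI[of _ 0])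
    show "(0 :: real) \<le> 1 / 2" "(1 / 2 :: real) < 1" by auto
    show "\<Phi> ` S \<subseteq> S"
    proof safe
      fix b assume "b \<in> S"
      then show "\<Phi> b \<in> S" using bound \<Phi> by (simp add: S_def)
    qed
    show "dist (\<Phi> b) (\<Phi> b') \<le> 1 / 2 * dist b b'" if b: "b \<in> S" "b' \<in> S" for b b'
    proof (rule dist_bound)
      fix t
      have "dist (apply_bcontfun (\<Phi> b) t) (apply_bcontfun (\<Phi> b') t) = norm (P b t - P b' t) / \<rho> t"
        using \<rho>_pos[of t] b
        by (simp add: \<Phi> dist_norm divide_inverse mult.commute flip: scaleR_diff_right)
      also have "\<dots> \<le> 1 / 2 * dist b b'"
        using P_lip[OF b, of t] \<rho>_pos[of t] by (simp add: field_simps)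
      finally show "dist (apply_bcontfun (\<Phi> b) t) (apply_bcontfun (\<Phi> b') t) \<le> 1 / 2 * dist b b'" .
    qed
  qed
  then obtain b where b: "b \<in> S" "\<Phi> b = b" by auto
  define Y where "Y t = y0 + P b t" for t
  have Y: "\<rho> t *\<^sub>R apply_bcontfun b t = Y t" for t
    using \<Phi>[OF b(1), of t] \<rho>_pos[of t] by (simp add: b(2) Y_def)
  show ?thesis
  proof
    show "Y 0 = y0" using P b by (simp add: Y_def)
    show "norm (Y t) \<le> \<eta> * \<rho> t" for t using tube[OF b(1), of t] by (simp only: Y)
    show "(Y has_vector_derivative H t (Y t)) (at t)" for t
      using has_vector_derivative_add[OF has_vector_derivative_const P(2)[OF b(1)], of y0 t]
      by (simp add: Y_def[abs_def] h_def Y[unfolded Y_def])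
  qed
qed

lemma closed_Collect_le_unit_interval:
  fixes f g :: "real \<Rightarrow> real"
  assumes "continuous_on {0..1} f" "continuous_on {0..1} g"
  shows "closed {x \<in> {0..1}. f x \<le> g x}"
  using continuous_closed_preimage[OF continuous_on_diff[OF assms(2,1)], of "{0..}"]
  by (simp add: vimage_def Int_def Collect_conj_eq[symmetric] conj_commute)

text \<open>
  At the first time at which the strict inequality failed, continuity would give its non-strict form
  on the whole interval up to that time, and the improvement would make it strict there.
\<close>

lemma continuity_bootstrap:
  fixes \<phi> \<psi> :: "real \<Rightarrow> real"
  assumes cont: "continuous_on UNIV \<phi>" "continuous_on UNIV \<psi>"
    and start: "\<phi> 0 < \<psi> 0"
    and improve: "\<And>t. (\<And>s. s \<in> closed_segment 0 t \<Longrightarrow> \<phi> s \<le> \<psi> s) \<Longrightarrow> \<phi> t < \<psi> t"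
  shows "\<phi> t < \<psi> t"
proof (rule ccontr)
  assume neg: "\<not> \<phi> t < \<psi> t"
  define B where "B = {x \<in> {0..1}. \<psi> (x * t) \<le> \<phi> (x * t)}"
  have c: "continuous_on {0..1} (\<lambda>x. \<phi> (x * t))" "continuous_on {0..1} (\<lambda>x. \<psi> (x * t))"
    by (intro continuous_on_compose2[OF cont(1)] continuous_on_compose2[OF cont(2)] continuous_intros; simp)+
  have B: "closed B" unfolding B_def
    by (rule closed_Collect_le_unit_interval[OF c(2,1)])
  then have cB: "compact B" by (auto simp: B_def compact_eq_bounded_closed intro: bounded_subset[of "{0..1}"])
  have neB: "B \<noteq> {}" using neg by (auto simp: B_def intro!: exI[of _ 1])
  obtain m where m: "m \<in> B" "\<And>x. x \<in> B \<Longrightarrow> m \<le> x"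
    using compact_attains_inf[OF cB neB] by auto
  have m01: "m > 0" "m \<le> 1" using m(1) start by (auto simp: B_def order.order_iff_strict)
  have below: "\<phi> (x * t) \<le> \<psi> (x * t)" if "0 \<le> x" "x < m" for x
    using m(2)[of x] that m01 by (force simp: B_def)
  have "\<phi> (m * t) \<le> \<psi> (m * t)"
  proof -
    have "m \<in> closure {0..<m}" using m01 by simp
    moreover have "{0..<m} \<subseteq> {x \<in> {0..1}. \<phi> (x * t) \<le> \<psi> (x * t)}"
      using below m01 by auto
    moreover have "closed {x \<in> {0..1}. \<phi> (x * t) \<le> \<psi> (x * t)}"
      by (rule closed_Collect_le_unit_interval[OF c(1,2)])
    ultimately show ?thesis using closure_minimal by blast
  qed
  then have "\<phi> (m * t) < \<psi> (m * t)"
  proof (intro improve)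
    fix s assume "s \<in> closed_segment 0 (m * t)"
    then obtain u where u: "0 \<le> u" "u \<le> 1" "s = (u * m) * t"
      by (auto simp: closed_segment_def)
    show "\<phi> s \<le> \<psi> s"
    proof (cases "u = 1")
      case True
      then show ?thesis using u \<open>\<phi> (m * t) \<le> \<psi> (m * t)\<close> by simp
    next
      case False
      then have "u * m < m" using u m01 by simp
      then show ?thesis using below[of "u * m"] u m01 by simp
    qed
  qed
  then show False using m(1) by (auto simp: B_def)
qed

section \<open>Fourier coefficients of integrable functions on the torus\<close>

definition character :: "real ^ 'd \<Rightarrow> int ^ 'd \<Rightarrow> real ^ 'd \<Rightarrow> complex" where
  "character \<omega> k x = exp (\<i> * complex_of_real (\<Sum>j\<in>UNIV. real_of_int (k $ j) * \<omega> $ j * x $ j))"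

lemma norm_character [simp]: "cmod (character \<omega> k x) = 1"
  by (simp add: character_def)

lemma character_0 [simp]: "character \<omega> 0 = (\<lambda>x. 1)"
  by (simp add: character_def fun_eq_iff)

lemma character_add: "character \<omega> (k + l) x = character \<omega> k x * character \<omega> l x"
  by (simp add: character_def algebra_simps sum.distrib flip: exp_add)

lemma cnj_character: "cnj (character \<omega> k x) = character \<omega> (- k) x"
  by (simp add: character_def exp_cnj sum_negf)

lemma continuous_on_character: "continuous_on S (character \<omega> k)"
  unfolding character_def by (intro continuous_intros)

lemma character_periodic:
  assumes "\<forall>j. \<omega> $ j \<noteq> 0"
  shows "character \<omega> k (x + axis j (2 * pi / \<omega> $ j)) = character \<omega> k x"
proof -
  have "(\<Sum>i\<in>UNIV. real_of_int (k $ i) * \<omega> $ i * (x + axis j (2 * pi / \<omega> $ j)) $ i)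
      = (\<Sum>i\<in>UNIV. real_of_int (k $ i) * \<omega> $ i * x $ i + (if i = j then 2 * pi * real_of_int (k $ j) else 0))"
    using assms by (intro sum.cong) (auto simp: axis_def algebra_simps)
  also have "\<dots> = (\<Sum>i\<in>UNIV. real_of_int (k $ i) * \<omega> $ i * x $ i) + 2 * pi * real_of_int (k $ j)"
    by (simp add: sum.distrib)
  finally have "character \<omega> k (x + axis j (2 * pi / \<omega> $ j))
      = character \<omega> k x * exp (\<i> * (complex_of_int (k $ j) * (complex_of_real pi * 2)))"
    by (simp add: character_def distrib_left exp_add mult_ac)
  then show ?thesis
    by (simp add: exp_eq_1)
qed

lemma fourier_coeff_eq:
  "fourier_coeff \<omega> u k = (LINT x : period_cell \<omega> | lebesgue. u x * character \<omega> (- k) x)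
     / complex_of_real (measure lebesgue (period_cell \<omega>))"
  by (simp add: fourier_coeff_def character_def sum_negf)

lemma lborel_integral_prod:
  fixes h :: "'d::finite \<Rightarrow> real \<Rightarrow> complex"
  assumes int: "\<And>j. integrable lborel (h j)"
  shows "(LINT x|lborel. (\<Prod>j\<in>UNIV. h j ((x :: real ^ 'd) $ j))) = (\<Prod>j\<in>UNIV. LINT t|lborel. h j t)"
proof -
  interpret product_sigma_finite "\<lambda>_ :: real ^ 'd. lborel :: real measure" ..
  define ix :: "real ^ 'd \<Rightarrow> 'd" where "ix b = (THE j. b = axis j 1)" for b
  have ix: "ix (axis j 1) = j" for j by (auto simp: ix_def axis_eq_axis)
  have bij: "bij_betw (\<lambda>j. axis j 1 :: real ^ 'd) UNIV Basis"
    by (auto simp: bij_betw_def inj_on_def axis_eq_axis Basis_vec_def)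
  have comp: "(\<Sum>b\<in>Basis. g b *\<^sub>R b) $ j = g (axis j 1)" for g :: "real ^ 'd \<Rightarrow> real" and j
  proof -
    have "(\<Sum>b\<in>Basis. g b *\<^sub>R b) $ j = (\<Sum>b\<in>Basis. g b *\<^sub>R b) \<bullet> axis j 1"
      by (simp add: inner_axis)
    also have "\<dots> = g (axis j 1)" by (rule inner_sum_left_Basis) (auto simp: Basis_vec_def)
    finally show ?thesis .
  qed
  have meas: "h j \<in> borel_measurable borel" for j
    using borel_measurable_integrable[OF int, of j] by simp
  have "(LINT x|lborel. (\<Prod>j\<in>UNIV. h j ((x :: real ^ 'd) $ j)))
      = (LINT g|(\<Pi>\<^sub>M b\<in>Basis. lborel). (\<Prod>j\<in>UNIV. h j ((\<Sum>b\<in>Basis. g b *\<^sub>R (b :: real ^ 'd)) $ j)))"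
  proof (subst lborel_eq, rule integral_distr)
    show "(\<lambda>g. \<Sum>b\<in>Basis. g b *\<^sub>R (b :: real ^ 'd)) \<in> (\<Pi>\<^sub>M b\<in>Basis. lborel) \<rightarrow>\<^sub>M borel"
      by measurable
    show "(\<lambda>x. \<Prod>j\<in>UNIV. h j ((x :: real ^ 'd) $ j)) \<in> borel_measurable borel"
      by (intro borel_measurable_prod measurable_compose[OF _ meas] borel_measurable_continuous_onI
          continuous_intros)
  qed
  also have "\<dots> = (LINT g|(\<Pi>\<^sub>M b\<in>Basis. lborel). (\<Prod>b\<in>Basis. h (ix b) (g b)))"
    unfolding comp by (subst prod.reindex_bij_betw[OF bij, symmetric]) (simp add: ix)
  also have "\<dots> = (\<Prod>b\<in>Basis. LINT t|lborel. h (ix b) t)"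
    by (rule product_integral_prod) (auto intro: int)
  also have "\<dots> = (\<Prod>j\<in>UNIV. LINT t|lborel. h j t)"
    by (subst prod.reindex_bij_betw[OF bij, symmetric]) (simp add: ix)
  finally show ?thesis .
qed

lemma indicator_scaleR: "indicator A t *\<^sub>R z = indicator A t * (z :: complex)"
  by (simp add: indicator_def)

lemma integral_exp_period:
  assumes "w \<noteq> 0"
  shows "integrable lborel (\<lambda>t. indicator {0..2 * pi / \<bar>w\<bar>} t * exp (\<i> * complex_of_real (real_of_int n * w * t)))"
    and "n \<noteq> 0 \<Longrightarrow> (LINT t|lborel. indicator {0..2 * pi / \<bar>w\<bar>} t * exp (\<i> * complex_of_real (real_of_int n * w * t))) = 0"
proof -
  have int: "set_integrable lborel {0..2 * pi / \<bar>w\<bar>} (\<lambda>t. exp (\<i> * complex_of_real (real_of_int n * w * t)))"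
    by (intro borel_integrable_atLeastAtMost' continuous_intros)
  then show "integrable lborel (\<lambda>t. indicator {0..2 * pi / \<bar>w\<bar>} t * exp (\<i> * complex_of_real (real_of_int n * w * t)))"
    by (simp only: set_integrable_def indicator_scaleR)
  assume n: "n \<noteq> 0"
  define F where "F t = exp (\<i> * complex_of_real (real_of_int n * w * t)) / (\<i> * of_int n * of_real w)" for t
  have "((\<lambda>t. exp (\<i> * complex_of_real (real_of_int n * w * t))) has_integral (F (2 * pi / \<bar>w\<bar>) - F 0)) {0..2 * pi / \<bar>w\<bar>}"
  proof (rule fundamental_theorem_of_calculus)
    fix t
    have "((\<lambda>s. exp (\<i> * of_int n * of_real w * s) / (\<i> * of_int n * of_real w)) has_field_derivative
        exp (\<i> * of_int n * of_real w * of_real t)) (at (complex_of_real t))"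
      using n assms by (auto intro!: derivative_eq_intros)
    from has_vector_derivative_real_field[OF this]
    show "(F has_vector_derivative exp (\<i> * complex_of_real (real_of_int n * w * t))) (at t within {0..2 * pi / \<bar>w\<bar>})"
      by (auto simp: F_def[abs_def] mult_ac intro: has_vector_derivative_at_within)
  qed (use assms in auto)
  moreover have "exp (\<i> * complex_of_real (real_of_int n * w * (2 * pi / \<bar>w\<bar>))) = 1"
    using assms by (cases "w > 0") (auto simp: exp_eq_1 intro: exI[of _ n] exI[of _ "- n"])
  ultimately have "integral {0..2 * pi / \<bar>w\<bar>} (\<lambda>t. exp (\<i> * complex_of_real (real_of_int n * w * t))) = 0"
    by (simp add: F_def integral_unique)
  then have "(LINT t : {0..2 * pi / \<bar>w\<bar>} | lborel. exp (\<i> * complex_of_real (real_of_int n * w * t))) = 0"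
    using set_borel_integral_eq_integral(2)[OF int] by simp
  then show "(LINT t|lborel. indicator {0..2 * pi / \<bar>w\<bar>} t * exp (\<i> * complex_of_real (real_of_int n * w * t))) = 0"
    by (simp only: set_lebesgue_integral_def indicator_scaleR)
qed

lemma integral_character:
  assumes \<omega>: "\<forall>j. \<omega> $ j \<noteq> 0"
  shows "(LINT x : period_cell \<omega> | lebesgue. character \<omega> k x)
     = (if k = 0 then complex_of_real (measure lebesgue (period_cell \<omega>)) else 0)"
proof (cases "k = 0")
  case True
  have "(LINT x : period_cell \<omega> | lebesgue. (1 :: complex)) = complex_of_real (measure lebesgue (period_cell \<omega>))"
    unfolding set_lebesgue_integral_def period_cell_def
    using lmeasurable_cbox by (simp add: scaleR_conv_of_real)
  then show ?thesis using True by simp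
next
  case False
  then obtain i where i: "k $ i \<noteq> 0" by (auto simp: vec_eq_iff)
  define h where "h j t = indicator {0..2 * pi / \<bar>\<omega> $ j\<bar>} t
      * exp (\<i> * complex_of_real (real_of_int (k $ j) * \<omega> $ j * t))" for j t
  have eq: "indicator (period_cell \<omega>) x *\<^sub>R character \<omega> k x = (\<Prod>j\<in>UNIV. h j (x $ j))" for x
  proof -
    have "(\<Prod>j\<in>UNIV. indicator {0..2 * pi / \<bar>\<omega> $ j\<bar>} (x $ j) :: complex) = indicator (period_cell \<omega>) x"
    proof (cases "x \<in> period_cell \<omega>")
      case True
      then show ?thesis by (simp add: period_cell_def mem_box_cart)
    next
      case False
      then obtain j where "x $ j \<notin> {0..2 * pi / \<bar>\<omega> $ j\<bar>}" by (auto simp: period_cell_def mem_box_cart)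
      then have "(\<Prod>j\<in>UNIV. indicator {0..2 * pi / \<bar>\<omega> $ j\<bar>} (x $ j) :: complex) = 0"
        by (intro prod_zero bexI[of _ j]) auto
      then show ?thesis using False by simp
    qed
    then show ?thesis
      by (simp add: h_def prod.distrib character_def sum_distrib_left indicator_def flip: exp_sum)
  qed
  have [measurable]: "character \<omega> k \<in> borel_measurable borel"
    by (intro borel_measurable_continuous_onI continuous_on_character)
  have "(LINT x : period_cell \<omega> | lebesgue. character \<omega> k x)
      = (LINT x | lborel. indicator (period_cell \<omega>) x *\<^sub>R character \<omega> k x)"
    unfolding set_lebesgue_integral_def
    by (rule integral_completion) (simp add: period_cell_def)
  also have "\<dots> = (\<Prod>j\<in>UNIV. LINT t|lborel. h j t)"
    unfolding eq
    by (rule lborel_integral_prod) (unfold h_def, rule integral_exp_period(1)[OF \<omega>[rule_format]])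
  also have "\<dots> = 0"
    using integral_exp_period(2)[OF \<omega>[rule_format] i] by (intro prod_zero) (auto simp: h_def)
  finally show ?thesis using False by simp
qed

inductive trig_polynomial :: "real ^ 'd \<Rightarrow> (real ^ 'd \<Rightarrow> complex) \<Rightarrow> bool" for \<omega> where
  character: "trig_polynomial \<omega> (\<lambda>x. c * character \<omega> k x)"
| add: "trig_polynomial \<omega> \<phi> \<Longrightarrow> trig_polynomial \<omega> \<psi> \<Longrightarrow> trig_polynomial \<omega> (\<lambda>x. \<phi> x + \<psi> x)"

lemma trig_polynomial_const: "trig_polynomial \<omega> (\<lambda>x. c)"
  using trig_polynomial.character[of \<omega> c 0] by simp

lemma trig_polynomial_sum:
  assumes "finite J" "\<And>j. j \<in> J \<Longrightarrow> trig_polynomial \<omega> (\<phi> j)"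
  shows "trig_polynomial \<omega> (\<lambda>x. \<Sum>j\<in>J. \<phi> j x)"
  using assms
proof (induction J rule: finite_induct)
  case empty
  then show ?case by (simp add: trig_polynomial_const)
next
  case (insert j J)
  then show ?case by (simp add: trig_polynomial.add)
qed

lemma trig_polynomial_mult:
  assumes "trig_polynomial \<omega> \<phi>" "trig_polynomial \<omega> \<psi>"
  shows "trig_polynomial \<omega> (\<lambda>x. \<phi> x * \<psi> x)"
  using assms(1)
proof induction
  case (character c k)
  show ?case using assms(2)
  proof induction
    case (character c' k')
    show ?case using trig_polynomial.character[of \<omega> "c * c'" "k + k'"]
      by (simp add: character_add mult_ac)
  next
    case (add \<psi>\<^sub>1 \<psi>\<^sub>2)
    show ?case using trig_polynomial.add[OF add.IH] by (simp only: distrib_left)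
  qed
next
  case (add \<phi>\<^sub>1 \<phi>\<^sub>2)
  show ?case using trig_polynomial.add[OF add.IH] by (simp only: distrib_right)
qed

text \<open>
  The quotient map of the torus, realised inside \<open>\<complex>\<^sup>d\<close>, where polynomial approximation is available.
\<close>

definition torus_embedding :: "real ^ 'd \<Rightarrow> real ^ 'd \<Rightarrow> complex ^ 'd" where
  "torus_embedding \<omega> x = (\<chi> j. character \<omega> (axis j 1) x)"

lemma continuous_on_torus_embedding: "continuous_on S (torus_embedding \<omega>)"
  unfolding torus_embedding_def by (intro continuous_intros continuous_on_character)

lemma torus_embedding_component:
  "torus_embedding \<omega> x $ j = exp (\<i> * complex_of_real (\<omega> $ j * x $ j))"
proof -
  have "(\<Sum>i\<in>UNIV. real_of_int ((axis j 1 :: int ^ _) $ i) * \<omega> $ i * x $ i) 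
      = (\<Sum>i\<in>UNIV. if i = j then \<omega> $ j * x $ j else 0)"
    by (intro sum.cong) (auto simp: axis_def)
  also have "\<dots> = \<omega> $ j * x $ j" by simp
  finally show ?thesis by (simp only: torus_embedding_def character_def vec_lambda_beta)
qed

text \<open>
  Points of the closed period cell are identified only along its boundary, so a point of the open cell
  shares its image with no other point of the closed cell.
\<close>

lemma torus_embedding_inject:
  assumes \<omega>: "\<forall>j. \<omega> $ j \<noteq> 0" and x: "x \<in> period_cell \<omega>"
    and y: "y \<in> box 0 (\<chi> j. 2 * pi / \<bar>\<omega> $ j\<bar>)" and eq: "torus_embedding \<omega> x = torus_embedding \<omega> y"
  shows "x = y"
proof -
  have "x $ j = y $ j" for j
  proof -
    have "\<bar>x $ j - y $ j\<bar> < 2 * pi / \<bar>\<omega> $ j\<bar>"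
    proof -
      have "0 \<le> x $ j" "x $ j \<le> 2 * pi / \<bar>\<omega> $ j\<bar>" "0 < y $ j" "y $ j < 2 * pi / \<bar>\<omega> $ j\<bar>"
        using x y by (simp_all add: period_cell_def mem_box_cart)
      then show ?thesis by linarith
    qed
    moreover have w: "\<bar>\<omega> $ j\<bar> > 0" using \<omega> by simp
    ultimately have "\<bar>\<omega> $ j\<bar> * \<bar>x $ j - y $ j\<bar> < 2 * pi"
      by (simp only: pos_less_divide_eq mult.commute)
    then have "\<bar>\<omega> $ j * x $ j - \<omega> $ j * y $ j\<bar> < 2 * pi"
      by (simp only: right_diff_distrib[symmetric] abs_mult)
    then have "\<bar>Im (\<i> * complex_of_real (\<omega> $ j * x $ j)) - Im (\<i> * complex_of_real (\<omega> $ j * y $ j))\<bar> < 2 * pi"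
      by simp
    moreover have "exp (\<i> * complex_of_real (\<omega> $ j * x $ j)) = exp (\<i> * complex_of_real (\<omega> $ j * y $ j))"
      using eq torus_embedding_component[of \<omega> x j] torus_embedding_component[of \<omega> y j] by simp
    ultimately have "\<i> * complex_of_real (\<omega> $ j * x $ j) = \<i> * complex_of_real (\<omega> $ j * y $ j)"
      by (rule exp_complex_eqI)
    then have "\<omega> $ j * x $ j = \<omega> $ j * y $ j"
      by (simp only: mult_cancel_left of_real_eq_iff) simp
    then show ?thesis using w by simp
  qed
  then show ?thesis by (simp add: vec_eq_iff)
qed

lemma trig_polynomial_real_polynomial:
  fixes \<omega> :: "real ^ 'd"
  assumes "real_polynomial_function P"
  shows "trig_polynomial \<omega> (\<lambda>x. complex_of_real (P (torus_embedding \<omega> x)))"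
  using assms
proof induction
  case (linear L)
  interpret L: bounded_linear L by fact
  have L: "L z = (\<Sum>j\<in>UNIV. Re (z $ j) * L (axis j 1) + Im (z $ j) * L (axis j \<i>))" for z :: "complex ^ 'd"
  proof -
    have "z = (\<Sum>j\<in>UNIV. Re (z $ j) *\<^sub>R axis j 1 + Im (z $ j) *\<^sub>R axis j \<i>)"
      by (auto simp: vec_eq_iff axis_def complex_eq_iff if_distrib[of Re] if_distrib[of Im]
          if_distrib[of "\<lambda>a. _ * a"] cong: if_cong)
    then have "L z = L (\<Sum>j\<in>UNIV. Re (z $ j) *\<^sub>R axis j 1 + Im (z $ j) *\<^sub>R axis j \<i>)"
      by simp
    also have "\<dots> = (\<Sum>j\<in>UNIV. Re (z $ j) * L (axis j 1) + Im (z $ j) * L (axis j \<i>))"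
      by (simp add: L.sum L.add L.scaleR)
    finally show ?thesis .
  qed
  have "complex_of_real (Re z * a + Im z * b) = (of_real a - \<i> * of_real b) / 2 * z + (of_real a + \<i> * of_real b) / 2 * cnj z"
    for z a b
    by (simp add: complex_eq_iff field_simps)
  then have "complex_of_real (L (torus_embedding \<omega> x)) =
      (\<Sum>j\<in>UNIV. (of_real (L (axis j 1)) - \<i> * of_real (L (axis j \<i>))) / 2 * character \<omega> (axis j 1) x
        + (of_real (L (axis j 1)) + \<i> * of_real (L (axis j \<i>))) / 2 * character \<omega> (- axis j 1) x)" for x
    by (subst L) (simp only: of_real_sum torus_embedding_def vec_lambda_beta cnj_character)
  then show ?case
    by (simp only:) (intro trig_polynomial_sum finite_class.finite_UNIV trig_polynomial.intros)
qed (auto intro: trig_polynomial_const trig_polynomial.add trig_polynomial_mult)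

lemma period_cell_lebesgue [simp]: "period_cell \<omega> \<in> sets lebesgue"
  by (simp add: period_cell_def)

lemma compact_period_cell: "compact (period_cell \<omega>)"
  by (simp add: period_cell_def)

lemma measure_period_cell:
  assumes "\<forall>j. \<omega> $ j \<noteq> 0"
  shows "measure lebesgue (period_cell \<omega>) > 0"
proof -
  have "\<forall>b\<in>Basis. 0 \<bullet> b < (\<chi> j. 2 * pi / \<bar>\<omega> $ j\<bar>) \<bullet> b"
    using assms by (auto simp: Basis_vec_def inner_axis)
  then show ?thesis
    unfolding period_cell_def by (subst measure_completion) (simp_all only: content_pos_lt_eq, simp)
qed

lemma absolutely_integrable_mult_continuous:
  fixes g \<phi> :: "real ^ 'd \<Rightarrow> complex"
  assumes g: "g absolutely_integrable_on period_cell \<omega>" and \<phi>: "continuous_on (period_cell \<omega>) \<phi>"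
  shows "(\<lambda>x. g x * \<phi> x) absolutely_integrable_on period_cell \<omega>"
proof -
  have "(\<lambda>x. \<phi> x * g x) absolutely_integrable_on period_cell \<omega>"
  proof (rule absolutely_integrable_bounded_measurable_product[where h = "(*)" and f = \<phi>, OF _ _ _ _ g])
    show "bilinear ((*) :: complex \<Rightarrow> complex \<Rightarrow> complex)"
      by (simp add: bilinear_conv_bounded_bilinear bounded_bilinear_mult)
    show "\<phi> \<in> borel_measurable (lebesgue_on (period_cell \<omega>))"
      by (rule continuous_imp_measurable_on_sets_lebesgue[OF \<phi>]) simp
    show "bounded (\<phi> ` period_cell \<omega>)"
      by (rule compact_imp_bounded[OF compact_continuous_image[OF \<phi> compact_period_cell]])
  qed simp
  then show ?thesis by (simp add: mult.commute)
qed

text \<open>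
  Trigonometric polynomials are the real polynomials on the torus embedded in \<open>\<complex>\<^sup>d\<close>, so by
  Stone-Weierstrass they approximate every continuous function on it uniformly.
\<close>

lemma integral_continuous_torus_eq_0:
  fixes g :: "real ^ 'd \<Rightarrow> complex" and F :: "complex ^ 'd \<Rightarrow> real"
  assumes \<omega>: "\<forall>j. \<omega> $ j \<noteq> 0" and g: "g absolutely_integrable_on period_cell \<omega>"
    and zero: "\<And>k. fourier_coeff \<omega> g k = 0" and F: "continuous_on UNIV F"
  shows "integral (period_cell \<omega>) (\<lambda>x. g x * of_real (F (torus_embedding \<omega> x))) = 0"
proof -
  let ?C = "period_cell \<omega>"
  have char: "integral ?C (\<lambda>x. g x * (c * character \<omega> k x)) = 0" for c k
  proof -
    have "(LINT x : ?C | lebesgue. g x * character \<omega> k x) = 0"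
      using zero[of "- k"] measure_period_cell[OF \<omega>] by (simp add: fourier_coeff_eq)
    then have "integral ?C (\<lambda>x. g x * character \<omega> k x) = 0"
      using set_lebesgue_integral_eq_integral(2)[OF absolutely_integrable_mult_continuous[OF g continuous_on_character]]
      by simp
    then have "integral ?C (\<lambda>x. c * (g x * character \<omega> k x)) = 0"
      by (subst integral_mult_right) simp
    then show ?thesis by (simp add: mult_ac)
  qed
  have trig: "(\<lambda>x. g x * \<phi> x) integrable_on ?C \<and> integral ?C (\<lambda>x. g x * \<phi> x) = 0"
    if "trig_polynomial \<omega> \<phi>" for \<phi>
    using that
  proof induction
    case (character c k)
    have "(\<lambda>x. g x * (c * character \<omega> k x)) absolutely_integrable_on ?C"
      by (intro absolutely_integrable_mult_continuous g continuous_intros continuous_on_character)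
    then show ?case using char absolutely_integrable_on_def by blast
  next
    case (add \<phi> \<psi>)
    then show ?case by (auto simp: distrib_left integral_add intro: integrable_add)
  qed
  have gF: "(\<lambda>x. g x * of_real (F (torus_embedding \<omega> x))) integrable_on ?C"
    by (rule set_lebesgue_integral_eq_integral(1)[OF absolutely_integrable_mult_continuous[OF g]])
       (auto intro!: continuous_intros continuous_on_compose2[OF F] continuous_on_torus_embedding)
  have ng: "(\<lambda>x. cmod (g x)) integrable_on ?C"
    using g absolutely_integrable_on_def by blast
  have bound: "cmod (integral ?C (\<lambda>x. g x * of_real (F (torus_embedding \<omega> x))))
      \<le> e * integral ?C (\<lambda>x. cmod (g x))" if e: "e > 0" for e
  proof -
    have "compact (torus_embedding \<omega> ` ?C)"
      by (intro compact_continuous_image continuous_on_torus_embedding compact_period_cell)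
    then obtain P where P: "real_polynomial_function P"
      "\<And>z. z \<in> torus_embedding \<omega> ` ?C \<Longrightarrow> \<bar>F z - P z\<bar> < e"
      using Stone_Weierstrass_real_polynomial_function[OF _ continuous_on_subset[OF F] e] by blast
    note tP = trig[OF trig_polynomial_real_polynomial[OF P(1)]]
    have "integral ?C (\<lambda>x. g x * of_real (F (torus_embedding \<omega> x)))
        = integral ?C (\<lambda>x. g x * of_real (F (torus_embedding \<omega> x)) - g x * of_real (P (torus_embedding \<omega> x)))"
      using gF tP by (simp add: Henstock_Kurzweil_Integration.integral_diff)
    also have "cmod \<dots> \<le> integral ?C (\<lambda>x. e * cmod (g x))"
    proof (rule integral_norm_bound_integral)
      show "(\<lambda>x. g x * of_real (F (torus_embedding \<omega> x)) - g x * of_real (P (torus_embedding \<omega> x))) integrable_on ?C"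
        using gF tP by (intro integrable_diff) auto
      show "(\<lambda>x. e * cmod (g x)) integrable_on ?C"
        using integrable_cmul[OF ng, of e] by simp
      fix x assume "x \<in> ?C"
      then have "\<bar>F (torus_embedding \<omega> x) - P (torus_embedding \<omega> x)\<bar> \<le> e"
        using P(2) by force
      from mult_left_mono[OF this norm_ge_zero]
      have "cmod (g x) * \<bar>F (torus_embedding \<omega> x) - P (torus_embedding \<omega> x)\<bar> \<le> cmod (g x) * e" .
      then show "cmod (g x * of_real (F (torus_embedding \<omega> x)) - g x * of_real (P (torus_embedding \<omega> x))) \<le> e * cmod (g x)"
        by (simp add: norm_mult mult.commute flip: right_diff_distrib of_real_diff)
    qed
    also have "\<dots> = e * integral ?C (\<lambda>x. cmod (g x))" by simp
    finally show ?thesis .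
  qed
  show ?thesis
  proof (rule ccontr)
    assume ne: "\<not> ?thesis"
    define I where "I = integral ?C (\<lambda>x. cmod (g x))"
    have I: "I \<ge> 0" unfolding I_def by (intro Henstock_Kurzweil_Integration.integral_nonneg ng) auto
    define a where "a = cmod (integral ?C (\<lambda>x. g x * of_real (F (torus_embedding \<omega> x))))"
    have a: "a > 0" using ne by (simp add: a_def)
    have "a \<le> a / (2 * (I + 1)) * I"
      using bound[of "a / (2 * (I + 1))"] a I by (simp add: a_def I_def)
    also have "\<dots> < a" using a I by (simp add: field_simps) (smt (verit) mult_nonneg_nonneg)
    finally show False by simp
  qed
qed

text \<open>
  A compact set in the open cell is saturated for the quotient map, so its indicator is the pointwise
  limit of the continuous functions \<open>max 0 (1 - n d)\<close>, with \<open>d\<close> the distance to the image of the set.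
\<close>

lemma integral_compact_eq_0:
  fixes g :: "real ^ 'd \<Rightarrow> complex"
  assumes \<omega>: "\<forall>j. \<omega> $ j \<noteq> 0" and g: "g absolutely_integrable_on period_cell \<omega>"
    and zero: "\<And>k. fourier_coeff \<omega> g k = 0"
    and C: "compact C" "C \<subseteq> box 0 (\<chi> j. 2 * pi / \<bar>\<omega> $ j\<bar>)"
  shows "integral C g = 0"
proof (cases "C = {}")
  case False
  let ?D = "period_cell \<omega>"
  define E where "E = torus_embedding \<omega>"
  have CD: "C \<subseteq> ?D" using C(2) box_subset_cbox by (auto simp: period_cell_def)
  have EC: "compact (E ` C)" "E ` C \<noteq> {}"
    unfolding E_def using C(1) False
    by (auto intro!: compact_continuous_image continuous_on_torus_embedding)
  define F where "F n \<zeta> = max 0 (1 - real n * infdist \<zeta> (E ` C))" for n \<zeta>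
  have F: "continuous_on UNIV (F n)" for n
    unfolding F_def by (intro continuous_intros)
  have lim: "(\<lambda>n. g x * of_real (F n (E x))) \<longlonglongrightarrow> (if x \<in> C then g x else 0)" if x: "x \<in> ?D" for x
  proof (cases "x \<in> C")
    case True
    then show ?thesis using x by (simp add: F_def)
  next
    case x': False
    have "E x \<notin> E ` C"
      using torus_embedding_inject[OF \<omega> x] C(2) x' by (auto simp: E_def)
    then have d: "infdist (E x) (E ` C) > 0"
      using EC by (metis compact_imp_closed in_closed_iff_infdist_zero infdist_nonneg less_le)
    obtain N where N: "1 / infdist (E x) (E ` C) < real N" using reals_Archimedean2 by blast
    have "F n (E x) = 0" if "n \<ge> N" for n
    proof -
      have "1 / infdist (E x) (E ` C) \<le> real n" using N that by linarith
      then show ?thesis using d by (simp add: F_def field_simps)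
    qed
    then have "\<forall>\<^sub>F n in sequentially. g x * of_real (F n (E x)) = 0"
      by (auto intro!: eventually_sequentiallyI[of N])
    then show ?thesis using x' by (simp add: tendsto_eventually)
  qed
  have "(\<lambda>n. integral ?D (\<lambda>x. g x * of_real (F n (E x)))) \<longlonglongrightarrow> integral ?D (\<lambda>x. if x \<in> C then g x else 0)"
  proof (rule dominated_convergence(2)[where h = "\<lambda>x. cmod (g x)"])
    show "(\<lambda>x. cmod (g x)) integrable_on ?D"
      using g absolutely_integrable_on_def by blast
    show "(\<lambda>x. g x * of_real (F n (E x))) integrable_on ?D" for n
      by (rule set_lebesgue_integral_eq_integral(1)[OF absolutely_integrable_mult_continuous[OF g]])
         (auto simp: E_def intro!: continuous_intros continuous_on_compose2[OF F] continuous_on_torus_embedding)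
    show "cmod (g x * of_real (F n (E x))) \<le> cmod (g x)" for n x
      by (simp add: norm_mult F_def infdist_nonneg mult_right_le_one_le)
  qed (rule lim)
  moreover have "integral ?D (\<lambda>x. g x * of_real (F n (E x))) = 0" for n
    unfolding E_def by (rule integral_continuous_torus_eq_0[OF \<omega> g zero F])
  ultimately have "integral ?D (\<lambda>x. if x \<in> C then g x else 0) = 0"
    by (simp add: LIMSEQ_const_iff)
  then show ?thesis
    using CD by (simp add: integral_restrict_Int Int_absorb2)
qed simp

text \<open>
  Up to a null set the set of positivity is a countable union of compact sets, and on each of them a
  positive function has integral zero.
\<close>

lemma negligible_positive_part:
  fixes h :: "real ^ 'd \<Rightarrow> real"
  assumes h: "h absolutely_integrable_on cbox a b"
    and zero: "\<And>C. compact C \<Longrightarrow> C \<subseteq> box a b \<Longrightarrow> integral C h = 0"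
  shows "negligible {x \<in> box a b. h x > 0}"
proof -
  let ?A = "{x \<in> box a b. h x > 0}"
  have hb: "h absolutely_integrable_on box a b"
    using h absolutely_integrable_on_open_interval by blast
  have "?A \<in> sets lebesgue"
  proof -
    have "h \<in> borel_measurable (lebesgue_on (box a b))"
      by (rule absolutely_integrable_imp_borel_measurable[OF hb]) simp
    then have "{x \<in> space (lebesgue_on (box a b)). 0 < h x} \<in> sets (lebesgue_on (box a b))"
      by (simp only: borel_measurable_iff_greater)
    then show ?thesis by (simp add: sets_restrict_space_iff)
  qed
  then obtain K N where K: "fsigma K" and N: "N \<in> null_sets lebesgue" and KN: "K \<union> N = ?A"
    by (rule lebesgue_set_almost_fsigma)
  obtain F :: "nat \<Rightarrow> (real ^ 'd) set" where F: "range F \<subseteq> Collect compact" "K = \<Union> (F ` UNIV)"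
    using iffD1[OF fsigma_Union_compact K] by blast
  have "negligible (F n)" for n
  proof -
    have cF: "compact (F n)" using F(1) by auto
    have sub: "F n \<subseteq> ?A" using F(2) KN by auto
    then have box: "F n \<subseteq> box a b" by auto
    have meas: "F n \<in> sets lebesgue"
      using cF by (simp add: compact_imp_closed lmeasurable_compact fmeasurableD)
    have hF: "h absolutely_integrable_on F n"
      by (rule set_integrable_subset[OF hb meas box])
    have "(LINT x : F n | lebesgue. h x) = 0"
      using set_lebesgue_integral_eq_integral(2)[OF hF] zero[OF cF box] by simp
    then have "AE x in lebesgue. indicator (F n) x *\<^sub>R h x = 0"
      using hF sub
      by (subst integral_nonneg_eq_0_iff_AE[symmetric])
         (auto simp: set_lebesgue_integral_def set_integrable_def indicator_def
           intro!: AE_I2 order.strict_implies_order)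
    then have "AE x in lebesgue. x \<notin> F n"
      by (rule AE_mp) (use sub in \<open>auto simp: indicator_def intro!: AE_I2\<close>)
    then show "negligible (F n)"
      using meas by (simp add: negligible_iff_null_sets AE_iff_null_sets)
  qed
  then have "negligible K"
    unfolding F(2) by (intro negligible_countable_Union) auto
  moreover have "negligible N" using N by (simp add: negligible_iff_null_sets)
  ultimately have "negligible (K \<union> N)" by (rule negligible_Un)
  then show ?thesis by (simp only: KN)
qed

theorem fourier_coeff_zero_imp_negligible:
  fixes g :: "real ^ 'd \<Rightarrow> complex"
  assumes \<omega>: "\<forall>j. \<omega> $ j \<noteq> 0" and g: "g absolutely_integrable_on period_cell \<omega>"
    and zero: "\<And>k. fourier_coeff \<omega> g k = 0"
  shows "negligible {x \<in> period_cell \<omega>. g x \<noteq> 0}"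
proof -
  define T where "T = (\<chi> j. 2 * pi / \<bar>\<omega> $ j\<bar>)"
  have cell: "period_cell \<omega> = cbox 0 T" by (simp add: period_cell_def T_def)
  have int: "integral C g = 0" if "compact C" "C \<subseteq> box 0 T" for C
    by (rule integral_compact_eq_0[OF \<omega> g zero that[unfolded T_def]])
  have gC: "g integrable_on C" if "compact C" "C \<subseteq> box 0 T" for C
  proof -
    have "g absolutely_integrable_on C"
      by (rule set_integrable_subset[OF g]) (use that box_subset_cbox cell in
          \<open>auto simp: compact_imp_closed lmeasurable_compact fmeasurableD\<close>)
    then show ?thesis using absolutely_integrable_on_def by blast
  qed
  have part: "negligible {x \<in> box 0 T. l (g x) > 0}" if l: "bounded_linear l" for l :: "complex \<Rightarrow> real"
  proof (rule negligible_positive_part)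
    show "(\<lambda>x. l (g x)) absolutely_integrable_on cbox 0 T"
      using absolutely_integrable_linear[OF g l] by (simp add: cell o_def)
    show "integral C (\<lambda>x. l (g x)) = 0" if "compact C" "C \<subseteq> box 0 T" for C
      using integral_linear[OF gC[OF that] l] int[OF that] bounded_linear.linear[OF l]
      by (simp add: o_def linear_0)
  qed
  have "negligible ((cbox 0 T - box 0 T) \<union> {x \<in> box 0 T. Re (g x) > 0} \<union> {x \<in> box 0 T. - Re (g x) > 0}
      \<union> {x \<in> box 0 T. Im (g x) > 0} \<union> {x \<in> box 0 T. - Im (g x) > 0})"
    by (intro negligible_Un negligible_frontier_interval part[of Re] part[of Im]
        part[of "\<lambda>z. - Re z"] part[of "\<lambda>z. - Im z"] bounded_linear_Re bounded_linear_Im bounded_linear_minus)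
  then show ?thesis
    by (rule negligible_subset) (auto simp: cell complex_eq_iff neq_iff)
qed

section \<open>The weighted Wiener algebra as a Banach algebra of functions\<close>

lemma has_sum_mult_complex:
  fixes f :: "'i \<Rightarrow> complex" and g :: "'j \<Rightarrow> complex"
  assumes f: "(f has_sum a) UNIV" and g: "(g has_sum b) UNIV"
  shows "((\<lambda>(i, j). f i * g j) has_sum a * b) UNIV"
    and "((\<lambda>(i, j). cmod (f i) * cmod (g j)) has_sum (\<Sum>\<^sub>\<infinity>i. cmod (f i)) * (\<Sum>\<^sub>\<infinity>j. cmod (g j))) UNIV"
proof -
  have nf: "((\<lambda>i. cmod (f i)) has_sum (\<Sum>\<^sub>\<infinity>i. cmod (f i))) UNIV"
    and ng: "((\<lambda>j. cmod (g j)) has_sum (\<Sum>\<^sub>\<infinity>j. cmod (g j))) UNIV"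
    using has_sum_imp_summable[OF f] has_sum_imp_summable[OF g]
    unfolding summable_on_iff_abs_summable_on_complex by (simp_all only: has_sum_infsum)
  have row: "((\<lambda>j. cmod (f i) * cmod (g j)) has_sum cmod (f i) * (\<Sum>\<^sub>\<infinity>j. cmod (g j))) UNIV" for i
    by (intro has_sum_cmult_right ng)
  have tot: "((\<lambda>i. cmod (f i) * (\<Sum>\<^sub>\<infinity>j. cmod (g j))) has_sum (\<Sum>\<^sub>\<infinity>i. cmod (f i)) * (\<Sum>\<^sub>\<infinity>j. cmod (g j))) UNIV"
    by (intro has_sum_cmult_left nf)
  have sum: "(\<lambda>(i, j). cmod (f i) * cmod (g j)) summable_on UNIV \<times> UNIV"
    by (rule summable_on_SigmaI[where g = "\<lambda>i. cmod (f i) * (\<Sum>\<^sub>\<infinity>j. cmod (g j))"])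
       (use row tot in \<open>auto simp: summable_on_def\<close>)
  have "((\<lambda>(i, j). cmod (f i) * cmod (g j)) has_sum (\<Sum>\<^sub>\<infinity>i. cmod (f i)) * (\<Sum>\<^sub>\<infinity>j. cmod (g j))) (UNIV \<times> UNIV)"
    by (rule has_sum_SigmaI[OF _ tot sum]) (use row in auto)
  then show "((\<lambda>(i, j). cmod (f i) * cmod (g j)) has_sum (\<Sum>\<^sub>\<infinity>i. cmod (f i)) * (\<Sum>\<^sub>\<infinity>j. cmod (g j))) UNIV"
    by simp
  have "(\<lambda>(i, j). f i * g j) summable_on UNIV \<times> UNIV"
    unfolding summable_on_iff_abs_summable_on_complex
    using sum by (simp add: case_prod_unfold norm_mult)
  then have "((\<lambda>(i, j). f i * g j) has_sum a * b) (UNIV \<times> UNIV)"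
    by (rule has_sum_SigmaI[OF _ has_sum_cmult_left[OF f], rotated]) (use has_sum_cmult_right[OF g] in auto)
  then show "((\<lambda>(i, j). f i * g j) has_sum a * b) UNIV"
    by simp
qed

lemma index_norm_uminus [simp]: "index_norm (- k) = index_norm k"
  by (simp add: index_norm_def)

lemma index_norm_add_le: "index_norm (k + l) \<le> index_norm k + index_norm l"
  unfolding index_norm_def sum.distrib[symmetric] by (intro sum_mono) auto

lemma index_norm_0 [simp]: "index_norm 0 = 0"
  by (simp add: index_norm_def)

lemma fourier_coeff_add:
  assumes "u absolutely_integrable_on period_cell \<omega>" "v absolutely_integrable_on period_cell \<omega>"
  shows "fourier_coeff \<omega> (\<lambda>x. u x + v x) k = fourier_coeff \<omega> u k + fourier_coeff \<omega> v k"
  using set_integral_add(2)[OF assms[THEN absolutely_integrable_mult_continuous[OF _ continuous_on_character]]]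
  by (simp add: fourier_coeff_eq add_divide_distrib distrib_right)

lemma fourier_coeff_diff:
  assumes "u absolutely_integrable_on period_cell \<omega>" "v absolutely_integrable_on period_cell \<omega>"
  shows "fourier_coeff \<omega> (\<lambda>x. u x - v x) k = fourier_coeff \<omega> u k - fourier_coeff \<omega> v k"
  using set_integral_diff(2)[OF assms[THEN absolutely_integrable_mult_continuous[OF _ continuous_on_character]]]
  by (simp add: fourier_coeff_eq diff_divide_distrib left_diff_distrib)

lemma fourier_coeff_mult: "fourier_coeff \<omega> (\<lambda>x. c * u x) k = c * fourier_coeff \<omega> u k"
  by (simp add: fourier_coeff_eq mult.assoc)

text \<open>
  The function \<open>g\<close>, in the application a nonlinear function of an integrable one, inherits its
  measurability from \<open>h\<close> because Lebesgue measure is complete.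
\<close>

lemma fourier_coeff_cong_ae:
  assumes N: "negligible N" and eq: "\<And>x. x \<in> period_cell \<omega> - N \<Longrightarrow> g x = h x"
    and h: "h absolutely_integrable_on period_cell \<omega>"
  shows "fourier_coeff \<omega> g k = fourier_coeff \<omega> h k"
proof -
  have g: "g absolutely_integrable_on period_cell \<omega>"
    by (rule absolutely_integrable_spike[OF h N]) (use eq in auto)
  have "integral (period_cell \<omega>) (\<lambda>x. g x * character \<omega> (- k) x) = integral (period_cell \<omega>) (\<lambda>x. h x * character \<omega> (- k) x)"
    by (rule integral_spike[OF N]) (use eq in auto)
  then show ?thesis
    unfolding fourier_coeff_eq
    by (simp add: set_lebesgue_integral_eq_integral(2)
        absolutely_integrable_mult_continuous[OF _ continuous_on_character] g h)
qed

lemma norm_fourier_coeff_le: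
  assumes \<omega>: "\<forall>j. \<omega> $ j \<noteq> 0" and u: "u absolutely_integrable_on period_cell \<omega>"
    and bound: "\<And>x. cmod (u x) \<le> B"
  shows "cmod (fourier_coeff \<omega> u k) \<le> B"
proof -
  have m: "measure lebesgue (period_cell \<omega>) > 0" by (rule measure_period_cell[OF \<omega>])
  have "B \<ge> 0" using bound norm_ge_zero order.trans by blast
  have "((\<lambda>x. u x * character \<omega> (- k) x) has_integral
      (LINT x : period_cell \<omega> | lebesgue. u x * character \<omega> (- k) x)) (period_cell \<omega>)"
    by (rule has_integral_set_lebesgue[OF absolutely_integrable_mult_continuous[OF u continuous_on_character]])
  then have "cmod (LINT x : period_cell \<omega> | lebesgue. u x * character \<omega> (- k) x)
      \<le> B * measure lebesgue (period_cell \<omega>)"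
    unfolding period_cell_def
    by (subst measure_completion)
       (auto intro!: has_integral_bound[OF \<open>B \<ge> 0\<close>] simp: norm_mult bound)
  then show ?thesis
    using m by (simp add: fourier_coeff_eq norm_divide divide_le_eq)
qed

locale torus =
  fixes \<omega> :: "real ^ 'd" and \<nu> :: real
  assumes \<omega>: "\<forall>j. \<omega> $ j \<noteq> 0" and \<nu>: "\<nu> \<ge> 1"
begin

lemma weight_pos: "\<nu> ^ n > 0" and weight_ge_1: "\<nu> ^ n \<ge> 1"
  and weight_nonzero: "complex_of_real (\<nu> ^ n) \<noteq> 0"
  using \<nu> by (auto simp: one_le_power)

text \<open>
  The Fourier series of the function whose weighted coefficients are \<open>a\<close>. The weight is absorbed into
  the coefficients so that the norm of the type \<open>l1\<close> is the Wiener norm for every \<open>\<nu>\<close>.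
\<close>

definition ev :: "real ^ 'd \<Rightarrow> (int ^ 'd) l1 \<Rightarrow> complex" where
  "ev x a = (\<Sum>\<^sub>\<infinity>k. coeff a k / of_real (\<nu> ^ index_norm k) * character \<omega> k x)"

lemma norm_ev_term: "cmod (coeff a k / of_real (\<nu> ^ index_norm k) * character \<omega> k x) \<le> cmod (coeff a k)"
proof -
  have "cmod (coeff a k) / \<nu> ^ index_norm k \<le> cmod (coeff a k) / 1"
    by (intro divide_left_mono weight_ge_1) (simp_all add: weight_pos)
  then show ?thesis
    by (simp only: norm_mult norm_divide norm_of_real norm_character abs_of_pos[OF weight_pos] div_by_1 mult_1_right)
qed

lemma ev_has_sum: "((\<lambda>k. coeff a k / of_real (\<nu> ^ index_norm k) * character \<omega> k x) has_sum ev x a) UNIV"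
  unfolding ev_def
  by (rule has_sum_infsum[OF abs_summable_summable[OF
      Infinite_Sum.abs_summable_on_comparison_test'[OF coeff_abs_summable norm_ev_term]]])

lemma norm_ev_le: "cmod (ev x a) \<le> norm a"
  by (rule norm_infsum_le[OF ev_has_sum norm_l1_has_sum norm_ev_term])

lemma bounded_linear_ev: "bounded_linear (ev x)"
proof (rule bounded_linear_intro[where K = 1])
  fix a b :: "(int ^ 'd) l1" and r :: real
  show "ev x (a + b) = ev x a + ev x b"
    using has_sum_add[OF ev_has_sum[of a x] ev_has_sum[of b x]] has_sum_unique[OF ev_has_sum[of "a + b" x]]
    by (simp add: add_divide_distrib distrib_right)
  show "ev x (r *\<^sub>R a) = r *\<^sub>R ev x a"
    using has_sum_scaleR[OF ev_has_sum[of a x], of r] has_sum_unique[OF ev_has_sum[of "r *\<^sub>R a" x]]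
    by (simp add: scaleR_conv_of_real mult.assoc)
qed (simp add: norm_ev_le)

lemma ev_single: "ev x (single k c) = c / of_real (\<nu> ^ index_norm k) * character \<omega> k x"
  using has_sum_unique[OF ev_has_sum has_sum_finite_neutralI[of "{k}"]] by fastforce

lemma continuous_on_ev: "continuous_on S (\<lambda>x. ev x a)"
proof -
  have "uniform_limit S (\<lambda>F x. \<Sum>k\<in>F. coeff a k / of_real (\<nu> ^ index_norm k) * character \<omega> k x)
      (\<lambda>x. ev x a) (finite_subsets_at_top UNIV)"
    unfolding ev_def by (rule Weierstrass_m_test_general[OF norm_ev_term coeff_abs_summable])
  then show ?thesis
  proof (rule uniform_limit_theorem[rotated])
    show "\<forall>\<^sub>F F in finite_subsets_at_top UNIV. continuous_on S
        (\<lambda>x. \<Sum>k\<in>F. coeff a k / of_real (\<nu> ^ index_norm k) * character \<omega> k x)"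
      by (intro always_eventually allI continuous_on_sum continuous_on_mult continuous_on_const
          continuous_on_character)
  qed simp
qed

lemma ev_absolutely_integrable: "(\<lambda>x. ev x a) absolutely_integrable_on period_cell \<omega>"
  unfolding period_cell_def by (rule absolutely_integrable_continuous[OF continuous_on_ev])

text \<open>
  Both sides are bounded linear in \<open>a\<close>, so it suffices to compare them on single characters, where the
  identity is the orthogonality of characters.
\<close>

lemma fourier_coeff_ev: "fourier_coeff \<omega> (\<lambda>x. ev x a) k = coeff a k / of_real (\<nu> ^ index_norm k)"
proof -
  interpret ev: bounded_linear "ev x" for x by (rule bounded_linear_ev)
  have lin: "bounded_linear (\<lambda>a. fourier_coeff \<omega> (\<lambda>x. ev x a) k)"
  proof (rule bounded_linear_intro[where K = 1])
    fix a b :: "(int ^ 'd) l1" and r :: real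
    show "fourier_coeff \<omega> (\<lambda>x. ev x (a + b)) k
        = fourier_coeff \<omega> (\<lambda>x. ev x a) k + fourier_coeff \<omega> (\<lambda>x. ev x b) k"
      unfolding ev.add by (intro fourier_coeff_add ev_absolutely_integrable)
    show "fourier_coeff \<omega> (\<lambda>x. ev x (r *\<^sub>R a)) k = r *\<^sub>R fourier_coeff \<omega> (\<lambda>x. ev x a) k"
      unfolding ev.scaleR scaleR_conv_of_real by (rule fourier_coeff_mult)
    show "cmod (fourier_coeff \<omega> (\<lambda>x. ev x a) k) \<le> norm a * 1"
      using norm_fourier_coeff_le[OF \<omega> ev_absolutely_integrable norm_ev_le] by simp
  qed
  have char: "fourier_coeff \<omega> (character \<omega> l) k = (if l = k then 1 else 0)" for l
    using measure_period_cell[OF \<omega>] integral_character[OF \<omega>, of "l - k"]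
    by (auto simp: fourier_coeff_eq character_add[symmetric])
  have "((\<lambda>l. fourier_coeff \<omega> (\<lambda>x. ev x (single l (coeff a l))) k) has_sum fourier_coeff \<omega> (\<lambda>x. ev x a) k) UNIV"
    by (rule has_sum_bounded_linear[OF lin has_sum_single])
  moreover have "((\<lambda>l. fourier_coeff \<omega> (\<lambda>x. ev x (single l (coeff a l))) k) has_sum coeff a k / of_real (\<nu> ^ index_norm k)) UNIV"
    by (rule has_sum_finite_neutralI[of "{k}"])
       (simp_all only: ev_single fourier_coeff_mult char, simp_all)
  ultimately show ?thesis by (rule has_sum_unique)
qed

definition coeffs :: "(real ^ 'd \<Rightarrow> complex) \<Rightarrow> (int ^ 'd) l1" where
  "coeffs u = Abs_l1 (\<lambda>k. fourier_coeff \<omega> u k * of_real (\<nu> ^ index_norm k))"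

lemma norm_weighted: "cmod (c * of_real (\<nu> ^ n)) = cmod c * \<nu> ^ n"
  using \<nu> by (simp add: norm_mult norm_power)

lemma coeff_coeffs:
  assumes "u \<in> wiener_algebra \<omega> \<nu>"
  shows "coeff (coeffs u) k = fourier_coeff \<omega> u k * of_real (\<nu> ^ index_norm k)"
  unfolding coeffs_def
  by (subst Abs_l1_inverse) (use assms in \<open>simp_all only: wiener_algebra_def mem_Collect_eq norm_weighted\<close>)

lemma coeffs_eqI:
  assumes "u \<in> wiener_algebra \<omega> \<nu>" "\<And>k. fourier_coeff \<omega> u k = coeff a k / of_real (\<nu> ^ index_norm k)"
  shows "coeffs u = a"
  by (rule l1_eqI) (use coeff_coeffs[OF assms(1)] assms(2) \<nu> in simp)

lemma ev_in_wiener_algebra: "(\<lambda>x. ev x a) \<in> wiener_algebra \<omega> \<nu>"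
proof -
  have "torus_fun \<omega> (\<lambda>x. ev x a)"
    by (simp add: torus_fun_def ev_def character_periodic[OF \<omega>])
  moreover have "cmod (coeff a k / of_real (\<nu> ^ index_norm k)) * \<nu> ^ index_norm k = cmod (coeff a k)" for k
    using \<nu> by (simp add: norm_divide norm_power)
  ultimately show ?thesis
    by (simp add: wiener_algebra_def ev_absolutely_integrable fourier_coeff_ev coeff_abs_summable del: of_real_power)
qed

lemma coeffs_ev [simp]: "coeffs (\<lambda>x. ev x a) = a"
  by (rule coeffs_eqI[OF ev_in_wiener_algebra fourier_coeff_ev])

lemma ev_inject: "(\<And>x. ev x a = ev x b) \<Longrightarrow> a = b"
  by (metis coeffs_ev ext)

lemma wiener_dist_eq:
  assumes u: "u \<in> wiener_algebra \<omega> \<nu>" and v: "v \<in> wiener_algebra \<omega> \<nu>"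
  shows "wiener_dist \<omega> \<nu> u v = norm (coeffs u - coeffs v)"
proof -
  have "fourier_coeff \<omega> (\<lambda>x. u x - v x) k = fourier_coeff \<omega> u k - fourier_coeff \<omega> v k" for k
    using u v by (intro fourier_coeff_diff) (auto simp: wiener_algebra_def)
  then show ?thesis
    unfolding wiener_dist_def wiener_norm_def norm_l1_def coeff_simps coeff_coeffs[OF u] coeff_coeffs[OF v]
    by (simp only: left_diff_distrib[symmetric] norm_weighted)
qed

lemma wiener_algebra_eq_ev:
  assumes u: "u \<in> wiener_algebra \<omega> \<nu>"
  shows "negligible {x \<in> period_cell \<omega>. u x \<noteq> ev x (coeffs u)}"
proof -
  have int: "u absolutely_integrable_on period_cell \<omega>" using u by (simp add: wiener_algebra_def)
  have "negligible {x \<in> period_cell \<omega>. u x - ev x (coeffs u) \<noteq> 0}"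
  proof (rule fourier_coeff_zero_imp_negligible[OF \<omega>])
    show "(\<lambda>x. u x - ev x (coeffs u)) absolutely_integrable_on period_cell \<omega>"
      by (rule set_integral_diff(1)[OF int ev_absolutely_integrable])
    show "fourier_coeff \<omega> (\<lambda>x. u x - ev x (coeffs u)) k = 0" for k
      using \<nu> by (simp add: fourier_coeff_diff[OF int ev_absolutely_integrable] fourier_coeff_ev coeff_coeffs[OF u])
  qed
  then show ?thesis by simp
qed

text \<open>
  Convolution of the unweighted coefficients. The quotient of weights, at most \<open>1\<close> because \<open>index_norm\<close>
  is subadditive, converts between the weighted coefficients stored in \<open>a\<close>, \<open>b\<close> and in the product.
\<close>

definition mul :: "(int ^ 'd) l1 \<Rightarrow> (int ^ 'd) l1 \<Rightarrow> (int ^ 'd) l1" where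
  "mul a b = (\<Sum>\<^sub>\<infinity>(k, l). single (k + l)
     (coeff a k * coeff b l * of_real (\<nu> ^ index_norm (k + l) / (\<nu> ^ index_norm k * \<nu> ^ index_norm l))))"

definition conj :: "(int ^ 'd) l1 \<Rightarrow> (int ^ 'd) l1" where
  "conj a = Abs_l1 (\<lambda>k. cnj (coeff a (- k)))"

lemma conj: "coeff (conj a) k = cnj (coeff a (- k))" "norm (conj a) \<le> norm a"
proof -
  have *: "(\<Sum>k\<in>F. cmod (cnj (coeff a (- k)))) \<le> norm a" if "finite F" for F
  proof -
    have "(\<Sum>k\<in>F. cmod (cnj (coeff a (- k)))) = (\<Sum>k\<in>uminus ` F. cmod (coeff a k))"
      by (subst sum.reindex) auto
    also have "\<dots> \<le> norm a" by (rule sum_coeff_le_norm) (use that in simp)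
    finally show ?thesis .
  qed
  show "coeff (conj a) k = cnj (coeff a (- k))" "norm (conj a) \<le> norm a"
    unfolding conj_def using Abs_l1_bounded[OF *] by simp_all
qed

lemma ev_conj: "ev x (conj a) = cnj (ev x a)"
proof -
  have "((\<lambda>k. cnj (coeff a k / of_real (\<nu> ^ index_norm k) * character \<omega> k x)) has_sum cnj (ev x a)) UNIV"
    by (rule has_sum_bounded_linear[OF bounded_linear_cnj ev_has_sum])
  then have "((\<lambda>k. coeff (conj a) k / of_real (\<nu> ^ index_norm k) * character \<omega> k x) has_sum cnj (ev x a)) UNIV"
    by (subst (asm) has_sum_reindex_bij_witness[where S = UNIV and T = UNIV and i = uminus and j = uminus
          and h = "\<lambda>k. coeff (conj a) k / of_real (\<nu> ^ index_norm k) * character \<omega> k x"])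
       (auto simp: conj cnj_character)
  then show ?thesis by (rule has_sum_unique[OF ev_has_sum])
qed

lemma mul_has_sum:
  "((\<lambda>(k, l). single (k + l)
     (coeff a k * coeff b l * of_real (\<nu> ^ index_norm (k + l) / (\<nu> ^ index_norm k * \<nu> ^ index_norm l))))
    has_sum mul a b) UNIV" (is "(?t has_sum _) _")
  and norm_mul_le: "norm (mul a b) \<le> norm a * norm b"
proof -
  have le: "norm (?t i) \<le> (\<lambda>(k, l). cmod (coeff a k) * cmod (coeff b l)) i" for i
  proof -
    obtain k l where i: "i = (k, l)" by force
    have "\<nu> ^ index_norm (k + l) \<le> \<nu> ^ index_norm k * \<nu> ^ index_norm l"
      unfolding power_add[symmetric] by (rule power_increasing[OF index_norm_add_le \<nu>])
    then have "\<nu> ^ index_norm (k + l) / (\<nu> ^ index_norm k * \<nu> ^ index_norm l) \<le> 1"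
      using \<nu> by (simp add: divide_le_eq)
    moreover have "\<nu> ^ index_norm (k + l) / (\<nu> ^ index_norm k * \<nu> ^ index_norm l) \<ge> 0"
      using \<nu> by simp
    ultimately have "cmod (of_real (\<nu> ^ index_norm (k + l) / (\<nu> ^ index_norm k * \<nu> ^ index_norm l))) \<le> 1"
      by (simp only: norm_of_real abs_of_nonneg)
    from mult_left_mono[OF this, of "cmod (coeff a k * coeff b l)"]
    show ?thesis by (simp only: i prod.case norm_single norm_mult mult_1_right) simp
  qed
  have prod: "((\<lambda>(k, l). cmod (coeff a k) * cmod (coeff b l)) has_sum norm a * norm b) UNIV"
    using has_sum_mult_complex(2)[OF has_sum_infsum has_sum_infsum, of "coeff a" "coeff b"]
      summable_on_iff_abs_summable_on_complex coeff_abs_summable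
    unfolding norm_l1_def by blast
  show sum: "(?t has_sum mul a b) UNIV"
    unfolding mul_def
    by (rule has_sum_infsum[OF abs_summable_summable[OF
        Infinite_Sum.abs_summable_on_comparison_test'[OF has_sum_imp_summable[OF prod] le]]])
  show "norm (mul a b) \<le> norm a * norm b"
    by (rule norm_infsum_le[OF sum prod le])
qed

lemma ev_mul: "ev x (mul a b) = ev x a * ev x b"
proof -
  have "((\<lambda>i. ev x (case i of (k, l) \<Rightarrow> single (k + l)
     (coeff a k * coeff b l * of_real (\<nu> ^ index_norm (k + l) / (\<nu> ^ index_norm k * \<nu> ^ index_norm l)))))
    has_sum ev x (mul a b)) UNIV"
    by (rule has_sum_bounded_linear[OF bounded_linear_ev mul_has_sum])
  moreover have "ev x (case i of (k, l) \<Rightarrow> single (k + l)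
     (coeff a k * coeff b l * of_real (\<nu> ^ index_norm (k + l) / (\<nu> ^ index_norm k * \<nu> ^ index_norm l))))
     = (case i of (k, l) \<Rightarrow> (coeff a k / of_real (\<nu> ^ index_norm k) * character \<omega> k x)
         * (coeff b l / of_real (\<nu> ^ index_norm l) * character \<omega> l x))" for i
    using \<nu> by (cases i) (simp add: ev_single character_add)
  ultimately have "((\<lambda>(k, l). (coeff a k / of_real (\<nu> ^ index_norm k) * character \<omega> k x)
         * (coeff b l / of_real (\<nu> ^ index_norm l) * character \<omega> l x)) has_sum ev x (mul a b)) UNIV"
    by (simp only:)
  then show ?thesis
    by (rule has_sum_unique[OF _ has_sum_mult_complex(1)[OF ev_has_sum ev_has_sum]])
qed

sublocale function_algebra ev mul "single 0" conj
  by (rule function_algebra.intro)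
     (simp_all add: bounded_linear_ev norm_ev_le ev_mul ev_single ev_conj norm_mul_le conj(2) ev_inject)

lemma coeff_cst_mul: "coeff (mul (single 0 c) a) k = c * coeff a k"
proof -
  have "(\<lambda>x. ev x (mul (single 0 c) a)) = (\<lambda>x. c * ev x a)"
    by (simp add: ev_mul ev_single)
  then have "coeff (mul (single 0 c) a) k / of_real (\<nu> ^ index_norm k) = c * (coeff a k / of_real (\<nu> ^ index_norm k))"
    by (metis fourier_coeff_ev fourier_coeff_mult)
  then show ?thesis using \<nu> by simp
qed

end

section \<open>The free evolution and the equations for the coefficients\<close>

context torus
begin

abbreviation cst :: "complex \<Rightarrow> (int ^ 'd) l1" where "cst \<equiv> single 0"

definition dispersion :: "int ^ 'd \<Rightarrow> real" where
  "dispersion k = (\<Sum>j\<in>UNIV. (real_of_int (k $ j) * \<omega> $ j)\<^sup>2)"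

definition phase :: "real \<Rightarrow> int ^ 'd \<Rightarrow> complex" where
  "phase t k = exp (- (\<i> * of_real (dispersion k * t)))"

definition flow :: "real \<Rightarrow> (int ^ 'd) l1 \<Rightarrow> (int ^ 'd) l1" where
  "flow t a = Abs_l1 (\<lambda>k. phase t k * coeff a k)"

lemma dispersion_0 [simp]: "dispersion 0 = 0"
  by (simp add: dispersion_def)

lemma norm_phase [simp]: "cmod (phase t k) = 1"
  by (simp add: phase_def)

lemma phase_minus: "phase (- t) k * phase t k = 1" "phase t k * phase (- t) k = 1"
  by (simp_all add: phase_def flip: exp_add)

lemma coeff_flow: "coeff (flow t a) k = phase t k * coeff a k"
  and norm_flow_le: "norm (flow t a) \<le> norm a"
proof -
  have *: "(\<Sum>k\<in>F. cmod (phase t k * coeff a k)) \<le> norm a" if "finite F" for F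
    using sum_coeff_le_norm[OF that] by (simp add: norm_mult)
  show "coeff (flow t a) k = phase t k * coeff a k" "norm (flow t a) \<le> norm a"
    unfolding flow_def using Abs_l1_bounded[OF *] by simp_all
qed

lemma flow_diff: "flow t (a - b) = flow t a - flow t b"
  by (rule l1_eqI) (simp add: coeff_flow algebra_simps)

lemma flow_zero [simp]: "flow t 0 = 0"
  by (rule l1_eqI) (simp add: coeff_flow)

text \<open>
  The flow consists of isometries, so strong continuity of single orbits gives joint continuity. An
  orbit is a uniformly convergent sum of its coefficients.
\<close>

lemma continuous_on_flow: "continuous_on UNIV (\<lambda>(t, a). flow t a)"
proof -
  have orbit: "continuous_on UNIV (\<lambda>t. flow t a)" for a
  proof -
    have termwise: "norm (single k (phase t k * coeff a k)) \<le> cmod (coeff a k)" for k t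
      by (simp add: norm_mult)
    have "uniform_limit UNIV (\<lambda>F t. \<Sum>k\<in>F. single k (phase t k * coeff a k))
        (\<lambda>t. \<Sum>\<^sub>\<infinity>k. single k (phase t k * coeff a k)) (finite_subsets_at_top UNIV)"
      by (rule Weierstrass_m_test_general[OF termwise coeff_abs_summable])
    moreover have "(\<Sum>\<^sub>\<infinity>k. single k (phase t k * coeff a k)) = flow t a" for t
      using has_sum_single[of "flow t a"] by (simp add: coeff_flow infsumI)
    ultimately have lim: "uniform_limit UNIV (\<lambda>F t. \<Sum>k\<in>F. single k (phase t k * coeff a k))
        (\<lambda>t. flow t a) (finite_subsets_at_top UNIV)"
      by simp
    show ?thesis
    proof (rule uniform_limit_theorem[OF _ lim])
      show "\<forall>\<^sub>F F in finite_subsets_at_top UNIV. continuous_on UNIV (\<lambda>t. \<Sum>k\<in>F. single k (phase t k * coeff a k))"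
        by (intro always_eventually allI continuous_on_sum bounded_linear.continuous_on[OF bounded_linear_single])
           (auto simp: phase_def intro!: continuous_intros)
    qed simp
  qed
  show ?thesis
    unfolding continuous_on_def
  proof (clarify, simp)
    fix t a
    have "((\<lambda>(s, b). flow s (b - a) + flow s a) \<longlongrightarrow> 0 + flow t a) (at (t, a))"
      unfolding case_prod_unfold
    proof (rule tendsto_add)
      have "((\<lambda>x. snd x - a) \<longlongrightarrow> snd (t, a) - a) (at (t, a))" by (intro tendsto_intros)
      then have "((\<lambda>x. norm (snd x - a)) \<longlongrightarrow> 0) (at (t, a))" by (simp add: tendsto_norm_zero)
      then show "((\<lambda>x. flow (fst x) (snd x - a)) \<longlongrightarrow> 0) (at (t, a))"
        by (rule Lim_null_comparison[rotated]) (simp add: norm_flow_le always_eventually)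
      have "((\<lambda>x. fst x) \<longlongrightarrow> fst (t, a)) (at (t, a))" by (intro tendsto_intros)
      then show "((\<lambda>x. flow (fst x) a) \<longlongrightarrow> flow t a) (at (t, a))"
        using orbit[of a] by (intro isCont_tendsto_compose[of _ "\<lambda>t. flow t a"]) (auto simp: continuous_on_eq_continuous_at)
    qed
    then show "((\<lambda>(s, b). flow s b) \<longlongrightarrow> flow t a) (at (t, a))"
      by (simp add: flow_diff)
  qed
qed

lemma nonlinear_coeff:
  assumes N: "\<And>u x. norm u \<le> r \<Longrightarrow> ev x (N u) = ev x u ^ p * f (ev x u)"
    and u: "u \<in> wiener_algebra \<omega> \<nu>" and small: "norm (coeffs u) \<le> r"
  shows "fourier_coeff \<omega> (\<lambda>x. u x ^ p * f (u x)) k = coeff (N (coeffs u)) k / of_real (\<nu> ^ index_norm k)"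
proof -
  have "fourier_coeff \<omega> (\<lambda>x. u x ^ p * f (u x)) k = fourier_coeff \<omega> (\<lambda>x. ev x (N (coeffs u))) k"
    by (rule fourier_coeff_cong_ae[OF wiener_algebra_eq_ev[OF u] _ ev_absolutely_integrable])
       (auto simp: N[OF small])
  then show ?thesis by (simp only: fourier_coeff_ev)
qed

text \<open>
  Multiplying the equation of a solution by \<open>\<i>\<close> and by the weight gives the equation for the stored
  coefficients. The statement concerns a single time because \<open>N\<close> represents the nonlinear term only
  while the norm is at most \<open>r\<close>.
\<close>

lemma nls_coeff_iff:
  assumes N: "\<And>u x. norm u \<le> r \<Longrightarrow> ev x (N u) = ev x u ^ p * f (ev x u)"
    and u: "\<And>t. u t \<in> wiener_algebra \<omega> \<nu>" and small: "norm (coeffs (u t)) \<le> r"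
  shows "((\<lambda>s. - \<i> * fourier_coeff \<omega> (u s) k) has_vector_derivative
               (- complex_of_real (\<Sum>j\<in>UNIV. (real_of_int (k $ j) * \<omega> $ j)\<^sup>2)
                  * fourier_coeff \<omega> (u t) k
                + fourier_coeff \<omega> (\<lambda>x. u t x ^ p * f (u t x)) k)) (at t)
     \<longleftrightarrow> ((\<lambda>s. coeff (coeffs (u s)) k) has_vector_derivative
            (- \<i> * of_real (dispersion k) * coeff (coeffs (u t)) k + \<i> * coeff (N (coeffs (u t))) k)) (at t)"
    (is "?L \<longleftrightarrow> ?R")
proof -
  define w where "w = complex_of_real (\<nu> ^ index_norm k)"
  have w: "w \<noteq> 0" unfolding w_def by (rule weight_nonzero)
  have c: "coeff (coeffs (u s)) k = fourier_coeff \<omega> (u s) k * w" for s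
    unfolding w_def by (rule coeff_coeffs[OF u])
  have nl: "fourier_coeff \<omega> (\<lambda>x. u t x ^ p * f (u t x)) k = coeff (N (coeffs (u t))) k / w"
    unfolding w_def by (rule nonlinear_coeff[OF N u small])
  define q where "q = fourier_coeff \<omega> (\<lambda>x. u t x ^ p * f (u t x)) k"
  have L: "?L \<longleftrightarrow> ((\<lambda>s. - \<i> * fourier_coeff \<omega> (u s) k) has_vector_derivative
      (- of_real (dispersion k) * fourier_coeff \<omega> (u t) k + q)) (at t)"
    by (simp only: dispersion_def q_def)
  have R: "?R \<longleftrightarrow> ((\<lambda>s. \<i> * w * (- \<i> * fourier_coeff \<omega> (u s) k)) has_vector_derivative
      \<i> * w * (- of_real (dispersion k) * fourier_coeff \<omega> (u t) k + q)) (at t)"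
  proof -
    have "coeff (N (coeffs (u t))) k = w * q" using w by (simp add: nl q_def)
    then show ?thesis by (simp add: c algebra_simps)
  qed
  show ?thesis
  proof
    assume ?L
    then show ?R unfolding L R by (rule has_vector_derivative_mult_right)
  next
    assume ?R
    then have "((\<lambda>s. 1 / (\<i> * w) * (\<i> * w * (- \<i> * fourier_coeff \<omega> (u s) k))) has_vector_derivative
      1 / (\<i> * w) * (\<i> * w * (- of_real (dispersion k) * fourier_coeff \<omega> (u t) k + q))) (at t)"
      unfolding R by (rule has_vector_derivative_mult_right)
    moreover have "1 / (\<i> * w) * (\<i> * w * X) = X" for X using w by simp
    ultimately show ?L unfolding L by (simp only:)
  qed
qed

end

section \<open>The reference orbit of the planar equation\<close>

text \<open>
  The orbit is \<open>(w / (t + \<i> B))\<^bsup>1/n\<^esup>\<close> with \<open>w = \<i> / (n f\<^sub>0)\<close>. Every required property can be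
  read off from \<open>z\<^sup>n = w / (t + \<i> B)\<close>; a large \<open>B\<close> makes the orbit small, and \<open>B > 0\<close> keeps
  \<open>t + \<i> B\<close> away from the cut of the logarithm.
\<close>

lemma reference_orbit:
  fixes f\<^sub>0 :: complex and n :: nat
  assumes n: "n \<ge> 1" and f0: "f\<^sub>0 \<noteq> 0" and \<delta>: "\<delta> > 0"
  obtains z :: "real \<Rightarrow> complex"
  where "\<And>t. (z has_vector_derivative \<i> * f\<^sub>0 * z t ^ Suc n) (at t)" "\<And>t. z t \<noteq> 0"
    "\<And>t. cmod (z t) \<le> cmod (z 0)" "cmod (z 0) \<le> \<delta>"
    "\<And>t. \<bar>t\<bar> * cmod (z t) ^ n \<le> 1 / cmod f\<^sub>0"
    "(z \<longlongrightarrow> 0) at_infinity"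
proof -
  define w where "w = \<i> / (of_nat n * f\<^sub>0)"
  have w: "w \<noteq> 0" using n f0 by (simp add: w_def)
  define B where "B = cmod w / \<delta> ^ n"
  have B: "B > 0" using w \<delta> by (simp add: B_def)
  define s where "s t = complex_of_real t + \<i> * complex_of_real B" for t
  have s: "s t \<notin> \<real>\<^sub>\<le>\<^sub>0" "s t \<noteq> 0" for t
    using B by (auto simp: s_def complex_nonpos_Reals_iff complex_eq_iff)
  have s_ge: "B \<le> cmod (s t)" "\<bar>t\<bar> \<le> cmod (s t)" for t
    using abs_Im_le_cmod[of "s t"] abs_Re_le_cmod[of "s t"] B by (auto simp: s_def)
  define z where "z t = exp ((Ln w - Ln (s t)) / of_nat n)" for t
  \<comment> \<open>All moduli are computed from the \<open>n\<close>-th power, where the root has disappeared.\<close>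
  have zn: "z t ^ n = w / s t" for t
    using n w s(2)[of t] by (simp add: z_def exp_diff flip: exp_of_nat_mult)
  then have norm_zn: "cmod (z t) ^ n = cmod w / cmod (s t)" for t
    by (metis norm_divide norm_power)
  show ?thesis
  proof
    fix t :: real
    show "z t \<noteq> 0" by (simp add: z_def)
    have "((\<lambda>x. exp ((Ln w - Ln (x + \<i> * complex_of_real B)) / of_nat n)) has_field_derivative
        z t * (- inverse (s t) / of_nat n)) (at (complex_of_real t))"
      using s(1)[of t] n
      by (auto intro!: derivative_eq_intros simp: z_def s_def divide_inverse mult_ac)
    then have "(z has_vector_derivative z t * (- inverse (s t) / of_nat n)) (at t)"
      unfolding z_def[abs_def] s_def by (rule has_vector_derivative_real_field)
    also have "z t * (- inverse (s t) / of_nat n) = \<i> * f\<^sub>0 * z t ^ Suc n"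
      using n f0 s(2)[of t] by (simp add: zn w_def field_simps)
    finally show "(z has_vector_derivative \<i> * f\<^sub>0 * z t ^ Suc n) (at t)" .
    have le: "cmod (z t) ^ n \<le> \<delta> ^ n" for t
    proof -
      have "cmod w \<le> cmod (s t) * \<delta> ^ n"
        using s_ge(1)[of t] \<delta> by (simp add: B_def field_simps)
      then show ?thesis using s(2)[of t] by (simp add: norm_zn divide_le_eq mult.commute)
    qed
    have "cmod (s 0) = B" using B by (simp add: s_def norm_mult)
    then have "cmod (z t) ^ n \<le> cmod (z 0) ^ n"
      using s_ge(1)[of t] B s(2)[of t] unfolding norm_zn by (intro divide_left_mono) auto
    then show "cmod (z t) \<le> cmod (z 0)"
      using n by (simp add: power_mono_iff)
    show "cmod (z 0) \<le> \<delta>"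
      using le[of 0] n \<delta> by (simp add: power_mono_iff)
    have "\<bar>t\<bar> * cmod (z t) ^ n \<le> cmod w"
    proof -
      have "\<bar>t\<bar> * cmod w \<le> cmod w * cmod (s t)"
        using mult_right_mono[OF s_ge(2)[of t] norm_ge_zero[of w]] by (simp only: mult.commute)
      then show ?thesis using s(2)[of t] by (simp add: norm_zn divide_le_eq)
    qed
    also have "cmod w \<le> 1 / cmod f\<^sub>0"
      using n f0 by (simp add: w_def norm_divide norm_mult field_simps)
    finally show "\<bar>t\<bar> * cmod (z t) ^ n \<le> 1 / cmod f\<^sub>0" .
  next
    show "(z \<longlongrightarrow> 0) at_infinity"
    proof (rule tendstoI)
      fix e :: real assume e: "e > 0"
      have "cmod (z t) < e" if "cmod w / e ^ n + 1 \<le> norm t" for t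
      proof -
        have "cmod w / e ^ n < cmod (s t)" using s_ge(2)[of t] that by auto
        then have "cmod w < cmod (s t) * e ^ n" using e by (simp add: field_simps)
        then have "cmod (z t) ^ n < e ^ n"
          using s(2)[of t] by (simp add: norm_zn field_simps)
        then show ?thesis using e power_less_imp_less_base[of "cmod (z t)" n e] by simp
      qed
      then show "\<forall>\<^sub>F t in at_infinity. dist (z t) 0 < e"
        by (auto simp: eventually_at_infinity)
    qed
  qed
qed

section \<open>Solutions that shadow the reference orbit\<close>

lemma has_vector_derivative_mult3:
  fixes a b c :: "real \<Rightarrow> complex"
  assumes "(a has_vector_derivative a') (at t)" "(b has_vector_derivative b') (at t)"
    "(c has_vector_derivative c') (at t)"
  shows "((\<lambda>s. a s * b s * c s) has_vector_derivative (a' * b t * c t + a t * b' * c t + a t * b t * c')) (at t)"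
  using has_vector_derivative_mult[OF has_vector_derivative_mult[OF assms(1,2)] assms(3)]
  by (simp add: algebra_simps)

text \<open>
  The constants of the construction: \<open>N\<close> represents the nonlinearity on the ball of radius \<open>r\<close>, \<open>z\<close> is
  the reference orbit and \<open>\<eta>\<close> the relative width of the tube. The last two assumptions bound
  the drift of \<open>y\<close> over the time \<open>\<rho> / \<bar>f(0)\<bar>\<close> by \<open>\<eta> \<rho> / 4\<close> and make the fixed point map a contraction.
\<close>

locale homoclinic_tube = torus \<omega> \<nu> for \<omega> :: "real ^ 'd" and \<nu> :: real +
  fixes f :: "complex \<Rightarrow> complex" and n :: nat
    and N :: "(int ^ 'd) l1 \<Rightarrow> (int ^ 'd) l1" and r K \<eta> :: real and z :: "real \<Rightarrow> complex"
  assumes f0: "f 0 \<noteq> 0" and K: "K \<ge> 0"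
    and N_ev: "\<And>u x. norm u \<le> r \<Longrightarrow> ev x (N u) = ev x u ^ (n + 2) * f (ev x u)"
    and N_cont: "continuous_on (cball 0 r) N"
    and N_lip: "\<And>c u v \<eta>. 2 * cmod c \<le> r \<Longrightarrow> \<eta> \<le> 1 \<Longrightarrow>
       norm (u - single 0 c) \<le> \<eta> * cmod c \<Longrightarrow> norm (v - single 0 c) \<le> \<eta> * cmod c \<Longrightarrow>
       norm (N u - N v - mul (single 0 (of_nat (n + 2) * f 0 * c ^ (n + 1))) (u - v))
         \<le> K * (\<eta> + cmod c) * cmod c ^ (n + 1) * norm (u - v)"
    and N_cst: "\<And>c. 2 * cmod c \<le> r \<Longrightarrow> norm (N (single 0 c) - single 0 (f 0 * c ^ (n + 2))) \<le> K * cmod c ^ (n + 3)"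
    and z_deriv: "\<And>t. (z has_vector_derivative \<i> * f 0 * z t ^ (n + 2)) (at t)"
    and z_nonzero: "\<And>t. z t \<noteq> 0" and z_max: "\<And>t. cmod (z t) \<le> cmod (z 0)"
    and z_growth: "\<And>t. \<bar>t\<bar> * cmod (z t) ^ (n + 1) \<le> 1 / cmod (f 0)"
    and z_lim: "(z \<longlongrightarrow> 0) at_infinity"
    and \<eta>: "0 < \<eta>" "\<eta> \<le> 1" and z_small: "2 * cmod (z 0) \<le> r"
    and small: "K * cmod (z 0) / cmod (f 0) \<le> \<eta> / 8" "K * (\<eta> + cmod (z 0)) / cmod (f 0) \<le> 1 / 8"
begin

text \<open>
  The scale of the amplitude \<open>y\<close>: a perturbation of relative size \<open>\<eta>\<close> of \<open>z\<close> has amplitude \<open>\<eta> \<rho>\<close>.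
\<close>

definition \<rho> :: "real \<Rightarrow> real" where
  "\<rho> t = 1 / cmod (z t) ^ (n + 1)"

text \<open>
  The change of variables between the state \<open>u\<close> and its amplitude \<open>y\<close>, and its inverse. The factor
  \<open>z\<^sup>p\<close> solves the linearised equation for constants, and \<open>flow\<close> solves the free equation.
\<close>

definition profile :: "real \<Rightarrow> (int ^ 'd) l1 \<Rightarrow> (int ^ 'd) l1" where
  "profile t y = cst (z t) + mul (cst (z t ^ (n + 2))) (flow t y)"

definition amplitude :: "real \<Rightarrow> (int ^ 'd) l1 \<Rightarrow> (int ^ 'd) l1" where
  "amplitude t a = flow (- t) (mul (cst (1 / z t ^ (n + 2))) (a - cst (z t)))"

definition remainder :: "real \<Rightarrow> (int ^ 'd) l1 \<Rightarrow> (int ^ 'd) l1" where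
  "remainder t a = N a - cst (f 0 * z t ^ (n + 2))
     - mul (cst (of_nat (n + 2) * f 0 * z t ^ (n + 1))) (a - cst (z t))"

text \<open>
  The right-hand side of the equation for the amplitude; only the part of the nonlinearity beyond its
  linearisation along \<open>z\<close> is left.
\<close>

definition field :: "real \<Rightarrow> (int ^ 'd) l1 \<Rightarrow> (int ^ 'd) l1" where
  "field t y = flow (- t) (mul (cst (\<i> / z t ^ (n + 2))) (remainder t (profile t y)))"

lemma norm_z_pos: "cmod (z t) > 0"
  using z_nonzero by simp

lemma \<rho>_pos: "\<rho> t > 0"
  using z_nonzero by (simp add: \<rho>_def)

lemma norm_i_div_z: "cmod (\<i> / z t ^ (n + 2)) = 1 / cmod (z t) ^ (n + 2)"
  by (simp only: norm_divide norm_power norm_ii)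

lemma norm_z_\<rho>: "cmod (z t) ^ (n + 2) * \<rho> t = cmod (z t)"
  using z_nonzero[of t] by (simp add: \<rho>_def)

lemma coeff_amplitude:
  "coeff (amplitude t a) k = phase (- t) k * (1 / z t ^ (n + 2)) * (coeff a k - (if k = 0 then z t else 0))"
  by (simp add: amplitude_def coeff_flow coeff_cst_mul)

lemma coeff_profile:
  "coeff (profile t y) k = (if k = 0 then z t else 0) + z t ^ (n + 2) * phase t k * coeff y k"
  by (simp add: profile_def coeff_flow coeff_cst_mul)

lemma profile_amplitude [simp]: "profile t (amplitude t a) = a"
proof (rule l1_eqI)
  fix k
  have "z t ^ (n + 2) * phase t k * (phase (- t) k * (1 / z t ^ (n + 2)) * b) = b" for b
    using phase_minus[of t k] z_nonzero[of t] by (simp add: mult_ac)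
  then show "coeff (profile t (amplitude t a)) k = coeff a k"
    by (simp only: coeff_profile coeff_amplitude) simp
qed

lemma amplitude_profile [simp]: "amplitude t (profile t y) = y"
proof (rule l1_eqI)
  fix k
  have "phase (- t) k * (1 / z t ^ (n + 2)) * (z t ^ (n + 2) * phase t k * b) = b" for b
    using phase_minus[of t k] z_nonzero[of t] by (simp add: mult_ac)
  then show "coeff (amplitude t (profile t y)) k = coeff y k"
    by (simp only: coeff_profile coeff_amplitude) simp
qed

lemma norm_cst_mul_le: "norm (mul (cst c) a) \<le> cmod c * norm a"
  using norm_mul[of "cst c" a] by simp

lemma profile_near:
  assumes "norm y \<le> \<eta> * \<rho> t"
  shows "norm (profile t y - cst (z t)) \<le> \<eta> * cmod (z t)"
proof -
  have "norm (profile t y - cst (z t)) \<le> cmod (z t ^ (n + 2)) * norm (flow t y)"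
    unfolding profile_def using norm_cst_mul_le by simp
  also have "\<dots> \<le> cmod (z t) ^ (n + 2) * (\<eta> * \<rho> t)"
    unfolding norm_power by (intro mult_left_mono order.trans[OF norm_flow_le assms]) auto
  also have "\<dots> = \<eta> * (cmod (z t) ^ (n + 2) * \<rho> t)" by (simp only: mult_ac)
  also have "\<dots> = \<eta> * cmod (z t)" by (simp only: norm_z_\<rho>)
  finally show ?thesis .
qed

lemma norm_profile:
  assumes "norm y \<le> \<eta> * \<rho> t"
  shows "norm (profile t y) \<le> 2 * cmod (z t)" "norm (profile t y) \<le> r"
proof -
  have "norm (profile t y) \<le> norm (profile t y - cst (z t)) + norm (cst (z t))"
    using norm_triangle_ineq[of "profile t y - cst (z t)" "cst (z t)"] by simp
  also have "\<dots> \<le> \<eta> * cmod (z t) + cmod (z t)"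
    using profile_near[OF assms] by simp
  also have "\<dots> \<le> 2 * cmod (z t)"
    using mult_right_mono[OF \<eta>(2) norm_ge_zero[of "z t"]] by simp
  finally show "norm (profile t y) \<le> 2 * cmod (z t)" .
  then show "norm (profile t y) \<le> r" using z_max[of t] z_small by linarith
qed

lemma z_small_t: "2 * cmod (z t) \<le> r"
  using z_max[of t] z_small by linarith

lemma field_lipschitz:
  assumes y: "norm y \<le> \<eta> * \<rho> t" and y': "norm y' \<le> \<eta> * \<rho> t"
  shows "norm (field t y - field t y') \<le> K * (\<eta> + cmod (z 0)) / \<rho> t * norm (y - y')"
proof -
  let ?a = "profile t y" and ?b = "profile t y'" and ?\<sigma> = "cmod (z t)"
  have diff: "?a - ?b = mul (cst (z t ^ (n + 2))) (flow t (y - y'))"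
    by (simp add: profile_def flow_diff mul.diff_right)
  have "remainder t ?a - remainder t ?b
      = N ?a - N ?b - mul (cst (of_nat (n + 2) * f 0 * z t ^ (n + 1))) (?a - ?b)"
    by (simp add: remainder_def mul.diff_right)
  then have "norm (remainder t ?a - remainder t ?b) \<le> K * (\<eta> + ?\<sigma>) * ?\<sigma> ^ (n + 1) * norm (?a - ?b)"
    using N_lip[OF z_small_t \<eta>(2) profile_near[OF y] profile_near[OF y']] by simp
  also have "\<dots> \<le> K * (\<eta> + cmod (z 0)) * ?\<sigma> ^ (n + 1) * (?\<sigma> ^ (n + 2) * norm (y - y'))"
  proof (intro mult_mono mult_nonneg_nonneg)
    show "norm (?a - ?b) \<le> ?\<sigma> ^ (n + 2) * norm (y - y')"
      unfolding diff norm_power[symmetric]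
      by (rule order.trans[OF norm_cst_mul_le]) (intro mult_left_mono norm_flow_le norm_ge_zero)
  qed (use K \<eta> z_max in auto)
  finally have rem: "norm (remainder t ?a - remainder t ?b) \<le> K * (\<eta> + cmod (z 0)) * ?\<sigma> ^ (n + 1) * (?\<sigma> ^ (n + 2) * norm (y - y'))" .
  have "field t y - field t y' = flow (- t) (mul (cst (\<i> / z t ^ (n + 2))) (remainder t ?a - remainder t ?b))"
    by (simp add: field_def flow_diff mul.diff_right)
  also have "norm \<dots> \<le> cmod (\<i> / z t ^ (n + 2)) * norm (remainder t ?a - remainder t ?b)"
    by (rule order.trans[OF norm_flow_le norm_cst_mul_le])
  also have "\<dots> \<le> cmod (\<i> / z t ^ (n + 2)) * (K * (\<eta> + cmod (z 0)) * ?\<sigma> ^ (n + 1) * (?\<sigma> ^ (n + 2) * norm (y - y')))"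
    by (intro mult_left_mono rem) auto
  also have "\<dots> = K * (\<eta> + cmod (z 0)) / \<rho> t * norm (y - y')"
    unfolding norm_i_div_z using z_nonzero[of t] by (simp add: \<rho>_def)
  finally show ?thesis .
qed

lemma norm_field_0: "norm (field t 0) \<le> K * cmod (z 0)"
proof -
  have "remainder t (cst (z t)) = N (cst (z t)) - cst (f 0 * z t ^ (n + 2))"
    by (simp add: remainder_def mul.zero_right)
  then have "norm (remainder t (profile t 0)) \<le> K * cmod (z t) ^ (n + 3)"
    using N_cst[OF z_small_t, of t] by (simp add: profile_def mul.zero_right)
  then have "cmod (\<i> / z t ^ (n + 2)) * norm (remainder t (profile t 0)) \<le> cmod (\<i> / z t ^ (n + 2)) * (K * cmod (z t) ^ (n + 3))"
    by (intro mult_left_mono) auto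
  also have "\<dots> = K * cmod (z t)"
    unfolding norm_i_div_z using z_nonzero[of t] by (simp add: numeral_3_eq_3)
  also have "\<dots> \<le> K * cmod (z 0)" by (intro mult_left_mono z_max K)
  finally show ?thesis
    unfolding field_def using order.trans[OF norm_flow_le norm_cst_mul_le] order.trans by blast
qed

lemma norm_field:
  assumes "norm y \<le> \<eta> * \<rho> t"
  shows "norm (field t y) \<le> K * cmod (z 0) + K * (\<eta> + cmod (z 0)) * \<eta>"
proof -
  have "norm (field t y - field t 0) \<le> K * (\<eta> + cmod (z 0)) / \<rho> t * norm (y - 0)"
    by (rule field_lipschitz[OF assms]) (use \<eta> \<rho>_pos[of t] in simp)
  also have "\<dots> \<le> K * (\<eta> + cmod (z 0)) / \<rho> t * (\<eta> * \<rho> t)"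
    using assms K \<eta> \<rho>_pos[of t] by (intro mult_left_mono) auto
  also have "\<dots> = K * (\<eta> + cmod (z 0)) * \<eta>" using \<rho>_pos[of t] by simp
  finally show ?thesis
    using norm_field_0[of t] norm_triangle_ineq[of "field t 0" "field t y - field t 0"] by simp
qed

lemma continuous_on_z: "continuous_on S z"
  using z_deriv by (auto intro!: continuous_at_imp_continuous_on has_vector_derivative_continuous)

lemma continuous_on_\<rho>: "continuous_on S \<rho>"
  unfolding \<rho>_def[abs_def] using z_nonzero by (auto intro!: continuous_intros continuous_on_z)

lemma \<rho>_min: "\<rho> 0 \<le> \<rho> t"
  unfolding \<rho>_def using norm_z_pos by (intro divide_left_mono power_mono z_max) auto

lemma \<rho>_growth: "\<bar>t\<bar> \<le> 1 / cmod (f 0) * \<rho> t"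
proof -
  have "\<bar>t\<bar> \<le> 1 / cmod (f 0) / cmod (z t) ^ (n + 1)"
    using z_growth[of t] zero_less_power[OF norm_z_pos] by (simp only: pos_le_divide_eq)
  then show ?thesis by (simp add: \<rho>_def)
qed

lemma continuous_on_flow':
  assumes "continuous_on S g" "continuous_on S h"
  shows "continuous_on S (\<lambda>x. flow (g x) (h x))"
  using continuous_on_compose2[OF continuous_on_flow continuous_on_Pair[OF assms]] by simp

lemma continuous_on_cst: "continuous_on S g \<Longrightarrow> continuous_on S (\<lambda>x. cst (g x))"
  by (rule bounded_linear.continuous_on[OF bounded_linear_single])

lemma continuous_on_field: "continuous_on {(t, y). norm y \<le> \<eta> * \<rho> t} (\<lambda>(t, y). field t y)"
proof -
  define T where "T = {(t, y :: (int ^ 'd) l1). norm y \<le> \<eta> * \<rho> t}"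
  have z: "continuous_on T (\<lambda>x. z (fst x))"
    by (rule continuous_on_compose2[OF continuous_on_z[of UNIV]]) (auto intro!: continuous_intros)
  have profile: "continuous_on T (\<lambda>x. profile (fst x) (snd x))"
    unfolding profile_def
    by (intro continuous_on_add continuous_on_cst mul.continuous_on continuous_on_flow' continuous_on_power z
        continuous_on_fst continuous_on_snd continuous_on_id)
  have N: "continuous_on T (\<lambda>x. N (profile (fst x) (snd x)))"
    by (rule continuous_on_compose2[OF N_cont profile]) (auto simp: T_def intro: norm_profile)
  show ?thesis
    unfolding T_def[symmetric] unfolding case_prod_unfold field_def remainder_def
    using z_nonzero
    by (intro continuous_on_flow' mul.continuous_on continuous_on_cst continuous_on_diff N profile z
        continuous_on_divide continuous_on_power continuous_on_mult continuous_on_const continuous_on_minus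
        continuous_on_fst continuous_on_id) auto
qed

lemma phase_deriv: "((\<lambda>t. phase t k) has_vector_derivative - \<i> * of_real (dispersion k) * phase t k) (at t)"
proof -
  have "((\<lambda>s. exp (- (\<i> * of_real (dispersion k) * s))) has_field_derivative
      - \<i> * of_real (dispersion k) * exp (- (\<i> * of_real (dispersion k) * of_real t))) (at (complex_of_real t))"
    by (auto intro!: derivative_eq_intros)
  from has_vector_derivative_real_field[OF this] show ?thesis
    by (simp add: phase_def mult.assoc)
qed

lemma phase_minus_deriv:
  "((\<lambda>t. phase (- t) k) has_vector_derivative \<i> * of_real (dispersion k) * phase (- t) k) (at t)"
proof -
  have "((\<lambda>s. exp (\<i> * of_real (dispersion k) * s)) has_field_derivative
      \<i> * of_real (dispersion k) * exp (\<i> * of_real (dispersion k) * of_real t)) (at (complex_of_real t))"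
    by (auto intro!: derivative_eq_intros)
  from has_vector_derivative_real_field[OF this] show ?thesis
    by (simp add: phase_def mult.assoc)
qed

lemma z_power_deriv:
  "((\<lambda>t. z t ^ (n + 2)) has_vector_derivative
     of_nat (n + 2) * \<i> * f 0 * z t ^ (n + 1) * z t ^ (n + 2)) (at t)"
proof -
  have "((\<lambda>x. x ^ (n + 2)) has_field_derivative of_nat (n + 2) * z t ^ (n + 1)) (at (z t))"
    by (rule DERIV_power[OF DERIV_ident, THEN DERIV_cong]) simp
  from field_vector_diff_chain_at[OF z_deriv this] show ?thesis
    by (simp add: o_def mult_ac)
qed

lemma inverse_z_power_deriv:
  "((\<lambda>t. 1 / z t ^ (n + 2)) has_vector_derivative
     - of_nat (n + 2) * \<i> * f 0 * z t ^ (n + 1) * (1 / z t ^ (n + 2))) (at t)"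
proof -
  have nz: "z t ^ (n + 2) \<noteq> 0" using z_nonzero by simp
  have "m * \<i> * f\<^sub>0 * P * Z * - (inverse Z ^ Suc (Suc 0)) = - m * \<i> * f\<^sub>0 * P * (1 / Z)" if "Z \<noteq> 0"
    for m f\<^sub>0 P Z :: complex
    using that by (simp add: field_simps)
  note eq = this[OF nz]
  show ?thesis
    using has_vector_derivative_eq_rhs[OF field_vector_diff_chain_at[OF z_power_deriv DERIV_inverse[OF nz]] eq]
    unfolding o_def inverse_eq_divide .
qed

definition rhs :: "(int ^ 'd) l1 \<Rightarrow> int ^ 'd \<Rightarrow> complex" where
  "rhs a k = - \<i> * of_real (dispersion k) * coeff a k + \<i> * coeff (N a) k"

lemma coeff_field:
  "coeff (field t y) k = phase (- t) k * (\<i> / z t ^ (n + 2)) * (coeff (N (profile t y)) k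
     - (if k = 0 then f 0 * z t ^ (n + 2) else 0)
     - of_nat (n + 2) * f 0 * z t ^ (n + 1) * (coeff (profile t y) k - (if k = 0 then z t else 0)))"
  by (simp only: field_def coeff_flow coeff_cst_mul remainder_def coeff_simps coeff_single mult.assoc)

text \<open>
  The next two lemmas translate the equation for the coefficients of \<open>u\<close> into that for \<open>y\<close> and back. They
  are stated at one time and for one coefficient: a solution in the Wiener algebra is differentiable
  coefficientwise only, and \<open>N\<close> represents its nonlinear term only while it is in the tube. The number \<open>d\<close> in
  the proofs is the coefficient of the constant function \<open>1\<close>; it vanishes wherever the dispersion does not.
\<close>

lemma amplitude_deriv:
  assumes "((\<lambda>s. coeff (a s) k) has_vector_derivative rhs (a t) k) (at t)"
  shows "((\<lambda>s. coeff (amplitude s (a s)) k) has_vector_derivative coeff (field t (amplitude t (a t))) k) (at t)"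
proof -
  define d where "d = (if k = 0 then 1 else 0 :: complex)"
  have d: "of_real (dispersion k) * d = 0" by (simp add: d_def)
  have "((\<lambda>s. coeff (a s) k - d * z s) has_vector_derivative rhs (a t) k - d * (\<i> * f 0 * z t ^ (n + 2))) (at t)"
    by (intro has_vector_derivative_diff assms has_vector_derivative_mult_right z_deriv)
  note D = has_vector_derivative_mult3[OF phase_minus_deriv inverse_z_power_deriv this]
  have ring: "\<i> * l * e * q * (a - d * z) + e * (- m * \<i> * f\<^sub>0 * P * q) * (a - d * z)
      + e * q * (- \<i> * l * a + \<i> * N' - d * (\<i> * f\<^sub>0 * Z))
    = e * (\<i> * q) * (N' - d * (f\<^sub>0 * Z) - m * f\<^sub>0 * P * (a - d * z))"
    if "l * d = 0" for l e q a z m f\<^sub>0 P N' Z :: complex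
  proof -
    have "\<i> * l * e * q * (a - d * z) = \<i> * l * e * q * a - \<i> * e * q * z * (l * d)" by (simp add: algebra_simps)
    then show ?thesis unfolding that by (simp add: algebra_simps)
  qed
  have eqfun: "(\<lambda>s. coeff (amplitude s (a s)) k) = (\<lambda>s. phase (- s) k * (1 / z s ^ (n + 2)) * (coeff (a s) k - d * z s))"
    by (simp add: fun_eq_iff coeff_amplitude d_def)
  have val: "coeff (field t (amplitude t (a t))) k = phase (- t) k * (\<i> * (1 / z t ^ (n + 2)))
     * (coeff (N (a t)) k - d * (f 0 * z t ^ (n + 2))
        - of_nat (n + 2) * f 0 * z t ^ (n + 1) * (coeff (a t) k - d * z t))"
    by (simp add: coeff_field d_def)
  show ?thesis
    unfolding eqfun val by (rule has_vector_derivative_eq_rhs[OF D[unfolded rhs_def] ring[OF d]])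
qed

lemma profile_deriv:
  assumes "((\<lambda>s. coeff (y s) k) has_vector_derivative coeff (field t (y t)) k) (at t)"
  shows "((\<lambda>s. coeff (profile s (y s)) k) has_vector_derivative rhs (profile t (y t)) k) (at t)"
proof -
  define d where "d = (if k = 0 then 1 else 0 :: complex)"
  have d: "of_real (dispersion k) * d = 0" by (simp add: d_def)
  note D = has_vector_derivative_add[OF has_vector_derivative_mult_right[OF z_deriv, of d]
      has_vector_derivative_mult3[OF z_power_deriv phase_deriv assms]]
  have eqfun: "(\<lambda>s. coeff (profile s (y s)) k) = (\<lambda>s. d * z s + z s ^ (n + 2) * phase s k * coeff (y s) k)"
    by (simp add: fun_eq_iff coeff_profile d_def)
  have a: "coeff (profile t (y t)) k = d * z t + z t ^ (n + 2) * phase t k * coeff (y t) k"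
    by (simp add: coeff_profile d_def)
  have ring: "d * (\<i> * f\<^sub>0 * Z) + ((m * \<i> * f\<^sub>0 * P * Z) * e * y + Z * (- \<i> * l * e) * y
      + Z * e * (e' * (\<i> / Z) * (N' - d * (f\<^sub>0 * Z) - m * f\<^sub>0 * P * (d * z + Z * e * y - d * z))))
    = - \<i> * l * (d * z + Z * e * y) + \<i> * N'"
    if "l * d = 0" "e * e' = 1" "Z \<noteq> 0" for l e e' y z m f\<^sub>0 P N' Z :: complex
  proof -
    have A: "Z * e * (e' * (\<i> / Z) * X) = \<i> * X" for X
    proof -
      have "Z * e * (e' * (\<i> / Z) * X) = (e * e') * (\<i> * X)" using that(3) by simp
      then show ?thesis by (simp only: that(2) mult_1_left)
    qed
    have "- \<i> * l * (d * z + Z * e * y) = - \<i> * z * (l * d) - \<i> * l * Z * e * y" by (simp add: algebra_simps)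
    then have B: "- \<i> * l * (d * z + Z * e * y) = - \<i> * l * Z * e * y" by (simp only: that(1)) simp
    show ?thesis unfolding A B by (simp add: algebra_simps)
  qed
  have f: "coeff (field t (y t)) k = phase (- t) k * (\<i> / z t ^ (n + 2)) * (coeff (N (profile t (y t))) k
     - d * (f 0 * z t ^ (n + 2))
     - of_nat (n + 2) * f 0 * z t ^ (n + 1) * (d * z t + z t ^ (n + 2) * phase t k * coeff (y t) k - d * z t))"
    unfolding coeff_field a by (simp add: d_def)
  have nz: "z t ^ (n + 2) \<noteq> 0" using z_nonzero by simp
  show ?thesis
    unfolding eqfun rhs_def a
    by (rule has_vector_derivative_eq_rhs[OF D[unfolded f] ring[OF d phase_minus(2) nz]])
qed

text \<open>
  The ball of radius \<open>\<eta> \<bar>z(0)\<bar> / 2\<close> around the constant \<open>z(0)\<close>: the amplitude at time \<open>0\<close> is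
  \<open>u - z(0)\<close> divided by \<open>z(0)\<^sup>p\<close>.
\<close>

definition data_ball :: "(real ^ 'd \<Rightarrow> complex) set" where
  "data_ball = {u \<in> wiener_algebra \<omega> \<nu>. norm (amplitude 0 (coeffs u)) < \<eta> / 2 * \<rho> 0}"

lemma amplitude_diff: "amplitude t a - amplitude t b = flow (- t) (mul (cst (1 / z t ^ (n + 2))) (a - b))"
  by (simp add: amplitude_def mul.diff_right flip: flow_diff)

lemma norm_amplitude_diff: "norm (amplitude t a - amplitude t b) \<le> norm (a - b) / cmod (z t) ^ (n + 2)"
proof -
  have "norm (amplitude t a - amplitude t b) \<le> cmod (1 / z t ^ (n + 2)) * norm (a - b)"
    unfolding amplitude_diff by (rule order.trans[OF norm_flow_le norm_cst_mul_le])
  then show ?thesis by (simp only: norm_divide norm_power norm_one mult_1_left times_divide_eq_left)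
qed

lemma wiener_open_data_ball: "wiener_open \<omega> \<nu> data_ball"
  unfolding wiener_open_def
proof (intro conjI ballI)
  show "data_ball \<subseteq> wiener_algebra \<omega> \<nu>" by (auto simp: data_ball_def)
  fix u assume u: "u \<in> data_ball"
  define gap where "gap = \<eta> / 2 * \<rho> 0 - norm (amplitude 0 (coeffs u))"
  have gap: "gap > 0" using u by (simp add: gap_def data_ball_def)
  show "\<exists>\<epsilon>>0. \<forall>v\<in>wiener_algebra \<omega> \<nu>. wiener_dist \<omega> \<nu> v u < \<epsilon> \<longrightarrow> v \<in> data_ball"
  proof (intro exI conjI ballI impI)
    show "gap * cmod (z 0) ^ (n + 2) > 0" using gap norm_z_pos by simp
    fix v assume v: "v \<in> wiener_algebra \<omega> \<nu>" "wiener_dist \<omega> \<nu> v u < gap * cmod (z 0) ^ (n + 2)"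
    have "norm (coeffs v - coeffs u) / cmod (z 0) ^ (n + 2) < gap"
      using v u wiener_dist_eq[of v u] zero_less_power[OF norm_z_pos]
      by (simp only: pos_divide_less_eq) (simp add: data_ball_def)
    then have "norm (amplitude 0 (coeffs v) - amplitude 0 (coeffs u)) < gap"
      using norm_amplitude_diff by (rule le_less_trans[rotated])
    then have "norm (amplitude 0 (coeffs v)) < \<eta> / 2 * \<rho> 0"
      using norm_triangle_ineq[of "amplitude 0 (coeffs v) - amplitude 0 (coeffs u)" "amplitude 0 (coeffs u)"]
      by (simp add: gap_def)
    then show "v \<in> data_ball" using v by (simp add: data_ball_def)
  qed
qed

lemma data_ball_nonempty: "data_ball \<noteq> {}"
proof -
  have "(\<lambda>x. ev x (cst (z 0))) \<in> data_ball"
    using \<eta> \<rho>_pos[of 0] ev_in_wiener_algebra by (simp add: data_ball_def amplitude_def mul.zero_right)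
  then show ?thesis by blast
qed

abbreviation \<kappa> :: real where "\<kappa> \<equiv> K * (\<eta> + cmod (z 0))"

lemma drift_small: "1 / cmod (f 0) * (K * cmod (z 0) + \<kappa> * \<eta>) \<le> \<eta> / 4"
proof -
  have "1 / cmod (f 0) * (K * cmod (z 0) + \<kappa> * \<eta>) = K * cmod (z 0) / cmod (f 0) + \<kappa> / cmod (f 0) * \<eta>"
    using f0 by (simp add: field_simps)
  also have "\<dots> \<le> \<eta> / 8 + 1 / 8 * \<eta>"
    using \<eta> by (intro add_mono mult_right_mono small) auto
  finally show ?thesis by simp
qed

text \<open>
  As long as the tube has not been left, \<open>y\<close> moves by at most \<open>\<eta> \<rho> / 4\<close> from an initial value below
  \<open>\<eta> \<rho> / 2\<close>, so it cannot reach the boundary. This controls all solutions at once and replaces a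
  uniqueness theorem.
\<close>

lemma solution_stays_in_tube:
  assumes sol: "nls_solution \<omega> \<nu> (n + 2) f u" and init: "u 0 \<in> data_ball"
  shows "norm (amplitude t (coeffs (u t))) < \<eta> * \<rho> t"
proof -
  define a where "a t = coeffs (u t)" for t
  define y where "y t = amplitude t (a t)" for t
  have W: "u t \<in> wiener_algebra \<omega> \<nu>" for t using sol by (simp add: nls_solution_def)
  have cont_a: "continuous_on UNIV a"
    unfolding continuous_on_def
  proof clarify
    fix t
    have "((\<lambda>s. norm (a s - a t)) \<longlongrightarrow> 0) (at t)"
      using sol by (simp add: nls_solution_def a_def wiener_dist_eq W)
    then show "(a \<longlongrightarrow> a t) (at t)"
      by (simp add: tendsto_norm_zero_iff LIM_zero_iff)
  qed
  have cont_y: "continuous_on UNIV y"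
    unfolding y_def amplitude_def using z_nonzero
    by (intro continuous_on_flow' mul.continuous_on continuous_on_cst continuous_on_diff cont_a continuous_on_z
        continuous_on_divide continuous_on_power continuous_on_const continuous_on_minus continuous_on_id) auto
  have deriv: "((\<lambda>s. coeff (y s) k) has_vector_derivative coeff (field t (y t)) k) (at t)"
    if t: "norm (y t) \<le> \<eta> * \<rho> t" for t k
  proof -
    have "norm (coeffs (u t)) \<le> r"
      using norm_profile(2)[OF t] by (simp add: y_def a_def)
    from nls_coeff_iff[where u = u and r = r, OF N_ev W this, of k] sol
    have "((\<lambda>s. coeff (a s) k) has_vector_derivative rhs (a t) k) (at t)"
      unfolding nls_solution_def a_def rhs_def by blast
    then show ?thesis unfolding y_def by (rule amplitude_deriv)
  qed
  have y0: "norm (y 0) < \<eta> / 2 * \<rho> 0"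
    using init by (simp add: y_def a_def data_ball_def)
  have "norm (y t) < \<eta> * \<rho> t"
  proof (rule continuity_bootstrap[where \<phi> = "\<lambda>t. norm (y t)" and \<psi> = "\<lambda>t. \<eta> * \<rho> t"])
    show "continuous_on UNIV (\<lambda>t. norm (y t))" "continuous_on UNIV (\<lambda>t. \<eta> * \<rho> t)"
      by (intro continuous_intros cont_y continuous_on_\<rho>)+
    show "norm (y 0) < \<eta> * \<rho> 0"
      using y0 mult_pos_pos[OF \<eta>(1) \<rho>_pos[of 0]] by simp
    fix t assume tube: "\<And>s. s \<in> closed_segment 0 t \<Longrightarrow> norm (y s) \<le> \<eta> * \<rho> s"
    have "norm (y t - y 0) \<le> (K * cmod (z 0) + \<kappa> * \<eta>) * \<bar>t\<bar>"
      by (rule l1_mean_value_inequality[where g = "\<lambda>s. field s (y s)"])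
         (use deriv tube norm_field in auto)
    also have "\<dots> \<le> (K * cmod (z 0) + \<kappa> * \<eta>) * (1 / cmod (f 0) * \<rho> t)"
      using K \<eta> by (intro mult_left_mono \<rho>_growth) auto
    also have "\<dots> = 1 / cmod (f 0) * (K * cmod (z 0) + \<kappa> * \<eta>) * \<rho> t" by simp
    also have "\<dots> \<le> \<eta> / 4 * \<rho> t"
      using \<rho>_pos[of t] by (intro mult_right_mono drift_small) auto
    also have "\<dots> \<le> \<eta> / 2 * \<rho> t" using \<eta> \<rho>_pos[of t] by simp
    finally have "norm (y t - y 0) \<le> \<eta> / 2 * \<rho> t" .
    moreover have "\<eta> / 2 * \<rho> 0 \<le> \<eta> / 2 * \<rho> t"
      using \<eta> by (intro mult_left_mono \<rho>_min) auto
    moreover have "norm (y t) \<le> norm (y t - y 0) + norm (y 0)"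
      using norm_triangle_ineq[of "y t - y 0" "y 0"] by simp
    ultimately show "norm (y t) < \<eta> * \<rho> t" using y0 by (simp add: field_simps)
  qed
  then show ?thesis by (simp add: y_def a_def)
qed

text \<open>
  The curve is redefined at time \<open>0\<close> because a solution has to start at the given function, which may
  differ from the sum of its Fourier series on a null set.
\<close>

lemma solution_exists:
  assumes init: "u\<^sub>0 \<in> data_ball"
  obtains u where "nls_solution \<omega> \<nu> (n + 2) f u" "u 0 = u\<^sub>0"
proof -
  have W0: "u\<^sub>0 \<in> wiener_algebra \<omega> \<nu>" using init by (simp add: data_ball_def)
  obtain y where y0: "y 0 = amplitude 0 (coeffs u\<^sub>0)" and tube: "\<And>t. norm (y t) \<le> \<eta> * \<rho> t"
    and y: "\<And>t. (y has_vector_derivative field t (y t)) (at t)"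
  proof (rule ode_global_solution_in_tube[of \<eta> \<rho> field "1 / cmod (f 0)" \<kappa> "K * cmod (z 0)" "amplitude 0 (coeffs u\<^sub>0)"])
    show "continuous_on {(t, y). norm y \<le> \<eta> * \<rho> t} (\<lambda>(t, y). field t y)" by (rule continuous_on_field)
    show "1 / cmod (f 0) * (K * cmod (z 0) + \<kappa> * \<eta>) \<le> \<eta> / 2" using drift_small \<eta> by linarith
    have "1 / cmod (f 0) * \<kappa> = \<kappa> / cmod (f 0)" by simp
    with small(2) show "1 / cmod (f 0) * \<kappa> \<le> 1 / 2" by linarith
    show "norm (amplitude 0 (coeffs u\<^sub>0)) \<le> \<eta> / 2 * \<rho> 0" using init by (simp add: data_ball_def)
    show "\<bar>t\<bar> \<le> 1 / cmod (f 0) * \<rho> t" for t by (rule \<rho>_growth)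
    show "norm (field t y - field t y') \<le> \<kappa> / \<rho> t * norm (y - y')"
      if "norm y \<le> \<eta> * \<rho> t" "norm y' \<le> \<eta> * \<rho> t" for t y y'
      by (rule field_lipschitz[OF that])
  qed (use K \<eta> in \<open>auto intro: continuous_on_\<rho> \<rho>_pos \<rho>_min norm_field_0\<close>)
  define a where "a t = profile t (y t)" for t
  define u where "u t = (if t = 0 then u\<^sub>0 else (\<lambda>x. ev x (a t)))" for t
  have W: "u t \<in> wiener_algebra \<omega> \<nu>" for t by (simp add: u_def W0 ev_in_wiener_algebra)
  have coeffs_u: "coeffs (u t) = a t" for t by (simp add: u_def a_def y0)
  have cont_y: "continuous_on UNIV y"
    using y by (auto intro!: continuous_at_imp_continuous_on has_vector_derivative_continuous)
  have cont_a: "continuous_on UNIV a"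
    unfolding a_def profile_def
    by (intro continuous_on_add continuous_on_flow' mul.continuous_on continuous_on_cst cont_y continuous_on_z
        continuous_on_power continuous_on_id)
  have "nls_solution \<omega> \<nu> (n + 2) f u"
    unfolding nls_solution_def
  proof (intro conjI allI)
    show "u t \<in> wiener_algebra \<omega> \<nu>" for t by (rule W)
    fix t
    have "(a \<longlongrightarrow> a t) (at t)" using cont_a by (simp add: continuous_on_def)
    then show "((\<lambda>s. wiener_dist \<omega> \<nu> (u s) (u t)) \<longlongrightarrow> 0) (at t)"
      by (simp add: wiener_dist_eq W coeffs_u tendsto_norm_zero_iff LIM_zero_iff)
    fix k
    have "((\<lambda>s. coeff (y s) k) has_vector_derivative coeff (field t (y t)) k) (at t)"
      by (rule bounded_linear.has_vector_derivative[OF bounded_linear_coeff y])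
    then have "((\<lambda>s. coeff (a s) k) has_vector_derivative rhs (a t) k) (at t)"
      unfolding a_def by (rule profile_deriv)
    moreover have "norm (coeffs (u t)) \<le> r"
      unfolding coeffs_u a_def by (rule norm_profile[OF tube])
    ultimately show "((\<lambda>s. - \<i> * fourier_coeff \<omega> (u s) k) has_vector_derivative
               (- complex_of_real (\<Sum>j\<in>UNIV. (real_of_int (k $ j) * \<omega> $ j)\<^sup>2)
                  * fourier_coeff \<omega> (u t) k
                + fourier_coeff \<omega> (\<lambda>x. u t x ^ (n + 2) * f (u t x)) k)) (at t)"
      using nls_coeff_iff[where u = u and r = r, OF N_ev W, of t k] by (simp only: coeffs_u rhs_def)
  qed
  moreover have "u 0 = u\<^sub>0" by (simp add: u_def)
  ultimately show ?thesis by (rule that)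
qed

lemma zero_in_wiener_algebra: "(\<lambda>x. 0) \<in> wiener_algebra \<omega> \<nu>" "coeffs (\<lambda>x. 0) = 0"
  using ev_in_wiener_algebra[of 0] coeffs_ev[of 0] by (simp_all add: ev.zero)

lemma zero_equilibrium: "nls_equilibrium \<omega> \<nu> (n + 2) f (\<lambda>x. 0)"
proof -
  have "fourier_coeff \<omega> (\<lambda>x. 0) k = 0" for k by (simp add: fourier_coeff_eq)
  then show ?thesis
    unfolding nls_equilibrium_def nls_solution_def
    by (simp add: zero_in_wiener_algebra wiener_dist_eq)
qed

theorem solutions_homoclinic:
  assumes sol: "nls_solution \<omega> \<nu> (n + 2) f u" and init: "u 0 \<in> data_ball"
  shows "homoclinic_orbit \<omega> \<nu> (n + 2) f u (\<lambda>x. 0)"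
proof -
  have W: "u t \<in> wiener_algebra \<omega> \<nu>" for t using sol by (simp add: nls_solution_def)
  have bound: "wiener_dist \<omega> \<nu> (u t) (\<lambda>x. 0) \<le> 2 * cmod (z t)" for t
    using norm_profile(1)[OF less_imp_le[OF solution_stays_in_tube[OF sol init, of t]]]
    by (simp add: wiener_dist_eq W zero_in_wiener_algebra)
  have lim: "((\<lambda>t. 2 * cmod (z t)) \<longlongrightarrow> 0) at_infinity"
    by (rule tendsto_eq_intros tendsto_norm_zero z_lim refl | simp)+
  have "((\<lambda>t. wiener_dist \<omega> \<nu> (u t) (\<lambda>x. 0)) \<longlongrightarrow> 0) at_infinity"
  proof (rule tendsto_sandwich[OF _ _ tendsto_const lim])
    show "\<forall>\<^sub>F t in at_infinity. 0 \<le> wiener_dist \<omega> \<nu> (u t) (\<lambda>x. 0)"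
      by (simp add: wiener_dist_eq W zero_in_wiener_algebra)
    show "\<forall>\<^sub>F t in at_infinity. wiener_dist \<omega> \<nu> (u t) (\<lambda>x. 0) \<le> 2 * cmod (z t)"
      by (simp add: bound)
  qed
  then show ?thesis
    unfolding homoclinic_orbit_def
    using sol zero_equilibrium tendsto_mono[OF at_top_le_at_infinity] tendsto_mono[OF at_bot_le_at_infinity]
    by blast
qed

end

text \<open>
  First \<open>\<eta>\<close> is chosen against the constant of the nonlinearity, then the size \<open>\<delta>\<close> of the reference orbit
  against \<open>\<eta>\<close>: the forcing of size \<open>\<bar>z(0)\<bar>\<close> has to be small compared with the width of the tube.
\<close>

lemma homoclinic_tube_exists:
  fixes \<omega> :: "real ^ 'd"
  assumes \<omega>: "\<forall>j. \<omega> $ j \<noteq> 0" and \<nu>: "\<nu> \<ge> 1" and f: "real_analytic f" "f 0 \<noteq> 0"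
  shows "\<exists>N r K \<eta> z. homoclinic_tube \<omega> \<nu> f n N r K \<eta> z"
proof -
  interpret torus \<omega> \<nu> by standard (fact \<omega> \<nu>)+
  obtain N :: "(int ^ 'd) l1 \<Rightarrow> (int ^ 'd) l1" and r K :: real where N: "r > 0" "K \<ge> 0"
    "\<And>u x. norm u \<le> r \<Longrightarrow> ev x (N u) = ev x u ^ (n + 2) * f (ev x u)"
    "continuous_on (cball 0 r) N"
    "\<And>c u v \<eta>. 2 * cmod c \<le> r \<Longrightarrow> \<eta> \<le> 1 \<Longrightarrow>
       norm (u - cst c) \<le> \<eta> * cmod c \<Longrightarrow> norm (v - cst c) \<le> \<eta> * cmod c \<Longrightarrow>
       norm (N u - N v - mul (cst (of_nat (n + 2) * f 0 * c ^ (n + 1))) (u - v))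
         \<le> K * (\<eta> + cmod c) * cmod c ^ (n + 1) * norm (u - v)"
    "\<And>c. 2 * cmod c \<le> r \<Longrightarrow> norm (N (cst c) - cst (f 0 * c ^ (n + 2))) \<le> K * cmod c ^ (n + 3)"
    by (rule nonlinearity_near_constants[OF f(1), of n]) (rule that)
  define Q where "Q = K / cmod (f 0) + 1"
  have Q: "Q \<ge> 1" "K / cmod (f 0) \<le> Q" using N(2) f(2) by (simp_all add: Q_def)
  define \<eta> where "\<eta> = 1 / (16 * Q)"
  have \<eta>: "0 < \<eta>" "\<eta> \<le> 1" "Q * \<eta> = 1 / 16" "\<eta> \<le> 1 / 16" using Q(1) by (simp_all add: \<eta>_def)
  define \<delta> where "\<delta> = min (r / 2) (\<eta> / (8 * Q))"
  have \<delta>: "\<delta> > 0" "\<delta> \<le> r / 2" "Q * \<delta> \<le> \<eta> / 8"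
  proof -
    show "\<delta> > 0" "\<delta> \<le> r / 2" using N(1) \<eta> Q(1) by (simp_all add: \<delta>_def)
    have "\<delta> \<le> \<eta> / (8 * Q)" by (simp add: \<delta>_def)
    then show "Q * \<delta> \<le> \<eta> / 8" using Q(1) by (simp add: field_simps)
  qed
  obtain z :: "real \<Rightarrow> complex" where z: "\<And>t. (z has_vector_derivative \<i> * f 0 * z t ^ Suc (n + 1)) (at t)"
    "\<And>t. z t \<noteq> 0" "\<And>t. cmod (z t) \<le> cmod (z 0)" "cmod (z 0) \<le> \<delta>"
    "\<And>t. \<bar>t\<bar> * cmod (z t) ^ (n + 1) \<le> 1 / cmod (f 0)" "(z \<longlongrightarrow> 0) at_infinity"
    using reference_orbit[of "n + 1" "f 0" \<delta>] f(2) \<delta>(1) by auto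
  have "K / cmod (f 0) * cmod (z 0) \<le> Q * \<delta>"
    using Q z(4) N(2) by (intro mult_mono) auto
  with \<delta>(3) have s1: "K / cmod (f 0) * cmod (z 0) \<le> \<eta> / 8" by linarith
  have "K / cmod (f 0) * \<eta> \<le> Q * \<eta>"
    using Q(2) \<eta>(1) by (intro mult_right_mono) auto
  then have s2: "K / cmod (f 0) * (\<eta> + cmod (z 0)) \<le> 1 / 8"
    using s1 \<eta>(3,4) unfolding distrib_left by linarith
  have "homoclinic_tube \<omega> \<nu> f n N r K \<eta> z"
  proof (intro homoclinic_tube.intro homoclinic_tube_axioms.intro)
    show "torus \<omega> \<nu>" by (rule torus_axioms)
    show "2 * cmod (z 0) \<le> r" using z(4) \<delta>(2) by linarith
    show "K * cmod (z 0) / cmod (f 0) \<le> \<eta> / 8" using s1 by simp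
    show "K * (\<eta> + cmod (z 0)) / cmod (f 0) \<le> 1 / 8" using s2 by simp
    show "(z has_vector_derivative \<i> * f 0 * z t ^ (n + 2)) (at t)" for t using z(1)[of t] by simp
  qed (fact f N z \<eta>)+
  then show ?thesis by blast
qed

theorem theorem1p5:
  fixes \<omega> :: "real ^ 'd" and \<nu> :: real and p :: nat and f :: "complex \<Rightarrow> complex"
  assumes "\<forall>j. \<omega> $ j \<noteq> 0"
    and "\<nu> \<ge> 1"
    and "p \<ge> 2"
    and "real_analytic f"
    and "f 0 \<noteq> 0"
  shows "\<exists>U. wiener_open \<omega> \<nu> U \<and> U \<noteq> {} \<and>
    (\<forall>u0\<in>U.
       (\<exists>u. nls_solution \<omega> \<nu> p f u \<and> u 0 = u0) \<and>
       (\<forall>u. nls_solution \<omega> \<nu> p f u \<and> u 0 = u0 \<longrightarrow>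
            homoclinic_orbit \<omega> \<nu> p f u (\<lambda>x. 0)))"
proof -
  define n where "n = p - 2"
  have p: "p = n + 2" using assms(3) by (simp add: n_def)
  obtain N r K \<eta> z where "homoclinic_tube \<omega> \<nu> f n N r K \<eta> z"
    using homoclinic_tube_exists[OF assms(1,2,4,5)] by blast
  then interpret homoclinic_tube \<omega> \<nu> f n N r K \<eta> z .
  show ?thesis
    unfolding p
  proof (intro exI[of _ data_ball] conjI ballI allI impI)
    fix u0 assume u0: "u0 \<in> data_ball"
    show "\<exists>u. nls_solution \<omega> \<nu> (n + 2) f u \<and> u 0 = u0"
      by (rule solution_exists[OF u0]) blast
    show "homoclinic_orbit \<omega> \<nu> (n + 2) f u (\<lambda>x. 0)" if "nls_solution \<omega> \<nu> (n + 2) f u \<and> u 0 = u0" for u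
      by (rule solutions_homoclinic) (use that u0 in auto)
  qed (rule wiener_open_data_ball data_ball_nonempty)+
qed

end
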